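(* Consider a stochastic path problem in which every history-dependent deterministic policy is proper and $r(s,a)\ge0$ for all $s,a$ (a stochastic longest path problem). Run algorithm VI-SP (defined in the context) with inputs $B\ge B_\star$ and $\delta\in(0,1)$. Then with probability at least $1-\delta$, for all $K\ge1$, with $T$ being the total number of steps in $K$ episodes, $$\mathrm{Reg}_K=O\left(\sqrt{V_\star B_\star SAK\,\tilde\iota_{T,B,\delta}}+BS^2A\,\tilde\iota_{T,B,\delta}\right),$$ where $\tilde\iota_{T,B,\delta}=(\ln(SA/\delta)+\ln\ln(BT))\times\ln T$.
   Context: Convention: $x=O(y)$ means $x\le cy$ for a universal constant $c$. Stochastic path (SP) problem: finite state set $\mathcal S$ ($S=|\mathcal S|$), finite action set $\mathcal A$ ($A=|\mathcal A|$), initial state $s_{\mathrm{init}}\in\mathcal S$, terminal state $g\notin\mathcal S$, transition kernel $P:\mathcal S\times\mathcal A\to\Delta_{\mathcal S\cup\{g\}}$ (written $P_{s,a}(\cdot)$), reward $r:\mathcal S\times\mathcal A\to[-1,1]$. In an episode, $s_1=s_{\mathrm{init}}$; at step $i$ the player in state $s_i$ takes action $a_i$, gets $r(s_i,a_i)$, and $s_{i+1}\sim P_{s_i,a_i}$; the episode ends upon reaching $g$. Let $\tau=\min\{i:s_{i+1}=g\}$. $\Pi^{\mathrm{HD}}$ is the set of history-dependent deterministic policies. A policy is proper if $g$ is reached with probability 1 from every starting state. $V^\pi(s)=\mathbb E^\pi[\sum_{i=1}^\tau r(s_i,a_i)\mid s_1=s]$, $V^\pi(g)=0$. When all policies in $\Pi^{\mathrm{HD}}$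 are proper, there is a stationary deterministic policy $\pi^\star$ with $V^\star:=V^{\pi^\star}\ge V^\pi$ on all states for all $\pi\in\Pi^{\mathrm{HD}}$. Define $V_\star=|V^\star(s_{\mathrm{init}})|$, $B_\star=\max_s|V^\star(s)|$; both are assumed $\ge1$. Learning protocol: the learner knows $r$ but not $P$ and interacts for $K$ episodes, each starting at $s_{\mathrm{init}}$. Time $t=1,2,\dots$ counts steps across episodes; at time $t$ the learner sees $s_t$, plays $a_t$, and transits to $s_t'\sim P_{s_t,a_t}$; $s_{t+1}=s_t'$ if $s_t'\ne g$, otherwise $s_{t+1}=s_{\mathrm{init}}$ and a new episode starts. Episode $k$ occupies times $t_k,\dots,e_k$, $e_k=t_{k+1}-1$, and $T=e_K$. The regret is $\mathrm{Reg}_K=\sum_{k=1}^K\bigl(V^\star(s_{\mathrm{init}})-\sum_{t=t_k}^{e_k}r(s_t,a_t)\bigr)$. Algorithm VI-SP with inputs $B\ge1$, $\delta\in(0,1)$ and sufficiently large universal constants $c_1,c_2$ with $2c_1^2\le c_2$: initialize counters $n(s,a,s')=n(s,a)=0$, $Q(s,a)=B$, $V(s)=B$ for $s\in\mathcal S$, and $V(g)=0$. At each time $t$: take $a_t=\arg\max_aQ(s_t,a)$ and observe $s_t'$; increment $n(s_t,a_t)$ and $n(s_t,a_t,s_t')$; let $n_t=n(s_t,a_t)$, $\bar P_t(s')=n(s_t,a_t,s')/n_t$, $\iota_t=\ln(SA/\delta)+\ln\ln(Bn_t)$, $b_t=\max\{c_1\sqrt{\mathbb V(\bar P_t,V)\iota_t/n_t},\,c_2B\iota_t/n_t\}$;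 set $Q(s_t,a_t)\leftarrow\min\{r(s_t,a_t)+\bar P_tV+b_t,\ Q(s_t,a_t)\}$ and then $V(s_t)\leftarrow\max_aQ(s_t,a)$. Here $PV=\sum_{s'}P(s')V(s')$ and $\mathbb V(P,V)=\sum_{s'}P(s')V(s')^2-(PV)^2$.
   Formalization: In the algorithm and the bound, ln ln x is read as ln(max{1, ln x}), and ln T in the bound as max{1, ln T}: literally, ln ln(Bn) is undefined at B=n=1 and the bound is 0 at T=1, where regret can be positive. Finite state and action sets are coded as sets of naturals. *)

theory Defs
  imports "HOL-Probability.Probability"
begin

section \<open>Trajectories of a discrete history-dependent random process\<close>

text \<open>
  \<open>trajectories \<kappa>\<close> is the law of the process \<open>\<omega> 0, \<omega> 1, \<dots>\<close> in which \<open>\<omega> i\<close> is drawn from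
  \<open>\<kappa> [\<omega> 0, \<dots>, \<omega> (i - 1)]\<close> (Ionescu-Tulcea).
\<close>

definition trajectories :: "('x list \<Rightarrow> 'x pmf) \<Rightarrow> (nat \<Rightarrow> 'x) measure" where
  "trajectories \<kappa> =
     projective_family.lim UNIV
       (Ionescu_Tulcea.CI (\<lambda>i \<omega>. measure_pmf (\<kappa> (map \<omega> [0..<i]))) (\<lambda>_. count_space UNIV))
       (\<lambda>_. count_space UNIV)"

lemma Ionescu_Tulcea_trajectories:
  fixes \<kappa> :: "'x::countable list \<Rightarrow> 'x pmf"
  shows "Ionescu_Tulcea (\<lambda>i \<omega>. measure_pmf (\<kappa> (map \<omega> [0..<i]))) (\<lambda>_. count_space UNIV)"
proof
  fix i :: nat
  show "(\<lambda>\<omega>. measure_pmf (\<kappa> (map \<omega> [0..<i]))) \<in>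
          PiM {0..<i} (\<lambda>_. count_space UNIV) \<rightarrow>\<^sub>M subprob_algebra (count_space UNIV)"
    by (subst count_space_PiM_finite) (auto intro: measure_pmf_in_subprob_algebra)
qed

lemma prob_space_trajectories:
  fixes \<kappa> :: "'x::countable list \<Rightarrow> 'x pmf"
  shows "prob_space (trajectories \<kappa>)"
proof -
  interpret Ionescu_Tulcea "\<lambda>i \<omega>. measure_pmf (\<kappa> (map \<omega> [0..<i]))" "\<lambda>_. count_space UNIV"
    by (rule Ionescu_Tulcea_trajectories)
  have "prob_space (distr PF.lim (PiM {} (\<lambda>_. count_space UNIV)) (\<lambda>x. restrict x {}))"
    unfolding distr_lim[OF finite.emptyI] by (rule PF.prob_space_P) auto
  then have "prob_space PF.lim"
    by (rule prob_space_distrD[rotated])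
       (auto intro!: measurable_restrict simp: measurable_cong_sets[OF PF.sets_lim refl])
  then show ?thesis
    by (simp add: trajectories_def)
qed

lemma sets_trajectories [measurable_cong]:
  fixes \<kappa> :: "'x::countable list \<Rightarrow> 'x pmf"
  shows "sets (trajectories \<kappa>) = sets (PiM UNIV (\<lambda>_. count_space UNIV))"
proof -
  interpret Ionescu_Tulcea "\<lambda>i \<omega>. measure_pmf (\<kappa> (map \<omega> [0..<i]))" "\<lambda>_. count_space UNIV"
    by (rule Ionescu_Tulcea_trajectories)
  show ?thesis by (simp add: trajectories_def)
qed

lemma space_trajectories [simp]:
  fixes \<kappa> :: "'x::countable list \<Rightarrow> 'x pmf"
  shows "space (trajectories \<kappa>) = UNIV"
  using sets_eq_imp_space_eq[OF sets_trajectories[of \<kappa>]] by (simp add: space_PiM)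

lemma measure_trajectories_prefix:
  fixes \<kappa> :: "'x::countable list \<Rightarrow> 'x pmf"
  shows "measure (trajectories \<kappa>) {\<omega>. map \<omega> [0..<n] = map x [0..<n]} =
           (\<Prod>i<n. pmf (\<kappa> (map x [0..<i])) (x i))"
proof -
  interpret Ionescu_Tulcea "\<lambda>i \<omega>. measure_pmf (\<kappa> (map \<omega> [0..<i]))" "\<lambda>_. count_space UNIV"
    by (rule Ionescu_Tulcea_trajectories)
  let ?M = "\<lambda>_::nat. count_space (UNIV :: 'x set)"
  have discrete: "PiM {0..<n} ?M = count_space (PiE {0..<n} (\<lambda>_. UNIV))" for n
    by (rule count_space_PiM_finite) auto
  have C: "emeasure (C 0 n (\<lambda>_. undefined)) {restrict x {0..<n}} =
      ennreal (\<Prod>i<n. pmf (\<kappa> (map x [0..<i])) (x i))"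
  proof (induction n)
    case 0
    then show ?case by (simp add: PiM_empty restrict_def)
  next
    case (Suc n)
    let ?\<mu> = "C 0 n (\<lambda>_. undefined)"
    have sets_\<mu>: "sets ?\<mu> = sets (PiM {0..<n} ?M)"
      using sets_C[of "\<lambda>_. undefined" 0 n] by (simp add: space_PiM)
    have space_\<mu>: "space ?\<mu> = PiE {0..<n} (\<lambda>_. UNIV)"
      using sets_eq_imp_space_eq[OF sets_\<mu>] by (simp add: space_PiM)
    have "emeasure (C 0 (Suc n) (\<lambda>_. undefined)) {restrict x {0..<Suc n}}
        = (\<integral>\<^sup>+ y. emeasure (eP n y) {restrict x {0..<Suc n}} \<partial>?\<mu>)"
      using measurable_eP[of n]
      by (simp, intro emeasure_bind[where N="PiM {0..<Suc n} ?M"])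
         (auto simp: space_\<mu> PiE_eq_empty_iff discrete measurable_cong_sets[OF sets_\<mu> refl] simp del: restrict_apply)
    also have "\<dots> = (\<integral>\<^sup>+ y. ennreal (pmf (\<kappa> (map x [0..<n])) (x n)) * indicator {restrict x {0..<n}} y \<partial>?\<mu>)"
    proof (rule nn_integral_cong)
      fix y assume y: "y \<in> space ?\<mu>"
      then have yE: "y \<in> PiE {0..<n} (\<lambda>_. UNIV)" by (simp add: space_\<mu>)
      have "emeasure (eP n y) {restrict x {0..<Suc n}} =
          emeasure (measure_pmf (\<kappa> (map y [0..<n]))) ((\<lambda>z. fun_upd y n z) -` {restrict x {0..<Suc n}})"
        using yE by (subst emeasure_eP) (auto simp: discrete space_PiM)
      also have "(\<lambda>z. fun_upd y n z) -` {restrict x {0..<Suc n}} =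
          (if y = restrict x {0..<n} then {x n} else {})"
        using yE by (auto simp: fun_eq_iff PiE_def extensional_def restrict_def split: if_splits)
           (metis less_Suc_eq less_irrefl_nat)+
      finally have eq: "emeasure (eP n y) {restrict x {0..<Suc n}} =
          emeasure (measure_pmf (\<kappa> (map y [0..<n]))) (if y = restrict x {0..<n} then {x n} else {})" .
      have \<kappa>: "\<kappa> (map (restrict x {0..<n}) [0..<n]) = \<kappa> (map x [0..<n])"
        by (rule arg_cong[where f=\<kappa>]) simp
      show "emeasure (eP n y) {restrict x {0..<Suc n}} =
          ennreal (pmf (\<kappa> (map x [0..<n])) (x n)) * indicator {restrict x {0..<n}} y"
        unfolding eq by (cases "y = restrict x {0..<n}") (simp_all add: emeasure_pmf_single \<kappa> del: restrict_apply map_eq_conv)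
    qed
    also have "\<dots> = ennreal (\<Prod>i<Suc n. pmf (\<kappa> (map x [0..<i])) (x i))"
      by (subst nn_integral_cmult_indicator)
         (auto simp: sets_\<mu> discrete Suc.IH ennreal_mult'[symmetric] mult.commute prod_nonneg)
    finally show ?case .
  qed
  have "{\<omega>. map \<omega> [0..<n] = map x [0..<n]} = PF.emb UNIV {0..<n} {restrict x {0..<n}}"
    by (auto simp: prod_emb_def space_PiM fun_eq_iff restrict_def split: if_splits)
  moreover have "emeasure PF.lim (PF.emb UNIV {0..<n} {restrict x {0..<n}}) =
      emeasure (C 0 n (\<lambda>_. undefined)) {restrict x {0..<n}}"
    by (subst lim) (auto simp: discrete emeasure_CI[of _ n] prod_emb_id)
  ultimately have "emeasure (trajectories \<kappa>) {\<omega>. map \<omega> [0..<n] = map x [0..<n]} =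
      ennreal (\<Prod>i<n. pmf (\<kappa> (map x [0..<i])) (x i))"
    using C by (simp add: trajectories_def)
  then show ?thesis
    by (simp add: measure_def prod_nonneg)
qed


section \<open>Stochastic path problems\<close>

text \<open>
  The terminal state \<open>g\<close> is \<^const>\<open>None\<close>. States and actions are carrier sets, not finite types, so
  that over a fixed infinite type one constant can be claimed for problems of all sizes: a constant
  chosen in a statement polymorphic in finite types could depend on their cardinalities.
\<close>

record ('s, 'a) path_problem =
  states :: "'s set"
  actions :: "'a set"
  init :: 's
  trans :: "'s \<Rightarrow> 'a \<Rightarrow> 's option pmf"
  reward :: "'s \<Rightarrow> 'a \<Rightarrow> real"

definition stochastic_path :: "('s, 'a) path_problem \<Rightarrow> bool" where
  "stochastic_path M \<longleftrightarrow>
     finite (states M) \<and> finite (actions M) \<and> actions M \<noteq> {} \<and> init M \<in> states M \<and>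
     (\<forall>s\<in>states M. \<forall>a\<in>actions M.
        set_pmf (trans M s a) \<subseteq> insert None (Some ` states M) \<and> reward M s a \<in> {-1..1})"

text \<open>
  A policy maps the past state-action pairs \<open>[(s\<^sub>1,a\<^sub>1), \<dots>, (s\<^sub>i\<^sub>-\<^sub>1,a\<^sub>i\<^sub>-\<^sub>1)]\<close> of the episode and the
  current state \<open>s\<^sub>i\<close> to the action \<open>a\<^sub>i\<close>.
\<close>

type_synonym ('s, 'a) policy = "('s \<times> 'a) list \<Rightarrow> 's \<Rightarrow> 'a"

definition HD_policies :: "('s, 'a) path_problem \<Rightarrow> ('s, 'a) policy set" where
  "HD_policies M = {\<pi>. \<forall>h. \<forall>s\<in>states M. \<pi> h s \<in> actions M}"

text \<open>
  In the law of a single episode started at \<open>s\<close>, \<open>\<omega> i\<close> is \<open>Some (s\<^sub>i\<^sub>+\<^sub>1, a\<^sub>i\<^sub>+\<^sub>1)\<close> until the terminal state is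
  reached and \<^const>\<open>None\<close> afterwards.
\<close>

definition episode_step ::
    "('s, 'a) path_problem \<Rightarrow> ('s, 'a) policy \<Rightarrow> 's \<Rightarrow> ('s \<times> 'a) option list \<Rightarrow> ('s \<times> 'a) option pmf"
where
  "episode_step M \<pi> s h =
     (if h = [] then return_pmf (Some (s, \<pi> [] s))
      else case last h of
        None \<Rightarrow> return_pmf None
      | Some (s', a') \<Rightarrow> map_pmf (map_option (\<lambda>x. (x, \<pi> (map the h) x))) (trans M s' a'))"

definition episode ::
    "('s, 'a) path_problem \<Rightarrow> ('s, 'a) policy \<Rightarrow> 's \<Rightarrow> (nat \<Rightarrow> ('s \<times> 'a) option) measure"
where
  "episode M \<pi> s = trajectories (episode_step M \<pi> s)"

definition episode_length :: "(nat \<Rightarrow> ('s \<times> 'a) option) \<Rightarrow> nat" where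
  "episode_length \<omega> = (LEAST i. \<omega> i = None)"

definition proper :: "('s, 'a) path_problem \<Rightarrow> ('s, 'a) policy \<Rightarrow> bool" where
  "proper M \<pi> \<longleftrightarrow> (\<forall>s\<in>states M. AE \<omega> in episode M \<pi> s. \<exists>i. \<omega> i = None)"

definition policy_value :: "('s, 'a) path_problem \<Rightarrow> ('s, 'a) policy \<Rightarrow> 's \<Rightarrow> real" where
  "policy_value M \<pi> s =
     (LINT \<omega>|episode M \<pi> s. (\<Sum>i<episode_length \<omega>. case_prod (reward M) (the (\<omega> i))))"

definition optimal_stationary :: "('s, 'a) path_problem \<Rightarrow> ('s \<Rightarrow> 'a) \<Rightarrow> bool" where
  "optimal_stationary M p \<longleftrightarrow>
     (\<forall>s\<in>states M. p s \<in> actions M) \<and>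
     (\<forall>\<pi>\<in>HD_policies M. \<forall>s\<in>states M. policy_value M \<pi> s \<le> policy_value M (\<lambda>_. p) s)"

text \<open>
  All optimal stationary policies have the same value function on \<^const>\<open>states\<close>, so the choice is
  immaterial; one exists whenever all history-dependent deterministic policies are proper.
\<close>

definition opt_value :: "('s, 'a) path_problem \<Rightarrow> 's \<Rightarrow> real" where
  "opt_value M = policy_value M (\<lambda>_. SOME p. optimal_stationary M p)"

definition V_star :: "('s, 'a) path_problem \<Rightarrow> real" where
  "V_star M = \<bar>opt_value M (init M)\<bar>"

definition B_star :: "('s, 'a) path_problem \<Rightarrow> real" where
  "B_star M = Max ((\<lambda>s. \<bar>opt_value M s\<bar>) ` states M)"


section \<open>Learning protocol\<close>

text \<open>
  A transition is a triple \<open>(s\<^sub>t, a\<^sub>t, s\<^sub>t')\<close>; a learner maps the past transitions, oldest first and across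
  episodes, and the current state to an action. In the law of the interaction, \<open>\<omega> t\<close> is the transition
  at time \<open>t + 1\<close>.
\<close>

type_synonym ('s, 'a) transition = "'s \<times> 'a \<times> 's option"

type_synonym ('s, 'a) learner = "('s, 'a) transition list \<Rightarrow> 's \<Rightarrow> 'a"

definition current_state :: "('s, 'a) path_problem \<Rightarrow> ('s, 'a) transition list \<Rightarrow> 's" where
  "current_state M h =
     (if h = [] then init M
      else case last h of (_, _, None) \<Rightarrow> init M | (_, _, Some s') \<Rightarrow> s')"

definition learning_step ::
    "('s, 'a) path_problem \<Rightarrow> ('s, 'a) learner \<Rightarrow> ('s, 'a) transition list \<Rightarrow> ('s, 'a) transition pmf"
where
  "learning_step M L h =
     (let s = current_state M h; a = L h s in map_pmf (\<lambda>x. (s, a, x)) (trans M s a))"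

definition learning ::
    "('s, 'a) path_problem \<Rightarrow> ('s, 'a) learner \<Rightarrow> (nat \<Rightarrow> ('s, 'a) transition) measure"
where
  "learning M L = trajectories (learning_step M L)"

definition reaches_goal :: "('s, 'a) transition \<Rightarrow> bool" where
  "reaches_goal x \<longleftrightarrow> snd (snd x) = None"

text \<open>
  \<open>ep_end \<omega> k\<close> is \<open>e\<^sub>k\<close>, the number of steps in the first \<open>k\<close> episodes. As \<open>\<omega>\<close> is indexed from 0,
  episode \<open>k\<close> consists of the transitions \<open>\<omega> t\<close> with \<open>ep_end \<omega> (k - 1) \<le> t < ep_end \<omega> k\<close>.
\<close>

primrec ep_end :: "(nat \<Rightarrow> ('s, 'a) transition) \<Rightarrow> nat \<Rightarrow> nat" where
  "ep_end \<omega> 0 = 0"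
| "ep_end \<omega> (Suc k) = Suc (LEAST t. ep_end \<omega> k \<le> t \<and> reaches_goal (\<omega> t))"

definition regret :: "('s, 'a) path_problem \<Rightarrow> (nat \<Rightarrow> ('s, 'a) transition) \<Rightarrow> nat \<Rightarrow> real" where
  "regret M \<omega> K =
     (\<Sum>k=1..K. opt_value M (init M) -
        (\<Sum>t\<in>{ep_end \<omega> (k - 1)..<ep_end \<omega> k}. case \<omega> t of (s, a, _) \<Rightarrow> reward M s a))"


section \<open>Algorithm VI-SP\<close>

text \<open>
  The iterated logarithm, read as 0 for \<open>x \<le> exp 1\<close>: \<open>ln (ln x)\<close> is undefined at \<open>x = 1\<close> and
  arbitrarily negative near it, which would make the exploration bonus vanish when \<open>B * n\<close> is close to 1.
\<close>

definition lnln :: "real \<Rightarrow> real" where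
  "lnln x = ln (max 1 (ln x))"

definition log_term :: "('s, 'a) path_problem \<Rightarrow> real \<Rightarrow> real \<Rightarrow> real" where
  "log_term M \<delta> x = ln (real (card (states M)) * real (card (actions M)) / \<delta>) + lnln x"

record ('s, 'a) vi_memory =
  cnt :: "'s \<Rightarrow> 'a \<Rightarrow> 's option \<Rightarrow> nat"
  tot :: "'s \<Rightarrow> 'a \<Rightarrow> nat"
  Qval :: "'s \<Rightarrow> 'a \<Rightarrow> real"
  Vval :: "'s option \<Rightarrow> real"

definition vi_init :: "real \<Rightarrow> ('s, 'a) vi_memory" where
  "vi_init B =
     \<lparr>cnt = (\<lambda>_ _ _. 0), tot = (\<lambda>_ _. 0), Qval = (\<lambda>_ _. B),
      Vval = (\<lambda>x. if x = None then 0 else B)\<rparr>"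

definition mean_on :: "'x set \<Rightarrow> ('x \<Rightarrow> real) \<Rightarrow> ('x \<Rightarrow> real) \<Rightarrow> real" where
  "mean_on X p v = (\<Sum>x\<in>X. p x * v x)"

definition variance_on :: "'x set \<Rightarrow> ('x \<Rightarrow> real) \<Rightarrow> ('x \<Rightarrow> real) \<Rightarrow> real" where
  "variance_on X p v = mean_on X p (\<lambda>x. (v x)\<^sup>2) - (mean_on X p v)\<^sup>2"

text \<open>Of the problem \<open>M\<close>, the update uses the states, the actions and the rewards, but not the kernel.\<close>

definition vi_update ::
    "('s, 'a) path_problem \<Rightarrow> real \<Rightarrow> real \<Rightarrow> real \<Rightarrow> real \<Rightarrow>
     ('s, 'a) transition \<Rightarrow> ('s, 'a) vi_memory \<Rightarrow> ('s, 'a) vi_memory"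
where
  "vi_update M c1 c2 B \<delta> = (\<lambda>(s, a, s') m.
     let
       X = insert None (Some ` states M);
       N = (tot m)(s := (tot m s)(a := tot m s a + 1));
       N' = (cnt m)(s := (cnt m s)(a := (cnt m s a)(s' := cnt m s a s' + 1)));
       n = real (N s a);
       P = (\<lambda>x. real (N' s a x) / n);
       \<iota> = log_term M \<delta> (B * n);
       b = max (c1 * sqrt (variance_on X P (Vval m) * \<iota> / n)) (c2 * B * \<iota> / n);
       q = min (reward M s a + mean_on X P (Vval m) + b) (Qval m s a);
       Q = (Qval m)(s := (Qval m s)(a := q));
       V = (Vval m)(Some s := Max (Q s ` actions M))
     in \<lparr>cnt = N', tot = N, Qval = Q, Vval = V\<rparr>)"

definition vi_run ::
    "('s, 'a) path_problem \<Rightarrow> real \<Rightarrow> real \<Rightarrow> real \<Rightarrow> real \<Rightarrow> ('s, 'a) transition list \<Rightarrow> ('s, 'a) vi_memory"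
where
  "vi_run M c1 c2 B \<delta> h = fold (vi_update M c1 c2 B \<delta>) h (vi_init B)"

text \<open>A learner runs VI-SP if its action always maximizes \<open>Q\<close>; ties may be broken in any way.\<close>

definition runs_VI_SP ::
    "('s, 'a) path_problem \<Rightarrow> real \<Rightarrow> real \<Rightarrow> real \<Rightarrow> real \<Rightarrow> ('s, 'a) learner \<Rightarrow> bool"
where
  "runs_VI_SP M c1 c2 B \<delta> L \<longleftrightarrow>
     (\<forall>h. \<forall>s\<in>states M.
        is_arg_max (Qval (vi_run M c1 c2 B \<delta> h) s) (\<lambda>a. a \<in> actions M) (L h s))"

text \<open>
  The factor \<open>ln T\<close> is read as \<open>max 1 (ln T)\<close>. This matters only for \<open>T \<le> 2\<close>; with the
  literal value 0 at \<open>T = 1\<close> the regret would have to be nonpositive whenever the first episode consists of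
  a single step.
\<close>

definition log_factor :: "('s, 'a) path_problem \<Rightarrow> real \<Rightarrow> real \<Rightarrow> nat \<Rightarrow> real" where
  "log_factor M B \<delta> T = log_term M \<delta> (B * real T) * max 1 (ln (real T))"

end

theory Submission
  imports Defs "HOL-Real_Asymp.Real_Asymp"
begin

text \<open>
  The optimal value \<open>U\<close> is the limit of value iteration, which is bounded because the expected hitting
  time of the terminal state is bounded over all policies.

  The condition \<open>2 * c1\<^sup>2 \<le> c2\<close> makes the update of VI-SP monotone in \<open>V\<close>, so an empirical
  Bernstein bound for the single function \<open>U\<close> keeps \<open>V\<^sub>t\<close> above \<open>U\<close> for ever. As \<open>V\<^sub>t\<close> decreases from
  \<open>B\<close>, telescoping \<open>V\<^sub>t\<close> along the run bounds the regret, up to \<open>O(B * S * A)\<close>, by the estimation errors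
  of \<open>P V\<^sub>t\<close>, the bonuses and a martingale. By Cauchy-Schwarz these are controlled by the sums over
  time of the variances of \<open>U\<close> and of \<open>W\<^sub>t = V\<^sub>t - U\<close>. The former is at most of order
  \<open>V_star * B_star * K\<close> since \<open>U\<close> is a nonnegative supermartingale within an episode; the latter
  is bounded in terms of itself and absorbed.

  All concentration bounds come from Ville's inequality. The confidence level \<open>\<delta>\<close> is reached
  because \<open>ln (S * A / \<delta>)\<close> is bounded away from 0, except when \<open>S = A = 1\<close> and \<open>\<delta>\<close> is close to 1.
  There nothing has to be learned, and the event is constructed directly.
\<close>

subsection \<open>Trajectories and Ville's inequality\<close>

text \<open>The estimate \<open>V t\<close> depends on the data behind \<open>emp t\<close>, so no
  concentration bound applies to its mean under \<open>emp t\<close>. Hence the split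
  \<open>V t = U + W t\<close>. The fixed function \<open>U\<close> gets an empirical Bernstein
  bound for each pair, with its own variance. For \<open>W t\<close> the kernel is compared entry by
  entry, and Cauchy-Schwarz over the successors costs a factor of order \<open>sqrt N\<close>. This
  is the origin of the squared number of states; it stays in the lower-order term because the
  contribution \<open>H\<close> of \<open>W\<close> is at most the leading term \<open>F\<close>
  plus a multiple of \<open>B * G\<close>. Under the true kernel \<open>V t\<close> is fixed by the
  past, so martingale bounds apply to it directly. The concentration bounds carry
  \<open>ln (1 / p) + 3 + 2 * lnln n\<close>, whereas the claim offers only multiples of
  \<open>log_term\<close>. Absorbing the additive 3 needs a positive lower bound on
  \<open>ln (S * A / \<delta>)\<close>. The threshold used is 1/8; it can fail only for a single
  pair with \<delta> above 7/8.\<close>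

primrec prefix_pmf :: "('x list \<Rightarrow> 'x pmf) \<Rightarrow> nat \<Rightarrow> 'x list pmf" where
  "prefix_pmf \<kappa> 0 = return_pmf []"
| "prefix_pmf \<kappa> (Suc n) = bind_pmf (prefix_pmf \<kappa> n) (\<lambda>h. map_pmf (\<lambda>x. h @ [x]) (\<kappa> h))"

text \<open>Conditioning on the first outcome instead of the last: what follows is a process of the
  same kind, with the kernel shifted by \<open>x\<close>. The induction for Ville's inequality runs
  in this direction.\<close>

lemma prefix_pmf_Suc_Cons:
  "prefix_pmf \<kappa> (Suc n) =
     bind_pmf (\<kappa> []) (\<lambda>x. map_pmf ((#) x) (prefix_pmf (\<lambda>h. \<kappa> (x # h)) n))"
proof (induction n)
  case 0
  then show ?case by (simp add: bind_return_pmf map_pmf_def)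
next
  case (Suc n)
  have "prefix_pmf \<kappa> (Suc (Suc n)) =
      bind_pmf (prefix_pmf \<kappa> (Suc n)) (\<lambda>h. map_pmf (\<lambda>x. h @ [x]) (\<kappa> h))"
    by simp
  also have "\<dots> = bind_pmf (\<kappa> []) (\<lambda>x. map_pmf ((#) x) (prefix_pmf (\<lambda>h. \<kappa> (x # h)) (Suc n)))"
    unfolding Suc
    by (simp add: bind_assoc_pmf bind_map_pmf map_bind_pmf map_pmf_comp)
  finally show ?case .
qed

lemma set_prefix_pmf:
  assumes "h \<in> set_pmf (prefix_pmf \<kappa> n)"
  shows "length h = n" "\<And>i. i < n \<Longrightarrow> h ! i \<in> set_pmf (\<kappa> (take i h))"
proof -
  have "length h = n \<and> (\<forall>i<n. h ! i \<in> set_pmf (\<kappa> (take i h)))"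
    using assms by (induction n arbitrary: h) (force simp: nth_append less_Suc_eq)+
  then show "length h = n" "\<And>i. i < n \<Longrightarrow> h ! i \<in> set_pmf (\<kappa> (take i h))" by auto
qed

lemma pmf_prefix_pmf:
  "pmf (prefix_pmf \<kappa> n) (map x [0..<n]) = (\<Prod>i<n. pmf (\<kappa> (map x [0..<i])) (x i))"
proof (induction n)
  case (Suc n)
  let ?h = "map x [0..<n]"
  have *: "pmf (map_pmf (\<lambda>y. h @ [y]) (\<kappa> h)) (?h @ [x n]) = indicator {?h} h * pmf (\<kappa> ?h) (x n)" for h
  proof (cases "h = ?h")
    case True
    have "inj (\<lambda>y. ?h @ [y])" by (simp add: inj_def)
    then have "pmf (map_pmf (\<lambda>y. ?h @ [y]) (\<kappa> ?h)) (?h @ [x n]) = pmf (\<kappa> ?h) (x n)"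
      by (rule pmf_map_inj')
    with True show ?thesis by simp
  next
    case False
    then have "?h @ [x n] \<notin> set_pmf (map_pmf (\<lambda>y. h @ [y]) (\<kappa> h))" by auto
    with False show ?thesis by (simp add: pmf_eq_0_set_pmf del: set_map_pmf)
  qed
  have "pmf (prefix_pmf \<kappa> (Suc n)) (map x [0..<Suc n]) =
      (\<integral>h. indicator {?h} h * pmf (\<kappa> ?h) (x n) \<partial>measure_pmf (prefix_pmf \<kappa> n))"
    by (simp add: pmf_bind *)
  also have "\<dots> = pmf (prefix_pmf \<kappa> n) ?h * pmf (\<kappa> ?h) (x n)"
    by (simp add: measure_pmf_single)
  finally show ?case using Suc by simp
qed simp

lemma measurable_nth [measurable]:
  fixes \<kappa> :: "'x::countable list \<Rightarrow> 'x pmf"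
  shows "(\<lambda>\<omega>. \<omega> i) \<in> trajectories \<kappa> \<rightarrow>\<^sub>M count_space UNIV"
  unfolding measurable_cong_sets[OF sets_trajectories refl]
          by (rule measurable_component_singleton) simp

lemma measurable_prefix [measurable]:
  fixes \<kappa> :: "'x::countable list \<Rightarrow> 'x pmf"
  shows "(\<lambda>\<omega>. map \<omega> [0..<n]) \<in> trajectories \<kappa> \<rightarrow>\<^sub>M count_space UNIV"
proof (induction n)
  case (Suc n)
  have "(\<lambda>\<omega>. (\<lambda>x \<omega>. (\<lambda>y \<omega>. x @ [y]) (\<omega> n) \<omega>) (map \<omega> [0..<n]) \<omega>) \<in> trajectories \<kappa> \<rightarrow>\<^sub>M count_space UNIV"
    by (rule measurable_compose_countable[OF measurable_compose_countable[OF _ measurable_nth] Suc]) simp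
  then show ?case by simp
qed simp

text \<open>The bridge from the measure on infinite sequences to discrete laws. Lists over a
  countable type are countable, so agreement on singletons suffices, and every list of length
  \<open>n\<close> is the prefix of some sequence.\<close>

lemma distr_prefix:
  fixes \<kappa> :: "'x::countable list \<Rightarrow> 'x pmf"
  shows "distr (trajectories \<kappa>) (count_space UNIV) (\<lambda>\<omega>. map \<omega> [0..<n]) = measure_pmf (prefix_pmf \<kappa> n)"
proof (rule measure_eqI_countable[where A = UNIV])
  fix l :: "'x list"
  interpret prob_space "trajectories \<kappa>" by (rule prob_space_trajectories)
  have "emeasure (distr (trajectories \<kappa>) (count_space UNIV) (\<lambda>\<omega>. map \<omega> [0..<n])) {l} =
      emeasure (trajectories \<kappa>) {\<omega>. map \<omega> [0..<n] = l}"
    by (subst emeasure_distr) (auto intro!: arg_cong[where f = "emeasure _"])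
  also have "\<dots> = ennreal (pmf (prefix_pmf \<kappa> n) l)"
  proof (cases "length l = n")
    case True
    then have l: "l = map (nth l) [0..<n]" using map_nth[of l] by simp
    show ?thesis
      unfolding emeasure_eq_measure
      by (subst (1 2) l) (simp only: measure_trajectories_prefix pmf_prefix_pmf)
  next
    case False
    then have "{\<omega>. map \<omega> [0..<n] = l} = {}" "pmf (prefix_pmf \<kappa> n) l = 0"
      by (auto simp: pmf_eq_0_set_pmf dest: set_prefix_pmf)
    then show ?thesis by simp
  qed
  finally show "emeasure (distr (trajectories \<kappa>) (count_space UNIV) (\<lambda>\<omega>. map \<omega> [0..<n])) {l} =
      emeasure (measure_pmf (prefix_pmf \<kappa> n)) {l}"
    by (simp add: emeasure_pmf_single)
qed auto

text \<open>The tower property, conditioning on the first \<open>n\<close> outcomes. Boundedness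
  keeps the inner integrals finite, so that both sides can be compared as nonnegative
  integrals.\<close>

lemma expectation_prefix_Suc:
  fixes \<kappa> :: "'x::countable list \<Rightarrow> 'x pmf" and f :: "'x list \<Rightarrow> real"
  assumes f: "\<And>h. 0 \<le> f h" "\<And>h. f h \<le> C"
  shows "(LINT \<omega>|trajectories \<kappa>. f (map \<omega> [0..<Suc n])) =
         (LINT \<omega>|trajectories \<kappa>. (LINT x|\<kappa> (map \<omega> [0..<n]). f (map \<omega> [0..<n] @ [x])))"
proof -
  have inner: "ennreal (LINT x|\<kappa> h. f (h @ [x])) = (\<integral>\<^sup>+x. ennreal (f (h @ [x])) \<partial>\<kappa> h)" for h
    by (rule nn_integral_eq_integral[symmetric])
       (auto intro!: measure_pmf.integrable_const_bound[where B = C] simp: f)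
  have "(LINT \<omega>|trajectories \<kappa>. f (map \<omega> [0..<Suc n])) = (LINT h|prefix_pmf \<kappa> (Suc n). f h)"
    by (subst distr_prefix[symmetric], subst integral_distr) auto
  also have "\<dots> = enn2real (\<integral>\<^sup>+h. ennreal (f h) \<partial>prefix_pmf \<kappa> (Suc n))"
    by (rule integral_eq_nn_integral) (auto simp: f)
  also have "\<dots> = enn2real (\<integral>\<^sup>+h. ennreal (LINT x|\<kappa> h. f (h @ [x])) \<partial>prefix_pmf \<kappa> n)"
    by (simp add: inner)
  also have "\<dots> = (LINT h|prefix_pmf \<kappa> n. LINT x|\<kappa> h. f (h @ [x]))"
    by (rule integral_eq_nn_integral[symmetric]) (auto simp: f intro!: Bochner_Integration.integral_nonneg)
  also have "\<dots> = (LINT \<omega>|trajectories \<kappa>. (LINT x|\<kappa> (map \<omega> [0..<n]). f (map \<omega> [0..<n] @ [x])))"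
    by (subst distr_prefix[symmetric], subst integral_distr) auto
  finally show ?thesis .
qed

text \<open>For each time this is an event on a finite prefix, and there are countably many times.
  It turns facts about supports of kernels into almost sure facts about paths.\<close>

lemma AE_trajectories_support:
  fixes \<kappa> :: "'x::countable list \<Rightarrow> 'x pmf"
  shows "AE \<omega> in trajectories \<kappa>. \<forall>t. \<omega> t \<in> set_pmf (\<kappa> (map \<omega> [0..<t]))"
proof (rule AE_all_countable[THEN iffD2, rule_format])
  fix t
  have "AE h in prefix_pmf \<kappa> (Suc t). h ! t \<in> set_pmf (\<kappa> (take t h))"
    by (auto simp del: prefix_pmf.simps simp: AE_measure_pmf_iff dest: set_prefix_pmf)
  then have "AE h in distr (trajectories \<kappa>) (count_space UNIV) (\<lambda>\<omega>. map \<omega> [0..<Suc t]).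
      h ! t \<in> set_pmf (\<kappa> (take t h))"
    unfolding distr_prefix .
  then have "AE \<omega> in trajectories \<kappa>.
      map \<omega> [0..<Suc t] ! t \<in> set_pmf (\<kappa> (take t (map \<omega> [0..<Suc t])))"
    by (subst (asm) AE_distr_iff) (auto simp del: upt_Suc)
  then show "AE \<omega> in trajectories \<kappa>. \<omega> t \<in> set_pmf (\<kappa> (map \<omega> [0..<t]))"
    by (simp add: take_map nth_append)
qed

text \<open>Induction on the first step replaces a stopping time: after a first factor
  \<open>X [] x\<close> the rest of the product must reach \<open>a / X [] x\<close>, which has
  probability at most \<open>X [] x / a\<close>, and averaging over \<open>x\<close> gives
  \<open>1 / a\<close>. This is why kernel, factors and level are all generalized.\<close>

lemma ville_prefix_pmf:
  fixes \<kappa> :: "'x list \<Rightarrow> 'x pmf" and X :: "'x list \<Rightarrow> 'x \<Rightarrow> real"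
  assumes "\<And>h x. 0 \<le> X h x" and "\<And>h. (\<integral>\<^sup>+x. ennreal (X h x) \<partial>\<kappa> h) \<le> 1" and "0 < a"
  shows "emeasure (prefix_pmf \<kappa> n) {l. \<exists>m\<le>length l. a \<le> (\<Prod>t<m. X (take t l) (l ! t))} \<le> ennreal (1 / a)"
  using assms
proof (induction n arbitrary: \<kappa> X a)
  case 0
  show ?case
  proof (cases "a \<le> 1")
    case True
    then have "1 \<le> ennreal (1 / a)" using 0 by simp
    then show ?thesis
      using measure_pmf.emeasure_le_1 order_trans by blast
  next
    case False
    then show ?thesis by simp
  qed
next
  case (Suc n)
  show ?case
  proof (cases "a \<le> 1")
    case True
    then have "1 \<le> ennreal (1 / a)" using Suc by simp
    then show ?thesis
      using measure_pmf.emeasure_le_1 order_trans by blast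
  next
    case False
    let ?A = "{l. \<exists>m\<le>length l. a \<le> (\<Prod>t<m. X (take t l) (l ! t))}"
    let ?X = "\<lambda>x h. X (x # h)"
    let ?A' = "\<lambda>x b. {l. \<exists>m\<le>length l. b \<le> (\<Prod>t<m. ?X x (take t l) (l ! t))}"
    have A: "((#) x) -` ?A \<subseteq> (if X [] x = 0 then {} else ?A' x (a / X [] x))" for x
    proof
      fix l assume "l \<in> ((#) x) -` ?A"
      then obtain m where m: "m \<le> Suc (length l)" "a \<le> (\<Prod>t<m. X (take t (x # l)) ((x # l) ! t))"
        by auto
      \<comment> \<open>The empty product is 1, which is below \<open>a\<close> in this case, so at
        least one factor is used.\<close>
      then obtain m' where m': "m = Suc m'"
        using False by (cases m) auto
      have a: "a \<le> X [] x * (\<Prod>t<m'. ?X x (take t l) (l ! t))"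
        using m(2) unfolding m' prod.lessThan_Suc_shift by simp
      then have "X [] x > 0"
        using Suc.prems(1)[of "[]" x] Suc.prems(3) by (cases "X [] x = 0") auto
      with a m m' show "l \<in> (if X [] x = 0 then {} else ?A' x (a / X [] x))"
        by (auto simp: divide_le_eq mult.commute intro!: exI[of _ m'])
    qed
    have "emeasure (prefix_pmf \<kappa> (Suc n)) ?A =
        (\<integral>\<^sup>+x. emeasure (prefix_pmf (\<lambda>h. \<kappa> (x # h)) n) (((#) x) -` ?A) \<partial>\<kappa> [])"
      unfolding prefix_pmf_Suc_Cons emeasure_bind_pmf by (simp add: emeasure_map_pmf)
    also have "\<dots> \<le> (\<integral>\<^sup>+x. ennreal (1 / a) * ennreal (X [] x) \<partial>\<kappa> [])"
    proof (rule nn_integral_mono)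
      fix x
      have "emeasure (prefix_pmf (\<lambda>h. \<kappa> (x # h)) n) (((#) x) -` ?A)
          \<le> emeasure (prefix_pmf (\<lambda>h. \<kappa> (x # h)) n) (if X [] x = 0 then {} else ?A' x (a / X [] x))"
        by (rule emeasure_mono[OF A]) auto
      also have "\<dots> \<le> ennreal (1 / a * X [] x)"
      proof (cases "X [] x = 0")
        case False
        then have "0 < a / X [] x" using Suc.prems(1)[of "[]" x] Suc.prems(3) by simp
        then have "emeasure (prefix_pmf (\<lambda>h. \<kappa> (x # h)) n) (?A' x (a / X [] x)) \<le> ennreal (1 / (a / X [] x))"
          by (intro Suc.IH Suc.prems(1,2))
        then show ?thesis using False by simp
      qed simp
      finally show "emeasure (prefix_pmf (\<lambda>h. \<kappa> (x # h)) n) (((#) x) -` ?A)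
          \<le> ennreal (1 / a) * ennreal (X [] x)"
        using Suc.prems(1,3) by (simp only: ennreal_mult'[symmetric] zero_le_divide_1_iff less_imp_le)
    qed
    also have "\<dots> = ennreal (1 / a) * (\<integral>\<^sup>+x. ennreal (X [] x) \<partial>\<kappa> [])"
      by (rule nn_integral_cmult) simp
    also have "\<dots> \<le> ennreal (1 / a)"
      using mult_left_mono[OF Suc.prems(2)[of "[]"], of "ennreal (1 / a)"] by simp
    finally show ?thesis .
  qed
qed

lemma measurable_prefix_fun:
  fixes \<kappa> :: "'x::countable list \<Rightarrow> 'x pmf" and Y :: "'x list \<Rightarrow> 'x \<Rightarrow> 'b::topological_space"
  shows "(\<lambda>\<omega>. Y (map \<omega> [0..<t]) (\<omega> t)) \<in> borel_measurable (trajectories \<kappa>)"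
proof -
  have "(\<lambda>h. Y (take t h) (h ! t)) \<circ> (\<lambda>\<omega>. map \<omega> [0..<Suc t]) \<in> borel_measurable (trajectories \<kappa>)"
    by (rule measurable_comp[OF measurable_prefix]) simp
  then show ?thesis
    by (simp add: comp_def take_map nth_append)
qed

text \<open>The events of crossing by time \<open>N\<close> increase with \<open>N\<close>, so the
  bound for finite horizons passes to their union by continuity from below.\<close>

lemma ville:
  fixes \<kappa> :: "'x::countable list \<Rightarrow> 'x pmf" and X :: "'x list \<Rightarrow> 'x \<Rightarrow> real"
  assumes "\<And>h x. 0 \<le> X h x" and "\<And>h. (\<integral>\<^sup>+x. ennreal (X h x) \<partial>\<kappa> h) \<le> 1" and "0 < a"
  shows "measure (trajectories \<kappa>)
           {\<omega> \<in> space (trajectories \<kappa>). \<exists>n. a \<le> (\<Prod>t<n. X (map \<omega> [0..<t]) (\<omega> t))} \<le> 1 / a"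
proof -
  interpret prob_space "trajectories \<kappa>" by (rule prob_space_trajectories)
  let ?E = "\<lambda>N. {\<omega> \<in> space (trajectories \<kappa>). \<exists>n\<le>N. a \<le> (\<Prod>t<n. X (map \<omega> [0..<t]) (\<omega> t))}"
  have E: "emeasure (trajectories \<kappa>) (?E N) \<le> ennreal (1 / a)" for N
  proof -
    let ?A = "{l. \<exists>m\<le>length l. a \<le> (\<Prod>t<m. X (take t l) (l ! t))}"
    have "?E N = (\<lambda>\<omega>. map \<omega> [0..<N]) -` ?A \<inter> space (trajectories \<kappa>)"
      by (force simp: take_map min_def intro!: prod.cong arg_cong2[where f = X])
    then have "emeasure (trajectories \<kappa>) (?E N) = emeasure (prefix_pmf \<kappa> N) ?A"
      by (simp add: distr_prefix[symmetric] emeasure_distr)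
    also have "\<dots> \<le> ennreal (1 / a)"
      by (rule ville_prefix_pmf[OF assms])
    finally show ?thesis .
  qed
  note [measurable] = measurable_prefix_fun[where Y = X and \<kappa> = \<kappa>]
  have E_sets: "?E N \<in> sets (trajectories \<kappa>)" for N
    by measurable
  have "emeasure (trajectories \<kappa>) (\<Union>N. ?E N) = (SUP N. emeasure (trajectories \<kappa>) (?E N))"
    by (rule SUP_emeasure_incseq[symmetric]) (use E_sets in \<open>auto simp: incseq_def intro: order_trans\<close>)
  also have "\<dots> \<le> ennreal (1 / a)"
    by (rule SUP_least) (rule E)
  also have "(\<Union>N. ?E N) = {\<omega> \<in> space (trajectories \<kappa>). \<exists>n. a \<le> (\<Prod>t<n. X (map \<omega> [0..<t]) (\<omega> t))}"
    by auto
  finally show ?thesis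
    using assms(3) by (simp add: emeasure_eq_measure)
qed

text \<open>The working form: the exceptional set is a measurable witness. Later arguments only take
  finite or countable unions of such sets and reason pointwise outside them.\<close>

lemma ville_exp:
  fixes \<kappa> :: "'x::countable list \<Rightarrow> 'x pmf" and Z :: "'x list \<Rightarrow> 'x \<Rightarrow> real"
  assumes "\<And>h. (\<integral>\<^sup>+x. ennreal (exp (Z h x)) \<partial>\<kappa> h) \<le> 1" and "0 < p"
  shows "\<exists>N\<in>sets (trajectories \<kappa>). measure (trajectories \<kappa>) N \<le> p \<and>
           (\<forall>\<omega>. \<omega> \<notin> N \<longrightarrow> (\<forall>n. (\<Sum>t<n. Z (map \<omega> [0..<t]) (\<omega> t)) < ln (1 / p)))"
proof (intro bexI conjI allI impI)
  let ?N = "{\<omega> \<in> space (trajectories \<kappa>). \<exists>n. 1 / p \<le> (\<Prod>t<n. exp (Z (map \<omega> [0..<t]) (\<omega> t)))}"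
  show "measure (trajectories \<kappa>) ?N \<le> p"
    using ville[of "\<lambda>h x. exp (Z h x)" \<kappa> "1 / p"] assms by simp
  note [measurable] = measurable_prefix_fun[where Y = "\<lambda>h x. exp (Z h x)" and \<kappa> = \<kappa>]
  show "?N \<in> sets (trajectories \<kappa>)" by measurable
  fix \<omega> n assume "\<omega> \<notin> ?N"
  then have "exp (\<Sum>t<n. Z (map \<omega> [0..<t]) (\<omega> t)) < 1 / p"
    by (simp add: exp_sum not_le)
  then show "(\<Sum>t<n. Z (map \<omega> [0..<t]) (\<omega> t)) < ln (1 / p)"
    using assms(2) by (metis exp_gt_zero ln_exp ln_less_cancel_iff zero_less_divide_1_iff)
qed

subsection \<open>Time-uniform concentration\<close>

text \<open>For negative \<open>y = - z\<close>, the lower bound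
  \<open>1 + z + z\<^sup>2 / 2\<close> on \<open>exp z\<close> is multiplied by
  \<open>1 - z + z\<^sup>2\<close>; the linear terms cancel and the product is at least 1.\<close>

lemma exp_le_quadratic:
  fixes y :: real
  assumes "y \<le> 1"
  shows "exp y \<le> 1 + y + y\<^sup>2"
proof (cases "0 \<le> y")
  case True
  then show ?thesis using assms exp_bound by blast
next
  case False
  define z where "z = - y"
  have z: "0 \<le> z" using False by (simp add: z_def)
  have "1 + z + z\<^sup>2 / 2 \<le> exp z" using z by (rule exp_lower_Taylor_quadratic)
  moreover have "0 \<le> 1 - z + z\<^sup>2"
  proof -
    have "1 - z + z\<^sup>2 = (1 - z / 2)\<^sup>2 + 3 / 4 * z\<^sup>2" by (simp add: power2_eq_square field_simps)
    then show ?thesis by simp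
  qed
  ultimately have "(1 - z + z\<^sup>2) * (1 + z + z\<^sup>2 / 2) \<le> (1 - z + z\<^sup>2) * exp z"
    by (intro mult_left_mono)
  moreover have "(1 - z + z\<^sup>2) * (1 + z + z\<^sup>2 / 2) = 1 + z\<^sup>2 / 2 + z ^ 3 / 2 + z ^ 4 / 2"
    by (simp add: power2_eq_square power3_eq_cube power4_eq_xxxx field_simps)
  ultimately have "1 \<le> (1 - z + z\<^sup>2) * exp z"
    using z by (smt (verit) divide_nonneg_nonneg zero_le_power)
  then have "exp (- z) \<le> 1 - z + z\<^sup>2"
    by (simp add: exp_minus field_simps)
  then show ?thesis by (simp add: z_def)
qed

text \<open>Equivalent to \<open>y - y\<^sup>2 \<le> ln (1 + y)\<close>. For negative
  \<open>y\<close> the difference, as a function of \<open>x = - y\<close>, vanishes at 0 and has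
  derivative \<open>x * (1 - 2 * x) / (1 - x)\<close>, nonnegative exactly up to the limit
  1/2.\<close>

lemma exp_minus_square_le:
  fixes y :: real
  assumes "\<bar>y\<bar> \<le> 1 / 2"
  shows "exp (y - y\<^sup>2) \<le> 1 + y"
proof -
  have "y - y\<^sup>2 \<le> ln (1 + y)"
  proof (cases "0 \<le> y")
    case True
    then show ?thesis using assms by (intro ln_one_plus_pos_lower_bound) auto
  next
    case False
    let ?g = "\<lambda>x::real. ln (1 - x) + x + x\<^sup>2"
    have "?g 0 \<le> ?g (- y)"
    proof (rule DERIV_nonneg_imp_nondecreasing[where f = ?g])
      fix x assume x: "0 \<le> x" "x \<le> - y"
      have "(?g has_real_derivative (- 1 / (1 - x) + 1 + 2 * x)) (at x)"
        using x assms by (auto intro!: derivative_eq_intros)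
      moreover have "- 1 / (1 - x) + 1 + 2 * x = x * (1 - 2 * x) / (1 - x)"
        using x assms by (simp add: field_simps)
      moreover have "0 \<le> x * (1 - 2 * x) / (1 - x)"
        using x assms by auto
      ultimately show "\<exists>y. (?g has_real_derivative y) (at x) \<and> y \<ge> 0" by metis
    qed (use False in simp)
    then show ?thesis by simp
  qed
  moreover have "0 < 1 + y" using assms by auto
  ultimately show ?thesis
    by (metis exp_le_cancel_iff exp_ln)
qed

section \<open>Exponential supermartingale factors with empirical and with conditional
  variance\<close>

lemma integrable_pmf_bounded:
  fixes f :: "'x \<Rightarrow> real"
  assumes "\<And>x. \<bar>f x\<bar> \<le> C"
  shows "integrable (measure_pmf p) f"
  by (rule measure_pmf.integrable_const_bound[where B = C]) (auto simp: assms)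

text \<open>The penalty is the realized square, not its expectation. Summed along a run it becomes
  an empirical second moment, which leads to widths in terms of the empirical variance that the
  bonus uses.\<close>

lemma nn_integral_exp_self_normalized:
  fixes Y :: "'x \<Rightarrow> real"
  assumes "\<And>x. \<bar>Y x\<bar> \<le> R" "(LINT x|measure_pmf p. Y x) = 0" "0 < \<eta>" "\<eta> * R \<le> 1 / 2"
  shows "(\<integral>\<^sup>+x. ennreal (exp (\<eta> * Y x - \<eta>\<^sup>2 * (Y x)\<^sup>2)) \<partial>measure_pmf p) \<le> 1"
proof -
  have Y: "\<bar>\<eta> * Y x\<bar> \<le> 1 / 2" for x
  proof -
    have "\<eta> * \<bar>Y x\<bar> \<le> \<eta> * R" using assms by (intro mult_left_mono) auto
    moreover have "\<bar>\<eta> * Y x\<bar> = \<eta> * \<bar>Y x\<bar>" using assms by (simp add: abs_mult)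
    ultimately show ?thesis using assms(4) by linarith
  qed
  have int: "integrable (measure_pmf p) Y" by (rule integrable_pmf_bounded) (rule assms)
  have "(\<integral>\<^sup>+x. ennreal (exp (\<eta> * Y x - \<eta>\<^sup>2 * (Y x)\<^sup>2)) \<partial>measure_pmf p)
      \<le> (\<integral>\<^sup>+x. ennreal (1 + \<eta> * Y x) \<partial>measure_pmf p)"
    using exp_minus_square_le[OF Y] by (intro nn_integral_mono) (simp add: power_mult_distrib ennreal_leI)
  also have "\<dots> = ennreal (LINT x|measure_pmf p. 1 + \<eta> * Y x)"
  proof (rule nn_integral_eq_integral)
    show "integrable (measure_pmf p) (\<lambda>x. 1 + \<eta> * Y x)" using int by simp
    have "0 \<le> 1 + \<eta> * Y x" for x using Y[of x] by linarith
    then show "AE x in measure_pmf p. 0 \<le> 1 + \<eta> * Y x" by simp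
  qed
  also have "(LINT x|measure_pmf p. 1 + \<eta> * Y x) = 1"
    using int assms(2) by simp
  finally show ?thesis by simp
qed

text \<open>The penalty here is the conditional variance. The restriction on \<eta> is one-sided,
  \<open>\<eta> * Y x \<le> 1\<close>; the case of a single state exploits this, since there
  \<open>Y\<close> has a small upper bound but not a small lower one.\<close>

lemma nn_integral_exp_cond_variance:
  fixes Y :: "'x \<Rightarrow> real"
  assumes "\<And>x. \<bar>Y x\<bar> \<le> R" "(LINT x|measure_pmf p. Y x) = 0" and Y: "\<And>x. \<eta> * Y x \<le> 1"
  shows "(\<integral>\<^sup>+x. ennreal (exp (\<eta> * Y x - \<eta>\<^sup>2 * (LINT x|measure_pmf p. (Y x)\<^sup>2))) \<partial>measure_pmf p) \<le> 1"
proof -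
  let ?v = "LINT x|measure_pmf p. (Y x)\<^sup>2"
  have R: "0 \<le> R" using assms(1)[of undefined] by simp
  have int: "integrable (measure_pmf p) Y" by (rule integrable_pmf_bounded) (rule assms)
  have int2: "integrable (measure_pmf p) (\<lambda>x. (Y x)\<^sup>2)"
    using assms(1) by (intro integrable_pmf_bounded[where C = "R\<^sup>2"]) (auto intro: abs_le_square_iff[THEN iffD1] simp: R)
  have pos: "0 \<le> 1 + \<eta> * Y x + \<eta>\<^sup>2 * (Y x)\<^sup>2" for x
    using exp_le_quadratic[OF Y[of x]] by (smt (verit) exp_gt_zero power_mult_distrib)
  have "(\<integral>\<^sup>+x. ennreal (exp (\<eta> * Y x)) \<partial>measure_pmf p)
      \<le> (\<integral>\<^sup>+x. ennreal (1 + \<eta> * Y x + \<eta>\<^sup>2 * (Y x)\<^sup>2) \<partial>measure_pmf p)"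
    using exp_le_quadratic[OF Y] by (intro nn_integral_mono) (simp add: power_mult_distrib ennreal_leI)
  also have "\<dots> = ennreal (LINT x|measure_pmf p. 1 + \<eta> * Y x + \<eta>\<^sup>2 * (Y x)\<^sup>2)"
    using int int2 by (intro nn_integral_eq_integral) (auto simp: pos)
  also have "(LINT x|measure_pmf p. 1 + \<eta> * Y x + \<eta>\<^sup>2 * (Y x)\<^sup>2) = 1 + \<eta>\<^sup>2 * ?v"
    using int int2 assms(2) by simp
  also have "ennreal \<dots> \<le> ennreal (exp (\<eta>\<^sup>2 * ?v))"
    by (intro ennreal_leI) (use exp_ge_add_one_self in blast)
  finally have *: "(\<integral>\<^sup>+x. ennreal (exp (\<eta> * Y x)) \<partial>measure_pmf p) \<le> ennreal (exp (\<eta>\<^sup>2 * ?v))" .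
  have "(\<integral>\<^sup>+x. ennreal (exp (\<eta> * Y x - \<eta>\<^sup>2 * ?v)) \<partial>measure_pmf p)
      = (\<integral>\<^sup>+x. ennreal (exp (- (\<eta>\<^sup>2 * ?v))) * ennreal (exp (\<eta> * Y x)) \<partial>measure_pmf p)"
    by (simp add: ennreal_mult'[symmetric] exp_add[symmetric] del: exp_diff)
  also have "\<dots> = ennreal (exp (- (\<eta>\<^sup>2 * ?v))) * (\<integral>\<^sup>+x. ennreal (exp (\<eta> * Y x)) \<partial>measure_pmf p)"
    by (rule nn_integral_cmult) simp
  also have "\<dots> \<le> ennreal (exp (- (\<eta>\<^sup>2 * ?v))) * ennreal (exp (\<eta>\<^sup>2 * ?v))"
    by (rule mult_left_mono[OF *]) simp
  also have "\<dots> = 1"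
    by (simp add: ennreal_mult'[symmetric] exp_minus)
  finally show ?thesis .
qed

text \<open>Weights of total mass 1 for the union bound over the levels of the grid, by
  telescoping.\<close>

lemma sums_inverse_pronic: "(\<lambda>j::nat. 1 / ((real j + 1) * (real j + 2))) sums 1"
proof -
  have "(\<lambda>j. 1 / (real j + 1)) \<longlonglongrightarrow> 0"
    by real_asymp
  from telescope_sums'[OF this]
  have "(\<lambda>j. 1 / (real j + 1) - 1 / (real (Suc j) + 1)) sums 1" by simp
  moreover have "1 / (real j + 1) - 1 / (real (Suc j) + 1) = 1 / ((real j + 1) * (real j + 2))" for j
    by (simp add: field_simps)
  ultimately show ?thesis by simp
qed

lemma lnln_nonneg [simp]: "0 \<le> lnln x"
  by (simp add: lnln_def)

lemma lnln_mono: "0 \<le> x \<Longrightarrow> x \<le> y \<Longrightarrow> lnln x \<le> lnln y"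
proof -
  assume "0 \<le> x" "x \<le> y"
  \<comment> \<open>At 0 the logarithm has its default value 0, which the maximum with 1
    hides.\<close>
  then have "x = 0 \<or> ln x \<le> ln y" by (cases "x = 0") auto
  then have "max 1 (ln x) \<le> max 1 (ln y)" by auto
  then show ?thesis unfolding lnln_def by (subst ln_le_cancel_iff) auto
qed

text \<open>Relevant levels have \<open>j \<le> 3 / 2 * max 1 (ln N)\<close>, so the weight of level
  \<open>j\<close> costs twice the iterated logarithm plus \<open>4 * ln 2\<close>, rounded up to
  3.\<close>

lemma ln_pronic_le:
  assumes "2 ^ j \<le> max 1 N" "0 < p" "0 \<le> N"
  shows "ln ((real j + 1) * (real j + 2) / p) \<le> ln (1 / p) + 3 + 2 * lnln N"
proof -
  define m where "m = max 1 (ln N)"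
  have m: "1 \<le> m" by (simp add: m_def)
  have "real j * ln 2 = ln (2 ^ j)" by (simp add: ln_realpow)
  also have "\<dots> \<le> ln (max 1 N)" using assms by (subst ln_le_cancel_iff) auto
  also have "\<dots> \<le> m" by (auto simp: m_def max_def)
  finally have "real j * ln 2 \<le> m" .
  moreover have "real j * (2 / 3) \<le> real j * ln 2" using ln2_ge_two_thirds by (intro mult_left_mono) auto
  ultimately have j: "real j \<le> 3 / 2 * m" by simp
  have "(real j + 1) * (real j + 2) \<le> (4 * m) * (4 * m)"
    using j m by (intro mult_mono) linarith+
  then have "ln ((real j + 1) * (real j + 2)) \<le> ln ((4 * m) * (4 * m))"
    using m by (subst ln_le_cancel_iff) auto
  also have "\<dots> = 4 * ln 2 + 2 * ln m"
  proof -
    have "ln (16::real) = 4 * ln 2" using ln_realpow[of 2 4] by simp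
    moreover have "(4 * m) * (4 * m) = 16 * m\<^sup>2" by (simp add: power2_eq_square)
    ultimately show ?thesis using m by (simp add: ln_mult ln_realpow)
  qed
  also have "\<dots> \<le> 3 + 2 * ln m" using ln2_le_25_over_36 by simp
  finally have "ln ((real j + 1) * (real j + 2)) \<le> 3 + 2 * lnln N"
    by (simp add: lnln_def m_def)
  then show ?thesis using assms(2) by (simp add: ln_div)
qed

text \<open>Dividing a grid inequality by \<eta> gives
  \<open>S \<le> \<eta> * Q + l / \<eta>\<close>, with minimizer \<open>sqrt (l / Q)\<close>. If
  \<open>Q \<le> 4 * R\<^sup>2 * l\<close>, the minimizer is beyond the largest grid point and level
  0 is used, which causes the term \<open>2 * R * l\<close>. Otherwise the first grid point below it
  loses at most a factor 2 in the second summand, hence 1 + 2 = 3 roots;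
  \<open>Q \<le> R\<^sup>2 * N\<close> ensures that this level is among those with
  \<open>2 ^ j \<le> max 1 N\<close>.\<close>

lemma dyadic_grid_bound:
  fixes S Q R l N :: real
  assumes R: "0 < R" and Q: "0 \<le> Q" "Q \<le> R\<^sup>2 * N" and l: "1 \<le> l"
    and grid: "\<And>j::nat. 2 ^ j \<le> max 1 N \<Longrightarrow>
      (1 / 2) ^ j / (2 * R) * S - ((1 / 2) ^ j / (2 * R))\<^sup>2 * Q \<le> l"
  shows "S \<le> 3 * sqrt (Q * l) + 2 * R * l"
proof -
  have bound: "S \<le> a * Q + l / a" if "a * S - a\<^sup>2 * Q \<le> l" "0 < a" for a
    using that by (simp add: field_simps power2_eq_square)
  show ?thesis
  proof (cases "Q \<le> 4 * R\<^sup>2 * l")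
    case True
    have "S \<le> (1 / (2 * R)) * Q + l / (1 / (2 * R))"
    proof (rule bound)
      show "1 / (2 * R) * S - (1 / (2 * R))\<^sup>2 * Q \<le> l" using grid[of 0] by simp
    qed (use R in simp)
    also have "\<dots> = sqrt Q * (sqrt Q / (2 * R)) + 2 * R * l"
    proof -
      have "sqrt Q * (sqrt Q / (2 * R)) = (sqrt Q * sqrt Q) / (2 * R)" by simp
      then show ?thesis using Q(1) by simp
    qed
    also have "sqrt Q * (sqrt Q / (2 * R)) \<le> sqrt Q * sqrt l"
    proof (rule mult_left_mono)
      have "sqrt Q \<le> sqrt (4 * R\<^sup>2 * l)" using True by simp
      also have "\<dots> = 2 * R * sqrt l" using R by (simp add: real_sqrt_mult)
      finally show "sqrt Q / (2 * R) \<le> sqrt l" using R by (simp add: field_simps)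
    qed (use Q in simp)
    also have "sqrt Q * sqrt l = sqrt (Q * l)" by (simp add: real_sqrt_mult)
    finally have "S \<le> sqrt (Q * l) + 2 * R * l" by simp
    moreover have "0 \<le> sqrt (Q * l)" using Q(1) l by simp
    ultimately show ?thesis by linarith
  next
    case False
    moreover have "0 \<le> 4 * R\<^sup>2 * l" using l by simp
    ultimately have Qpos: "0 < Q" by linarith
    define s where "s = sqrt (l / Q)"
    have s: "0 < s" using Qpos l by (simp add: s_def)
    have "s\<^sup>2 = l / Q" using Qpos l by (simp add: s_def)
    have "(2 * R * s)\<^sup>2 = 4 * R\<^sup>2 * l / Q"
      using \<open>s\<^sup>2 = l / Q\<close> by (simp add: power_mult_distrib)
    also have "\<dots> < 1\<^sup>2" using False Qpos by simp
    finally have "(2 * R * s)\<^sup>2 < 1\<^sup>2" .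
    then have z1: "2 * R * s < 1" by (rule power2_less_imp_less) simp
    define j where "j = (LEAST j. (1 / 2) ^ j \<le> 2 * R * s)"
    have "\<exists>j. (1 / 2) ^ j < 2 * R * s"
      by (rule real_arch_pow_inv) (use R s in auto)
    then have j1: "(1 / 2) ^ j \<le> 2 * R * s"
      unfolding j_def by (meson LeastI_ex less_imp_le)
    then obtain i where i: "j = Suc i" using z1 by (cases j) auto
    have "\<not> (1 / 2) ^ i \<le> 2 * R * s"
      using not_less_Least[of i "\<lambda>j. (1 / 2) ^ j \<le> 2 * R * s"] i by (simp add: j_def)
    then have j2: "(1 / 2) ^ j > R * s" using i by simp
    define a where "a = (1 / 2) ^ j / (2 * R)"
    have a: "a \<le> s" "s / 2 < a" "0 < a"
      using j1 j2 R by (auto simp: a_def field_simps)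
    have "(2::real) ^ j < 1 / (R * s)"
      using j2 R s by (simp add: power_one_over field_simps)
    then have "((2::real) ^ j)\<^sup>2 \<le> (1 / (R * s))\<^sup>2" by (intro power_mono) auto
    also have "\<dots> = Q / (R\<^sup>2 * l)"
      using \<open>s\<^sup>2 = l / Q\<close> by (simp add: power_divide power_mult_distrib)
    also have "\<dots> \<le> Q / R\<^sup>2" using R Qpos l by (intro divide_left_mono) auto
    also have "\<dots> \<le> N" using R Q by (simp add: field_simps)
    finally have "((2::real) ^ j)\<^sup>2 \<le> N" .
    moreover have "(2::real) ^ j \<le> (2 ^ j)\<^sup>2"
      by (rule self_le_power) auto
    ultimately have "2 ^ j \<le> max 1 N" by simp
    from grid[OF this] have "S \<le> a * Q + l / a"
      using a(3) by (intro bound) (auto simp: a_def)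
    also have "\<dots> \<le> s * Q + l / (s / 2)"
      using a Qpos l s by (intro add_mono mult_right_mono divide_left_mono) auto
    also have "s * Q = sqrt (Q * l)"
    proof -
      have "a / b * (b * b) = b * a" if "b \<noteq> 0" for a b :: real
        using that by simp
      from this[of "sqrt Q" "sqrt l"] show ?thesis
        using Qpos by (simp only: s_def real_sqrt_divide real_sqrt_mult) simp
    qed
    also have "l / (s / 2) = 2 * sqrt (Q * l)"
    proof -
      have "a * a / (a / b / 2) = 2 * (b * a)" if "a \<noteq> 0" "b \<noteq> 0" for a b :: real
        using that by simp
      from this[of "sqrt l" "sqrt Q"] show ?thesis
        using Qpos l by (simp only: s_def real_sqrt_divide real_sqrt_mult) simp
    qed
    finally have "S \<le> 3 * sqrt (Q * l)" by simp
    moreover have "0 \<le> 2 * R * l" using R l by simp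
    ultimately show ?thesis by linarith
  qed
qed

text \<open>
  Stitching the exponential inequality over the grid \<open>\<eta> = 2\<^sup>-\<^sup>j / (2 * R)\<close>, with failure probability
  \<open>p / ((j + 1) * (j + 2))\<close> at level \<open>j\<close>; only levels with \<open>2\<^sup>j \<le> n\<close> matter at time \<open>n\<close>, which is where
  the iterated logarithm comes from.
\<close>

lemma time_uniform_bernstein:
  fixes \<kappa> :: "'x::countable list \<Rightarrow> 'x pmf" and Y q \<nu> :: "'x list \<Rightarrow> 'x \<Rightarrow> real"
  assumes R: "0 < R" and q: "\<And>h x. 0 \<le> q h x" "\<And>h x. q h x \<le> R\<^sup>2 * \<nu> h x"
    and exp: "\<And>\<eta> h. 0 < \<eta> \<Longrightarrow> \<eta> * R \<le> 1 / 2 \<Longrightarrow>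
      (\<integral>\<^sup>+x. ennreal (exp (\<eta> * Y h x - \<eta>\<^sup>2 * q h x)) \<partial>\<kappa> h) \<le> 1"
    and p: "0 < p" "p \<le> 1"
  shows "\<exists>E\<in>sets (trajectories \<kappa>). measure (trajectories \<kappa>) E \<le> p \<and>
    (\<forall>\<omega>. \<omega> \<notin> E \<longrightarrow> (\<forall>n.
       (\<Sum>t<n. Y (map \<omega> [0..<t]) (\<omega> t)) \<le>
         3 * sqrt ((\<Sum>t<n. q (map \<omega> [0..<t]) (\<omega> t)) *
                   (ln (1 / p) + 3 + 2 * lnln (\<Sum>t<n. \<nu> (map \<omega> [0..<t]) (\<omega> t)))) +
         2 * R * (ln (1 / p) + 3 + 2 * lnln (\<Sum>t<n. \<nu> (map \<omega> [0..<t]) (\<omega> t)))))"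
proof -
  interpret prob_space "trajectories \<kappa>" by (rule prob_space_trajectories)
  let ?\<eta> = "\<lambda>j::nat. (1 / 2) ^ j / (2 * R)"
  let ?p = "\<lambda>j::nat. p / ((real j + 1) * (real j + 2))"
  let ?Z = "\<lambda>j h x. ?\<eta> j * Y h x - (?\<eta> j)\<^sup>2 * q h x"
  have "\<exists>E\<in>sets (trajectories \<kappa>). measure (trajectories \<kappa>) E \<le> ?p j \<and>
      (\<forall>\<omega>. \<omega> \<notin> E \<longrightarrow> (\<forall>n. (\<Sum>t<n. ?Z j (map \<omega> [0..<t]) (\<omega> t)) < ln (1 / ?p j)))" for j
  proof (rule ville_exp)
    have "(1 / 2 :: real) ^ j \<le> 1" by (rule power_le_one) auto
    then show "(\<integral>\<^sup>+x. ennreal (exp (?Z j h x)) \<partial>\<kappa> h) \<le> 1" for h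
      using R by (intro exp) auto
  qed (use p in auto)
  then have "\<forall>j. \<exists>E. E \<in> sets (trajectories \<kappa>) \<and> measure (trajectories \<kappa>) E \<le> ?p j \<and>
      (\<forall>\<omega>. \<omega> \<notin> E \<longrightarrow> (\<forall>n. (\<Sum>t<n. ?Z j (map \<omega> [0..<t]) (\<omega> t)) < ln (1 / ?p j)))"
    by blast
  from choice[OF this] obtain E where "\<forall>j. E j \<in> sets (trajectories \<kappa>) \<and> measure (trajectories \<kappa>) (E j) \<le> ?p j \<and>
      (\<forall>\<omega>. \<omega> \<notin> E j \<longrightarrow> (\<forall>n. (\<Sum>t<n. ?Z j (map \<omega> [0..<t]) (\<omega> t)) < ln (1 / ?p j)))" ..
  then have E: "\<And>j. E j \<in> sets (trajectories \<kappa>)" "\<And>j. measure (trajectories \<kappa>) (E j) \<le> ?p j"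
      "\<And>j \<omega> n. \<omega> \<notin> E j \<Longrightarrow> (\<Sum>t<n. ?Z j (map \<omega> [0..<t]) (\<omega> t)) < ln (1 / ?p j)"
    by blast+
  have sums: "?p sums p"
    using sums_mult[OF sums_inverse_pronic, of p] by simp
  have summable: "summable (\<lambda>j. prob (E j))"
    by (rule summable_comparison_test'[OF sums_summable[OF sums], of 0]) (use E(2) in auto)
  have "prob (\<Union>j. E j) \<le> (\<Sum>j. prob (E j))"
    using E(1) summable by (intro finite_measure_subadditive_countably) auto
  also have "\<dots> \<le> (\<Sum>j. ?p j)"
    using E(2) by (intro suminf_le summable sums_summable[OF sums]) auto
  also have "\<dots> = p" by (rule sums_unique[OF sums, symmetric])
  finally have meas: "prob (\<Union>j. E j) \<le> p" .
  show ?thesis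
  proof (intro bexI conjI allI impI)
    show "(\<Union>j. E j) \<in> sets (trajectories \<kappa>)" using E(1) by auto
    show "prob (\<Union>j. E j) \<le> p" by (rule meas)
    fix \<omega> n assume \<omega>: "\<omega> \<notin> (\<Union>j. E j)"
    let ?Q = "\<Sum>t<n. q (map \<omega> [0..<t]) (\<omega> t)"
    \<comment> \<open>\<open>?N\<close> measures activity, not time. For a fixed pair it counts
      visits, so the iterated logarithm is taken of the visit count.\<close>
    let ?N = "\<Sum>t<n. \<nu> (map \<omega> [0..<t]) (\<omega> t)"
    let ?S = "\<Sum>t<n. Y (map \<omega> [0..<t]) (\<omega> t)"
    let ?l = "ln (1 / p) + 3 + 2 * lnln ?N"
    have QN: "?Q \<le> R\<^sup>2 * ?N" unfolding sum_distrib_left by (intro sum_mono q)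
    have Q0: "0 \<le> ?Q" by (intro sum_nonneg q)
    have "0 \<le> R\<^sup>2 * ?N" using QN Q0 by linarith
    then have N0: "0 \<le> ?N" using R by (simp add: zero_le_mult_iff)
    show "?S \<le> 3 * sqrt (?Q * ?l) + 2 * R * ?l"
    proof (rule dyadic_grid_bound[OF R Q0 QN])
      have "0 \<le> ln (1 / p)" using p by simp
      then show "1 \<le> ?l" using lnln_nonneg[of ?N] by linarith
      fix j :: nat assume j: "2 ^ j \<le> max 1 ?N"
      have "?\<eta> j * ?S - (?\<eta> j)\<^sup>2 * ?Q = (\<Sum>t<n. ?Z j (map \<omega> [0..<t]) (\<omega> t))"
        by (simp add: sum_subtractf sum_distrib_left)
      also have "\<dots> \<le> ln (1 / ?p j)" using \<omega> by (intro less_imp_le E(3)) blast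
      also have "\<dots> \<le> ?l" using ln_pronic_le[OF j p(1) N0] by simp
      finally show "?\<eta> j * ?S - (?\<eta> j)\<^sup>2 * ?Q \<le> ?l" .
    qed
  qed
qed

text \<open>The second moment around the true mean is \<open>v + D\<^sup>2\<close>, so
  \<open>D\<close> occurs on both sides. If \<open>36 * l \<le> n\<close>, its term on the right is
  at most half of the left side; otherwise \<open>36 * R * l / n\<close> already exceeds
  \<open>R\<close>.\<close>

lemma empirical_bernstein_solve:
  fixes D v R l n :: real
  assumes "0 < n" "0 \<le> l" "0 \<le> v" "\<bar>D\<bar> \<le> R" "0 \<le> R"
    and "n * \<bar>D\<bar> \<le> 3 * sqrt (n * (v + D\<^sup>2) * l) + 2 * R * l"
  shows "\<bar>D\<bar> \<le> 6 * sqrt (v * l / n) + 36 * R * l / n"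
proof (cases "36 * l \<le> n")
  case True
  have "sqrt (n * (v + D\<^sup>2) * l) = sqrt (n * l * v + n * l * D\<^sup>2)"
    by (simp add: algebra_simps)
  also have "\<dots> \<le> sqrt (n * l * v) + sqrt (n * l * D\<^sup>2)"
    using assms by (intro sqrt_add_le_add_sqrt) auto
  finally have "sqrt (n * (v + D\<^sup>2) * l) \<le> sqrt (n * l * v) + sqrt (n * l * D\<^sup>2)" .
  moreover have "sqrt (n * l * v) = n * sqrt (v * l / n)"
  proof -
    have "n * l * v = n\<^sup>2 * (v * l / n)" using assms(1) by (simp add: power2_eq_square)
    then show ?thesis using assms(1) by (simp only: real_sqrt_mult) simp
  qed
  moreover have "sqrt (n * l * D\<^sup>2) \<le> n / 6 * \<bar>D\<bar>"
  proof -
    have "n * l \<le> (n / 6)\<^sup>2"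
      using True assms by (simp add: power2_eq_square field_simps)
    then have "sqrt (n * l) \<le> n / 6" using assms by (intro real_le_lsqrt) auto
    then show ?thesis using mult_right_mono[of "sqrt (n * l)" "n / 6" "\<bar>D\<bar>"]
      by (simp add: real_sqrt_mult)
  qed
  ultimately have *: "sqrt (n * (v + D\<^sup>2) * l) \<le> n * sqrt (v * l / n) + n / 6 * \<bar>D\<bar>"
    by (metis add_left_mono order_trans)
  have "n * \<bar>D\<bar> \<le> 3 * (n * sqrt (v * l / n) + n / 6 * \<bar>D\<bar>) + 2 * R * l"
    by (rule order_trans[OF assms(6)]) (intro add_right_mono mult_left_mono *, simp)
  then have "n * \<bar>D\<bar> \<le> n * (6 * sqrt (v * l / n)) + 4 * R * l" by (simp add: field_simps)
  then have "\<bar>D\<bar> \<le> 6 * sqrt (v * l / n) + 4 * R * l / n" using assms(1) by (simp add: field_simps)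
  also have "4 * R * l / n \<le> 36 * R * l / n" using assms by (intro divide_right_mono) auto
  finally show ?thesis by simp
next
  case False
  then have "R * 1 \<le> R * (36 * l / n)" using assms by (intro mult_left_mono) (auto simp: field_simps)
  then have "\<bar>D\<bar> \<le> 36 * R * l / n" using assms(4) by (simp add: algebra_simps)
  moreover have "0 \<le> 6 * sqrt (v * l / n)" using assms by simp
  ultimately show ?thesis by linarith
qed

subsection \<open>Optimal values of path problems\<close>

abbreviation successors :: "('s, 'a) path_problem \<Rightarrow> 's option set" where
  "successors M \<equiv> insert None (Some ` states M)"

abbreviation exp_next :: "('s, 'a) path_problem \<Rightarrow> 's \<Rightarrow> 'a \<Rightarrow> ('s option \<Rightarrow> real) \<Rightarrow> real" where
  "exp_next M s a \<equiv> mean_on (successors M) (pmf (trans M s a))"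

lemma mean_on_mono:
  assumes "\<And>x. x \<in> X \<Longrightarrow> 0 \<le> p x" "\<And>x. x \<in> X \<Longrightarrow> f x \<le> g x"
  shows "mean_on X p f \<le> mean_on X p g"
  unfolding mean_on_def by (intro sum_mono mult_left_mono assms)

lemma mean_on_nonneg:
  assumes "\<And>x. x \<in> X \<Longrightarrow> 0 \<le> p x" "\<And>x. x \<in> X \<Longrightarrow> 0 \<le> f x"
  shows "0 \<le> mean_on X p f"
  unfolding mean_on_def by (intro sum_nonneg mult_nonneg_nonneg assms)

lemma mean_on_add: "mean_on X p (\<lambda>x. f x + g x) = mean_on X p f + mean_on X p g"
  by (simp add: mean_on_def sum.distrib algebra_simps)

lemma mean_on_diff: "mean_on X p (\<lambda>x. f x - g x) = mean_on X p f - mean_on X p g"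
  by (simp add: mean_on_def sum_subtractf algebra_simps)

lemma mean_on_cmult: "mean_on X p (\<lambda>x. c * f x) = c * mean_on X p f"
  by (simp add: mean_on_def sum_distrib_left algebra_simps)

lemma mean_on_const: "sum p X = 1 \<Longrightarrow> mean_on X p (\<lambda>_. c) = c"
  by (simp add: mean_on_def sum_distrib_right[symmetric])

lemma mean_on_cong: "(\<And>x. x \<in> X \<Longrightarrow> f x = g x) \<Longrightarrow> mean_on X p f = mean_on X p g"
  by (simp add: mean_on_def cong: sum.cong)

locale nonneg_path_problem =
  fixes M :: "('s::countable, 'a::countable) path_problem"
  assumes sp: "stochastic_path M"
    and reward_nonneg: "\<And>s a. s \<in> states M \<Longrightarrow> a \<in> actions M \<Longrightarrow> 0 \<le> reward M s a"
    and all_proper: "\<And>\<pi>. \<pi> \<in> HD_policies M \<Longrightarrow> proper M \<pi>"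
begin

abbreviation "X \<equiv> successors M"
abbreviation "S \<equiv> states M"
abbreviation "A \<equiv> actions M"

lemma finite_S [simp]: "finite S" and finite_A [simp]: "finite A" and A_ne: "A \<noteq> {}"
  and init_S [simp]: "init M \<in> S"
  using sp by (auto simp: stochastic_path_def)

lemma set_trans: "s \<in> S \<Longrightarrow> a \<in> A \<Longrightarrow> set_pmf (trans M s a) \<subseteq> X"
  and reward_le: "s \<in> S \<Longrightarrow> a \<in> A \<Longrightarrow> reward M s a \<le> 1"
  using sp by (auto simp: stochastic_path_def)

lemma sum_trans: "s \<in> S \<Longrightarrow> a \<in> A \<Longrightarrow> sum (pmf (trans M s a)) X = 1"
  by (rule sum_pmf_eq_1) (auto dest: set_trans)

lemma expectation_trans:
  "s \<in> S \<Longrightarrow> a \<in> A \<Longrightarrow> (LINT x|trans M s a. f x) = exp_next M s a f"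
  by (subst integral_measure_pmf[where A = X]) (auto simp: mean_on_def dest: set_trans)

text \<open>On such a set the stationary policy made of the confining actions would never reach the
  terminal state. This turns properness into a combinatorial fact: every nonempty set of states has
  a member that leaves it with positive probability under each action.\<close>

lemma no_closed_set:
  assumes Z: "Z \<subseteq> S" "Z \<noteq> {}" and closed: "\<And>s. s \<in> Z \<Longrightarrow> \<exists>a\<in>A. set_pmf (trans M s a) \<subseteq> Some ` Z"
  shows False
proof -
  obtain b where b: "\<And>s. s \<in> Z \<Longrightarrow> b s \<in> A" "\<And>s. s \<in> Z \<Longrightarrow> set_pmf (trans M s (b s)) \<subseteq> Some ` Z"
    using closed by metis
  define p where "p s = (if s \<in> Z then b s else SOME a. a \<in> A)" for s
  have "(\<lambda>_. p) \<in> HD_policies M"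
    using b A_ne by (auto simp: HD_policies_def p_def some_in_eq)
  then have proper: "proper M (\<lambda>_. p)" by (rule all_proper)
  obtain s where s: "s \<in> Z" using Z by auto
  let ?\<kappa> = "episode_step M (\<lambda>_. p) s"
  interpret prob_space "episode M (\<lambda>_. p) s"
    unfolding episode_def by (rule prob_space_trajectories)
  have "AE \<omega> in episode M (\<lambda>_. p) s. \<forall>t. \<omega> t \<in> set_pmf (?\<kappa> (map \<omega> [0..<t]))"
    unfolding episode_def by (rule AE_trajectories_support)
  moreover have "AE \<omega> in episode M (\<lambda>_. p) s. \<exists>i. \<omega> i = None"
    using proper s Z by (auto simp: proper_def)
  ultimately have "AE \<omega> in episode M (\<lambda>_. p) s. False"
  proof eventually_elim
    case (elim \<omega>)
    have "\<exists>x\<in>Z. \<omega> t = Some (x, p x)" for t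
    proof (induction t)
      case 0
      show ?case using elim(1)[rule_format, of 0] s by (simp add: episode_step_def)
    next
      case (Suc t)
      then obtain x where x: "x \<in> Z" "\<omega> t = Some (x, p x)" by auto
      then have "set_pmf (trans M x (p x)) \<subseteq> Some ` Z" using b(2) by (auto simp: p_def)
      then show ?case
        using elim(1)[rule_format, of "Suc t"] x by (auto simp: episode_step_def)
    qed
    then show False using elim(2) by (metis option.distinct(1))
  qed
  then show False by simp
qed

text \<open>
  A bound \<open>w\<close> on the hitting time of the terminal state under any policy, as \<open>w = d None - d\<close> for a
  function \<open>d\<close> that increases by 1 per step in expectation; \<open>d\<close> is built by adding the states one by one.
\<close>

lemma hitting_time_bound:
  "\<exists>w :: 's option \<Rightarrow> real. w None = 0 \<and> (\<forall>x. 0 \<le> w x) \<and>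
     (\<forall>s\<in>S. \<forall>a\<in>A. 1 + exp_next M s a w \<le> w (Some s))"
proof -
  define P where "P T d \<longleftrightarrow> T \<subseteq> S \<and> (\<forall>x. 0 \<le> d x \<and> d x \<le> d None) \<and>
      (\<forall>x. x \<notin> insert None (Some ` T) \<longrightarrow> d x = 0) \<and>
      (\<forall>s\<in>T. \<forall>a\<in>A. d (Some s) + 1 \<le> exp_next M s a d)" for T and d :: "'s option \<Rightarrow> real"
  have "\<exists>T d. P T d \<and> card T = n" if "n \<le> card S" for n
    using that
  proof (induction n)
    case 0
    have "P {} (\<lambda>_. 0)" by (simp add: P_def)
    then show ?case by (metis card.empty)
  next
    case (Suc n)
    then obtain T d where Td: "P T d" "card T = n" by auto
    have T: "T \<subseteq> S" using Td by (simp add: P_def)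
    then have finT: "finite T" by (rule finite_subset) simp
    have "S - T \<noteq> {}" using Td Suc(2) T by (auto dest: card_mono[OF finT])
    then have "\<not> (\<forall>s\<in>S - T. \<exists>a\<in>A. set_pmf (trans M s a) \<subseteq> Some ` (S - T))"
      using no_closed_set[of "S - T"] by auto
    then obtain s where s: "s \<in> S" "s \<notin> T" "\<And>a. a \<in> A \<Longrightarrow> \<not> set_pmf (trans M s a) \<subseteq> Some ` (S - T)"
      by auto
    let ?G = "insert None (Some ` T)"
    let ?g = "\<lambda>a. exp_next M s a (indicator ?G)"
    have g: "0 < ?g a" if a: "a \<in> A" for a
    proof -
      obtain x where x: "x \<in> set_pmf (trans M s a)" "x \<notin> Some ` (S - T)" using s(3)[OF a] by auto
      then have "x \<in> X" "x \<in> ?G" using set_trans[OF s(1) a] by auto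
      moreover have "0 < pmf (trans M s a) x" using x(1) by (simp add: pmf_positive)
      ultimately have "0 < pmf (trans M s a) x * indicator ?G x" by simp
      then show ?thesis unfolding mean_on_def
        using \<open>x \<in> X\<close> by (intro sum_pos2[of X x]) auto
    qed
    define e where "e = Min (?g ` A)"
    have e: "0 < e" using g A_ne unfolding e_def by (subst Min_gr_iff) auto
    have e': "e \<le> ?g a" if "a \<in> A" for a unfolding e_def using that by simp
    \<comment> \<open>From \<open>s\<close> every action enters \<open>?G\<close> with probability
      at least \<open>e\<close>, so the summand \<open>b * indicator ?G\<close> with
      \<open>b = 1 / e\<close> makes \<open>d'\<close> grow by at least 1 from its value 0 at
      \<open>s\<close>. On \<open>T\<close> this summand also raises \<open>d'\<close> by
      \<open>b\<close>; the factor \<open>b + 1\<close> on the old \<open>d\<close>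
      compensates.\<close>
    define b where "b = 1 / e"
    define d' where "d' x = (b + 1) * d x + b * indicator ?G x" for x
    have b: "0 < b" using e by (simp add: b_def)
    have d: "0 \<le> d x" "d x \<le> d None" "x \<notin> ?G \<Longrightarrow> d x = 0"
        "s' \<in> T \<Longrightarrow> a \<in> A \<Longrightarrow> d (Some s') + 1 \<le> exp_next M s' a d" for x s' a
      using Td(1) unfolding P_def by blast+
    have mean_d': "exp_next M s a d' = (b + 1) * exp_next M s a d + b * exp_next M s a (indicator ?G)" for s a
      unfolding d'_def by (simp add: mean_on_add mean_on_cmult)
    have "P (insert s T) d'"
      unfolding P_def
    proof (intro conjI allI ballI impI)
      show "insert s T \<subseteq> S" using s T by simp
      show "0 \<le> d' x" for x using d(1)[of x] b by (simp add: d'_def)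
      show "d' x \<le> d' None" for x
        unfolding d'_def using d(2)[of x] b by (intro add_mono mult_left_mono) (auto simp: indicator_def)
      show "d' x = 0" if "x \<notin> insert None (Some ` insert s T)" for x
        using that d(3)[of x] by (simp add: d'_def)
      fix s' a assume s': "s' \<in> insert s T" and a: "a \<in> A"
      show "d' (Some s') + 1 \<le> exp_next M s' a d'"
      proof (cases "s' = s")
        case True
        have "d' (Some s) = 0" using d(3)[of "Some s"] s(2) by (auto simp: d'_def indicator_def)
        moreover have "1 \<le> b * ?g a" using e'[OF a] e by (simp add: b_def)
        moreover have "0 \<le> (b + 1) * exp_next M s a d"
          using b d(1) by (intro mult_nonneg_nonneg mean_on_nonneg) auto
        ultimately show ?thesis unfolding True mean_d' by linarith
      next
        case False
        then have "s' \<in> T" using s' by simp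
        then have "(b + 1) * (d (Some s') + 1) \<le> (b + 1) * exp_next M s' a d"
          using d(4) a b by (intro mult_left_mono) auto
        moreover have "0 \<le> b * exp_next M s' a (indicator ?G)"
          using b by (intro mult_nonneg_nonneg mean_on_nonneg) auto
        moreover have "d' (Some s') = (b + 1) * d (Some s') + b"
          using \<open>s' \<in> T\<close> by (simp add: d'_def)
        ultimately show ?thesis unfolding mean_d' by (simp add: algebra_simps)
      qed
    qed
    moreover have "card (insert s T) = Suc n" using s finT Td by simp
    ultimately show ?case by blast
  qed
  then obtain T d where Td: "P T d" "card T = card S" by blast
  then have "T = S" by (intro card_subset_eq) (auto simp: P_def)
  with Td have d: "\<And>x. d x \<le> d None" "\<And>s a. s \<in> S \<Longrightarrow> a \<in> A \<Longrightarrow> d (Some s) + 1 \<le> exp_next M s a d"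
    by (auto simp: P_def)
  show ?thesis
  proof (intro exI[of _ "\<lambda>x. d None - d x"] conjI ballI allI)
    fix s a assume sa: "s \<in> S" "a \<in> A"
    then have "exp_next M s a (\<lambda>x. d None - d x) = d None - exp_next M s a d"
      by (simp only: mean_on_diff mean_on_const[OF sum_trans])
    then show "1 + exp_next M s a (\<lambda>x. d None - d x) \<le> d None - d (Some s)"
      using d(2)[OF sa] by linarith
  qed (use d(1) in auto)
qed

text \<open>Iteration from 0 increases because rewards are nonnegative, and stays below
  \<open>w\<close> because rewards are at most 1 and \<open>w\<close> pays 1 per step. Expectations
  are finite sums, so both Bellman inequalities survive the pointwise limit.\<close>

lemma bellman_solution:
  obtains U :: "'s option \<Rightarrow> real" where "U None = 0" "\<And>x. 0 \<le> U x"
    "\<And>s a. s \<in> S \<Longrightarrow> a \<in> A \<Longrightarrow> reward M s a + exp_next M s a U \<le> U (Some s)"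
    "\<And>s. s \<in> S \<Longrightarrow> \<exists>a\<in>A. U (Some s) = reward M s a + exp_next M s a U"
proof -
  obtain w :: "'s option \<Rightarrow> real" where w: "w None = 0" "\<And>x. 0 \<le> w x"
    "\<And>s a. s \<in> S \<Longrightarrow> a \<in> A \<Longrightarrow> 1 + exp_next M s a w \<le> w (Some s)"
    using hitting_time_bound by blast
  let ?q = "\<lambda>u s a. reward M s a + exp_next M s a u"
  define step :: "('s option \<Rightarrow> real) \<Rightarrow> 's option \<Rightarrow> real" where
    "step u x = (case x of None \<Rightarrow> 0 | Some s \<Rightarrow> if s \<in> S then Max (?q u s ` A) else 0)" for u x
  define v where "v n = (step ^^ n) (\<lambda>_. 0)" for n
  have v_Suc: "v (Suc n) = step (v n)" for n by (simp add: v_def)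
  have q_mono: "?q u s a \<le> ?q u' s a" if "\<And>x. u x \<le> u' x" for u u' s a
    using that by (simp add: mean_on_mono)
  have q_le: "?q u s a \<le> step u (Some s)" if "s \<in> S" "a \<in> A" for u s a
    using that by (simp add: step_def)
  have step_le: "step u (Some s) \<le> c" if "s \<in> S" "\<And>a. a \<in> A \<Longrightarrow> ?q u s a \<le> c" for u s c
    using that A_ne by (simp add: step_def)
  have step_ex: "\<exists>a\<in>A. step u (Some s) = ?q u s a" if "s \<in> S" for u s
  proof -
    have "Max (?q u s ` A) \<in> ?q u s ` A" using A_ne by (intro Max_in) auto
    then show ?thesis using that by (auto simp: step_def)
  qed
  have step0: "x \<notin> Some ` S \<Longrightarrow> step u x = 0" for u x
    by (auto simp: step_def split: option.split)
  have step_mono: "step u x \<le> step u' x" if "\<And>x. u x \<le> u' x" for u u' x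
  proof (cases "x \<in> Some ` S")
    case True
    then show ?thesis
      by (auto intro!: step_le order_trans[OF q_mono[OF that] q_le])
  qed (simp add: step0)
  have v_nonneg: "0 \<le> v n x" for n x
  proof (induction n arbitrary: x)
    case (Suc n)
    show ?case
    proof (cases "x \<in> Some ` S")
      case True
      then obtain s where s: "s \<in> S" "x = Some s" by auto
      obtain a where a: "a \<in> A" "step (v n) (Some s) = ?q (v n) s a" using step_ex[OF s(1)] by auto
      have "0 \<le> ?q (v n) s a"
        using Suc s a by (intro add_nonneg_nonneg reward_nonneg mean_on_nonneg) auto
      then show ?thesis using a s by (simp add: v_Suc)
    qed (simp add: step0 v_Suc)
  qed (simp add: v_def)
  have v_mono: "v n x \<le> v (Suc n) x" for n x
  proof (induction n arbitrary: x)
    case 0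
    then show ?case using v_nonneg[of "Suc 0" x] by (simp add: v_def)
  next
    case (Suc n)
    then show ?case unfolding v_Suc by (rule step_mono)
  qed
  have v_le: "v n x \<le> w x" for n x
  proof (induction n arbitrary: x)
    case 0
    then show ?case by (simp add: v_def w)
  next
    case (Suc n)
    show ?case
    proof (cases "x \<in> Some ` S")
      case True
      then obtain s where s: "s \<in> S" "x = Some s" by auto
      have "?q (v n) s a \<le> w (Some s)" if "a \<in> A" for a
        using w(3)[OF s(1) that] reward_le[OF s(1) that] q_mono[of "v n" w s a, OF Suc] by linarith
      then show ?thesis unfolding v_Suc s by (intro step_le s)
    qed (simp add: step0 v_Suc w)
  qed
  define U where "U x = lim (\<lambda>n. v n x)" for x
  have lim: "(\<lambda>n. v n x) \<longlonglongrightarrow> U x" for x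
  proof -
    have "convergent (\<lambda>n. v n x)"
      by (rule Bseq_monoseq_convergent[OF BseqI'[of _ "w x"]])
         (use v_le v_nonneg in \<open>auto intro!: incseq_imp_monoseq incseq_SucI v_mono\<close>)
    then show ?thesis by (simp add: U_def convergent_LIMSEQ_iff)
  qed
  have v_le_U: "v n x \<le> U x" for n x
    by (rule incseq_le[OF _ lim]) (auto intro!: incseq_SucI v_mono)
  have limq: "(\<lambda>n. ?q (v n) s a) \<longlonglongrightarrow> ?q U s a" for s a
    unfolding mean_on_def by (intro tendsto_intros lim)
  show thesis
  proof (rule that)
    show "U None = 0"
    proof -
      have "v n None = 0" for n by (cases n) (simp_all add: v_Suc step0, simp add: v_def)
      then show ?thesis using lim[of None] by (simp add: LIMSEQ_const_iff)
    qed
    show "0 \<le> U x" for x using v_nonneg v_le_U order_trans by blast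
    fix s assume s: "s \<in> S"
    show "?q U s a \<le> U (Some s)" if "a \<in> A" for a
    proof (rule LIMSEQ_le_const2[OF limq], intro exI allI impI)
      fix n
      have "?q (v n) s a \<le> v (Suc n) (Some s)" unfolding v_Suc by (rule q_le[OF s that])
      also have "\<dots> \<le> U (Some s)" by (rule v_le_U)
      finally show "?q (v n) s a \<le> U (Some s)" .
    qed
    then have "step U (Some s) \<le> U (Some s)" by (intro step_le s)
    moreover have "U (Some s) \<le> step U (Some s)"
    proof (rule LIMSEQ_le_const2[OF LIMSEQ_Suc[OF lim]], intro exI allI impI)
      fix n show "v (Suc n) (Some s) \<le> step U (Some s)"
        unfolding v_Suc by (rule step_mono) (rule v_le_U)
    qed
    ultimately have "U (Some s) = step U (Some s)" by simp
    then show "\<exists>a\<in>A. U (Some s) = ?q U s a" using step_ex[OF s, of U] by simp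
  qed
qed

section \<open>Expected reward of a policy over one episode\<close>

definition lift_state :: "('s option \<Rightarrow> real) \<Rightarrow> ('s \<times> 'a) option \<Rightarrow> real" where
  "lift_state f x = (case x of None \<Rightarrow> 0 | Some (s, a) \<Rightarrow> if s \<in> S \<and> a \<in> A then f (Some s) else 0)"

text \<open>The conditional expectation of \<open>lift_state f\<close> one step later. As there, the
  value 0 off the legal pairs makes the function bounded on the whole type, which settles
  integrability.\<close>

definition lift_next :: "('s option \<Rightarrow> real) \<Rightarrow> ('s \<times> 'a) option \<Rightarrow> real" where
  "lift_next f x = (case x of None \<Rightarrow> 0 | Some (s, a) \<Rightarrow> if s \<in> S \<and> a \<in> A then exp_next M s a f else 0)"

definition lift_reward :: "('s \<times> 'a) option \<Rightarrow> real" where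
  "lift_reward x = (case x of None \<Rightarrow> 0 | Some (s, a) \<Rightarrow> if s \<in> S \<and> a \<in> A then reward M s a else 0)"

definition valid_pair :: "('s \<times> 'a) option \<Rightarrow> bool" where
  "valid_pair x \<longleftrightarrow> (case x of None \<Rightarrow> True | Some (s, a) \<Rightarrow> s \<in> S \<and> a \<in> A)"

lemma lift_state_bounds:
  assumes "\<And>x. 0 \<le> f x"
  shows "0 \<le> lift_state f x" "lift_state f x \<le> (\<Sum>s\<in>S. f (Some s))"
  using assms by (auto simp: lift_state_def sum_nonneg intro!: member_le_sum split: option.split)

lemma lift_next_bounds:
  assumes "f None = 0" "\<And>x. 0 \<le> f x"
  shows "0 \<le> lift_next f x" "lift_next f x \<le> (\<Sum>s\<in>S. f (Some s))"
proof -
  show "0 \<le> lift_next f x"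
    using assms by (auto simp: lift_next_def split: option.split intro!: mean_on_nonneg)
  have "exp_next M s a f \<le> (\<Sum>s\<in>S. f (Some s))" if "s \<in> S" "a \<in> A" for s a
  proof -
    have "exp_next M s a f \<le> exp_next M s a (\<lambda>_. \<Sum>s\<in>S. f (Some s))"
      using assms by (intro mean_on_mono) (auto intro!: member_le_sum sum_nonneg)
    also have "\<dots> = (\<Sum>s\<in>S. f (Some s))" by (rule mean_on_const[OF sum_trans[OF that]])
    finally show ?thesis .
  qed
  then show "lift_next f x \<le> (\<Sum>s\<in>S. f (Some s))"
    using assms by (auto simp: lift_next_def split: option.split intro!: sum_nonneg)
qed

lemma lift_reward_bounds: "0 \<le> lift_reward x" "lift_reward x \<le> 1"
  using reward_nonneg reward_le by (auto simp: lift_reward_def split: option.split)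

context
  fixes \<pi> and s0
  assumes \<pi>: "\<pi> \<in> HD_policies M" and s0: "s0 \<in> S"
begin

text \<open>The last clause keeps only that the action comes from the policy after some history; for
  stationary policies this determines it.\<close>

lemma AE_episode:
  "AE \<omega> in episode M \<pi> s0. \<omega> 0 = Some (s0, \<pi> [] s0) \<and>
     (\<forall>t. valid_pair (\<omega> t) \<and> (\<omega> t = None \<longrightarrow> \<omega> (Suc t) = None) \<and>
          (\<forall>s a. \<omega> t = Some (s, a) \<longrightarrow> (\<exists>h. a = \<pi> h s)))"
proof -
  let ?\<kappa> = "episode_step M \<pi> s0"
  have "AE \<omega> in episode M \<pi> s0. \<forall>t. \<omega> t \<in> set_pmf (?\<kappa> (map \<omega> [0..<t]))"
    unfolding episode_def by (rule AE_trajectories_support)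
  then show ?thesis
  proof eventually_elim
    case (elim \<omega>)
    have 0: "\<omega> 0 = Some (s0, \<pi> [] s0)"
      using spec[OF elim, of 0] by (simp add: episode_step_def)
    have Suc_None: "\<omega> (Suc t) = None" if "\<omega> t = None" for t
      using elim[rule_format, of "Suc t"] that by (simp add: episode_step_def)
    have Suc_Some: "\<omega> (Suc t) \<in> map_option (\<lambda>x. (x, \<pi> (map the (map \<omega> [0..<Suc t])) x)) ` set_pmf (trans M s a)"
      if "\<omega> t = Some (s, a)" for t s a
      using elim[rule_format, of "Suc t"] that by (simp add: episode_step_def)
    have "valid_pair (\<omega> t) \<and> (\<forall>s a. \<omega> t = Some (s, a) \<longrightarrow> (\<exists>h. a = \<pi> h s))" for t
    proof (induction t)
      case 0
      from \<open>\<omega> 0 = Some (s0, \<pi> [] s0)\<close> show ?case using \<pi> s0 by (auto simp: valid_pair_def HD_policies_def)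
    next
      case (Suc t)
      show ?case
      proof (cases "\<omega> t")
        case None
        then show ?thesis by (simp add: Suc_None valid_pair_def)
      next
        case (Some sa)
        obtain s a where sa: "sa = (s, a)" by (cases sa)
        then have "s \<in> S" "a \<in> A" using Suc Some by (auto simp: valid_pair_def)
        define h where "h = map the (map \<omega> [0..<Suc t])"
        obtain y where y: "y \<in> set_pmf (trans M s a)" "\<omega> (Suc t) = map_option (\<lambda>x. (x, \<pi> h x)) y"
          using Suc_Some[of t s a] Some sa unfolding h_def by blast
        then have "y \<in> X" using set_trans[OF \<open>s \<in> S\<close> \<open>a \<in> A\<close>] by blast
        then show ?thesis
          using y(2) \<pi> by (cases y) (auto simp: valid_pair_def HD_policies_def)
      qed
    qed
    then show ?case using 0 Suc_None by auto
  qed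
qed

lemma measurable_episode [measurable]:
  "(\<lambda>\<omega>. \<omega> i) \<in> episode M \<pi> s0 \<rightarrow>\<^sub>M count_space UNIV"
  unfolding episode_def by measurable

lemma integrable_episode:
  fixes f :: "('s \<times> 'a) option \<Rightarrow> real"
  assumes "\<And>x. 0 \<le> f x" "\<And>x. f x \<le> C"
  shows "integrable (episode M \<pi> s0) (\<lambda>\<omega>. f (\<omega> i))"
proof -
  interpret prob_space "episode M \<pi> s0"
    unfolding episode_def by (rule prob_space_trajectories)
  have "(\<lambda>\<omega>. f (\<omega> i)) \<in> borel_measurable (episode M \<pi> s0)"
    by (rule measurable_compose[OF measurable_episode]) simp
  then show ?thesis
    using assms by (intro integrable_const_bound[where B = C]) auto
qed

text \<open>The tower property for a function of the last entry. The action attached to the new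
  state is legal and otherwise immaterial to \<open>lift_state\<close>, so averaging over the new
  state gives \<open>lift_next f\<close>.\<close>

lemma expectation_lift_state_Suc:
  assumes f: "f None = 0" "\<And>x. 0 \<le> f x"
  shows "(LINT \<omega>|episode M \<pi> s0. lift_state f (\<omega> (Suc i))) = (LINT \<omega>|episode M \<pi> s0. lift_next f (\<omega> i))"
proof -
  let ?\<kappa> = "episode_step M \<pi> s0"
  have "(LINT \<omega>|episode M \<pi> s0. lift_state f (\<omega> (Suc i))) =
      (LINT \<omega>|trajectories ?\<kappa>. lift_state f (last (map \<omega> [0..<Suc (Suc i)])))"
    by (simp add: episode_def)
  also have "\<dots> = (LINT \<omega>|trajectories ?\<kappa>. LINT x|?\<kappa> (map \<omega> [0..<Suc i]).
      lift_state f (last (map \<omega> [0..<Suc i] @ [x])))"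
    by (rule expectation_prefix_Suc[where f = "\<lambda>h. lift_state f (last h)", OF lift_state_bounds]) (rule f)+
  also have "\<dots> = (LINT \<omega>|episode M \<pi> s0. LINT x|?\<kappa> (map \<omega> [0..<Suc i]). lift_state f x)"
    by (simp add: episode_def)
  also have "\<dots> = (LINT \<omega>|episode M \<pi> s0. lift_next f (\<omega> i))"
  proof (rule integral_cong_AE)
    show "(\<lambda>\<omega>. LINT x|?\<kappa> (map \<omega> [0..<Suc i]). lift_state f x) \<in> borel_measurable (episode M \<pi> s0)"
      unfolding episode_def by (rule measurable_compose[OF measurable_prefix]) simp
    show "(\<lambda>\<omega>. lift_next f (\<omega> i)) \<in> borel_measurable (episode M \<pi> s0)"
      by (rule measurable_compose[OF measurable_episode]) simp
    show "AE \<omega> in episode M \<pi> s0. (LINT x|?\<kappa> (map \<omega> [0..<Suc i]). lift_state f x) = lift_next f (\<omega> i)"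
      using AE_episode
    proof eventually_elim
      case (elim \<omega>)
      show ?case
      proof (cases "\<omega> i")
        case None
        then show ?thesis by (simp add: episode_step_def lift_state_def lift_next_def)
      next
        case (Some sa)
        obtain s a where sa: "sa = (s, a)" by (cases sa)
        with elim Some have sa_in: "s \<in> S" "a \<in> A" by (auto simp: valid_pair_def dest!: spec[of _ i])
        let ?h = "map the (map \<omega> [0..<Suc i])"
        have "(LINT x|?\<kappa> (map \<omega> [0..<Suc i]). lift_state f x) =
            (LINT x|trans M s a. lift_state f (map_option (\<lambda>x. (x, \<pi> ?h x)) x))"
          using Some sa by (simp add: episode_step_def)
        also have "\<dots> = exp_next M s a (\<lambda>x. lift_state f (map_option (\<lambda>x. (x, \<pi> ?h x)) x))"
          by (rule expectation_trans[OF sa_in])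
        also have "\<dots> = exp_next M s a f"
          using \<pi> f by (intro mean_on_cong) (auto simp: lift_state_def HD_policies_def)
        finally show ?thesis using Some sa sa_in by (simp add: lift_next_def)
      qed
    qed
  qed
  finally show ?thesis .
qed

lemma integrable_lift:
  assumes "f None = 0" "\<And>x. 0 \<le> f x"
  shows "integrable (episode M \<pi> s0) (\<lambda>\<omega>. lift_state f (\<omega> i))"
    "integrable (episode M \<pi> s0) (\<lambda>\<omega>. lift_next f (\<omega> i))"
    "integrable (episode M \<pi> s0) (\<lambda>\<omega>. lift_reward (\<omega> i))"
  by (rule integrable_episode[OF lift_state_bounds] integrable_episode[OF lift_next_bounds]
      integrable_episode[OF lift_reward_bounds]; use assms in simp)+

lemma expectation_lift_state_0:
  assumes "f None = 0" "\<And>x. 0 \<le> f x"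
  shows "(LINT \<omega>|episode M \<pi> s0. lift_state f (\<omega> 0)) = f (Some s0)"
proof -
  interpret prob_space "episode M \<pi> s0"
    unfolding episode_def by (rule prob_space_trajectories)
  have "AE \<omega> in episode M \<pi> s0. lift_state f (\<omega> 0) = f (Some s0)"
    using AE_episode
  proof eventually_elim
    case (elim \<omega>)
    then show ?case using \<pi> s0 by (auto simp: lift_state_def HD_policies_def)
  qed
  then have "(LINT \<omega>|episode M \<pi> s0. lift_state f (\<omega> 0)) = (LINT \<omega>|episode M \<pi> s0. f (Some s0))"
    by (intro integral_cong_AE borel_measurable_integrable integrable_lift(1)[of f, OF assms]) auto
  then show ?thesis by (simp add: prob_space)
qed

text \<open>A Lyapunov inequality, telescoped: the expectation of \<open>f\<close> falls by at least
  that of \<open>g\<close> in each step. It serves with \<open>g\<close> the reward and with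
  \<open>g\<close> the indicator that the episode is still running.\<close>

lemma sum_expected_reward_le:
  assumes f: "f None = 0" "\<And>x. 0 \<le> f x"
    and g: "\<And>x. 0 \<le> g x" "\<And>x. g x \<le> C"
    and le: "\<And>x. valid_pair x \<Longrightarrow> g x + lift_next f x \<le> lift_state f x"
  shows "(\<Sum>i<n. LINT \<omega>|episode M \<pi> s0. g (\<omega> i)) \<le>
    f (Some s0) - (LINT \<omega>|episode M \<pi> s0. lift_state f (\<omega> n))"
proof (induction n)
  case 0
  then show ?case by (simp add: expectation_lift_state_0[of f, OF f])
next
  case (Suc n)
  have "(LINT \<omega>|episode M \<pi> s0. g (\<omega> n)) + (LINT \<omega>|episode M \<pi> s0. lift_next f (\<omega> n)) =
      (LINT \<omega>|episode M \<pi> s0. g (\<omega> n) + lift_next f (\<omega> n))"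
    by (intro Bochner_Integration.integral_add[symmetric] integrable_episode[OF g] integrable_lift f)
  also have "\<dots> \<le> (LINT \<omega>|episode M \<pi> s0. lift_state f (\<omega> n))"
  proof (intro integral_mono_AE Bochner_Integration.integrable_add integrable_episode[OF g] integrable_lift f)
    show "AE \<omega> in episode M \<pi> s0. g (\<omega> n) + lift_next f (\<omega> n) \<le> lift_state f (\<omega> n)"
      using AE_episode by eventually_elim (simp add: le)
  qed
  finally show ?case
    using Suc by (simp add: expectation_lift_state_Suc[of f, OF f])
qed

lemma sum_expected_reward_eq:
  assumes f: "f None = 0" "\<And>x. 0 \<le> f x" and p: "\<pi> = (\<lambda>_. p)"
    and eq: "\<And>s. s \<in> S \<Longrightarrow> reward M s (p s) + exp_next M s (p s) f = f (Some s)"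
  shows "(\<Sum>i<n. LINT \<omega>|episode M \<pi> s0. lift_reward (\<omega> i)) =
    f (Some s0) - (LINT \<omega>|episode M \<pi> s0. lift_state f (\<omega> n))"
proof (induction n)
  case 0
  then show ?case by (simp add: expectation_lift_state_0[of f, OF f])
next
  case (Suc n)
  have "(LINT \<omega>|episode M \<pi> s0. lift_reward (\<omega> n)) + (LINT \<omega>|episode M \<pi> s0. lift_next f (\<omega> n)) =
      (LINT \<omega>|episode M \<pi> s0. lift_reward (\<omega> n) + lift_next f (\<omega> n))"
    by (intro Bochner_Integration.integral_add[symmetric] integrable_lift[of f] f)
  also have "\<dots> = (LINT \<omega>|episode M \<pi> s0. lift_state f (\<omega> n))"
  proof (rule integral_cong_AE)
    show "(\<lambda>\<omega>. lift_reward (\<omega> n) + lift_next f (\<omega> n)) \<in> borel_measurable (episode M \<pi> s0)"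
      by (intro borel_measurable_integrable Bochner_Integration.integrable_add integrable_lift[of f] f)
    show "(\<lambda>\<omega>. lift_state f (\<omega> n)) \<in> borel_measurable (episode M \<pi> s0)"
      by (intro borel_measurable_integrable integrable_lift[of f] f)
    show "AE \<omega> in episode M \<pi> s0. lift_reward (\<omega> n) + lift_next f (\<omega> n) = lift_state f (\<omega> n)"
      using AE_episode
    proof eventually_elim
      case (elim \<omega>)
      show ?case
      proof (cases "\<omega> n")
        case None
        then show ?thesis by (simp add: lift_reward_def lift_state_def lift_next_def)
      next
        case (Some sa)
        obtain s a where sa: "sa = (s, a)" by (cases sa)
        have "valid_pair (\<omega> n)" "\<exists>h. a = \<pi> h s" using elim Some sa by blast+
        then show ?thesis
          using Some sa p eq[of s] by (auto simp: lift_reward_def lift_state_def lift_next_def valid_pair_def)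
      qed
    qed
  qed
  finally show ?case
    using Suc by (simp add: expectation_lift_state_Suc[of f, OF f])
qed

text \<open>\<open>w\<close> pays 1 for every step taken, so the probabilities of still running are
  summable, with total at most \<open>w (Some s0)\<close>.\<close>

lemma expected_alive_tendsto_0:
  "(\<lambda>n. LINT \<omega>|episode M \<pi> s0. lift_state (\<lambda>x. if x = None then 0 else 1) (\<omega> n)) \<longlonglongrightarrow> 0"
proof -
  obtain w :: "'s option \<Rightarrow> real" where w: "w None = 0" "\<And>x. 0 \<le> w x"
    "\<And>s a. s \<in> S \<Longrightarrow> a \<in> A \<Longrightarrow> 1 + exp_next M s a w \<le> w (Some s)"
    using hitting_time_bound by blast
  let ?g = "lift_state (\<lambda>x. if x = None then 0 else 1)"
  have g: "0 \<le> ?g x" "?g x \<le> 1" for x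
    by (auto simp: lift_state_def split: option.split)
  have "(\<Sum>i<n. LINT \<omega>|episode M \<pi> s0. ?g (\<omega> i)) \<le> w (Some s0)" for n
  proof -
    have "(\<Sum>i<n. LINT \<omega>|episode M \<pi> s0. ?g (\<omega> i)) \<le>
        w (Some s0) - (LINT \<omega>|episode M \<pi> s0. lift_state w (\<omega> n))"
    proof (rule sum_expected_reward_le[where f = w and g = ?g, OF w(1,2) g])
      show "?g x + lift_next w x \<le> lift_state w x" if "valid_pair x" for x
        using that w(3) by (auto simp: valid_pair_def lift_state_def lift_next_def split: option.split)
    qed
    also have "\<dots> \<le> w (Some s0)"
      using lift_state_bounds(1)[of w] w(2) by (simp add: Bochner_Integration.integral_nonneg)
    finally show ?thesis .
  qed
  then have "summable (\<lambda>i. LINT \<omega>|episode M \<pi> s0. ?g (\<omega> i))"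
    by (intro bounded_imp_summable[where B = "w (Some s0)"] Bochner_Integration.integral_nonneg)
       (auto simp: g lessThan_Suc_atMost[symmetric] simp del: sum.lessThan_Suc)
  then show ?thesis by (rule summable_LIMSEQ_zero)
qed

text \<open>Exchange of sum and expectation. Rewards vanish after the end of the episode, so the sum
  up to the random length is an infinite series; properness makes this length meaningful almost
  surely, and nonnegativity makes the assumed summability absolute.\<close>

lemma policy_value_sums:
  assumes "summable (\<lambda>i. LINT \<omega>|episode M \<pi> s0. lift_reward (\<omega> i))"
  shows "(\<lambda>i. LINT \<omega>|episode M \<pi> s0. lift_reward (\<omega> i)) sums policy_value M \<pi> s0"
proof -
  have int: "integrable (episode M \<pi> s0) (\<lambda>\<omega>. lift_reward (\<omega> i))" for i
    by (rule integrable_episode[OF lift_reward_bounds])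
  have "AE \<omega> in episode M \<pi> s0. \<exists>i. \<omega> i = None"
    using all_proper[OF \<pi>] s0 by (auto simp: proper_def)
  with AE_episode have AE: "AE \<omega> in episode M \<pi> s0.
      (\<forall>i\<ge>episode_length \<omega>. lift_reward (\<omega> i) = 0) \<and>
      (\<Sum>i<episode_length \<omega>. case_prod (reward M) (the (\<omega> i))) = (\<Sum>i<episode_length \<omega>. lift_reward (\<omega> i))"
  proof eventually_elim
    case (elim \<omega>)
    have len: "\<omega> (episode_length \<omega>) = None"
      unfolding episode_length_def using elim(2) by (rule LeastI_ex)
    have "\<omega> i = None" if "episode_length \<omega> \<le> i" for i
      using that by (induction i rule: dec_induct) (use len elim(1) in auto)
    then have "\<forall>i\<ge>episode_length \<omega>. lift_reward (\<omega> i) = 0" by (simp add: lift_reward_def)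
    moreover have "case_prod (reward M) (the (\<omega> i)) = lift_reward (\<omega> i)" if "i < episode_length \<omega>" for i
    proof -
      have "\<omega> i \<noteq> None" using that unfolding episode_length_def by (rule not_less_Least)
      moreover have "valid_pair (\<omega> i)" using elim(1) by blast
      ultimately show ?thesis by (auto simp: lift_reward_def valid_pair_def split: option.splits)
    qed
    ultimately show ?case by simp
  qed
  have "(\<lambda>i. LINT \<omega>|episode M \<pi> s0. lift_reward (\<omega> i)) sums
      (LINT \<omega>|episode M \<pi> s0. (\<Sum>i. lift_reward (\<omega> i)))"
  proof (rule sums_integral[OF int])
    show "AE \<omega> in episode M \<pi> s0. summable (\<lambda>i. norm (lift_reward (\<omega> i)))"
      using AE
    proof eventually_elim
      case (elim \<omega>)
      then show ?case by (intro summable_finite[of "{..<episode_length \<omega>}"]) (auto simp: not_less)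
    qed
    show "summable (\<lambda>i. LINT \<omega>|episode M \<pi> s0. norm (lift_reward (\<omega> i)))"
      using assms by (simp add: lift_reward_bounds)
  qed
  also have "(LINT \<omega>|episode M \<pi> s0. (\<Sum>i. lift_reward (\<omega> i))) = policy_value M \<pi> s0"
  proof -
    have 1: "(\<lambda>\<omega>. \<Sum>i. lift_reward (\<omega> i)) \<in> borel_measurable (episode M \<pi> s0)"
      using int by (intro borel_measurable_suminf) (auto intro: borel_measurable_integrable)
    have eq: "AE \<omega> in episode M \<pi> s0. (\<Sum>i. lift_reward (\<omega> i)) =
        (\<Sum>i<episode_length \<omega>. case_prod (reward M) (the (\<omega> i)))"
      using AE
    proof eventually_elim
      case (elim \<omega>)
      then show ?case by (subst suminf_finite[of "{..<episode_length \<omega>}"]) (auto simp: not_less)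
    qed
    have 2: "(\<lambda>\<omega>. \<Sum>i<episode_length \<omega>. case_prod (reward M) (the (\<omega> i))) \<in> borel_measurable (episode M \<pi> s0)"
    proof (rule measurable_compose_countable[where g = episode_length])
      show "(\<lambda>\<omega>. \<Sum>i<n. case_prod (reward M) (the (\<omega> i))) \<in> borel_measurable (episode M \<pi> s0)" for n
        by (intro borel_measurable_sum measurable_compose[OF measurable_episode]) simp
      show "episode_length \<in> episode M \<pi> s0 \<rightarrow>\<^sub>M count_space UNIV"
        unfolding episode_length_def by measurable
    qed
    show ?thesis unfolding policy_value_def by (rule integral_cong_AE[OF 1 2 eq])
  qed
  finally show ?thesis .
qed

lemma policy_value_le:
  assumes f: "f None = 0" "\<And>x. 0 \<le> f x"
    and le: "\<And>s a. s \<in> S \<Longrightarrow> a \<in> A \<Longrightarrow> reward M s a + exp_next M s a f \<le> f (Some s)"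
  shows "policy_value M \<pi> s0 \<le> f (Some s0)"
proof -
  have b: "(\<Sum>i<n. LINT \<omega>|episode M \<pi> s0. lift_reward (\<omega> i)) \<le> f (Some s0)" for n
  proof -
    have "(\<Sum>i<n. LINT \<omega>|episode M \<pi> s0. lift_reward (\<omega> i)) \<le>
        f (Some s0) - (LINT \<omega>|episode M \<pi> s0. lift_state f (\<omega> n))"
    proof (rule sum_expected_reward_le[where f = f and g = lift_reward, OF f lift_reward_bounds])
      show "lift_reward x + lift_next f x \<le> lift_state f x" if "valid_pair x" for x
        using that le by (auto simp: valid_pair_def lift_state_def lift_next_def lift_reward_def split: option.split)
    qed
    also have "\<dots> \<le> f (Some s0)"
      using lift_state_bounds(1)[of f] f by (simp add: Bochner_Integration.integral_nonneg)
    finally show ?thesis .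
  qed
  then have "summable (\<lambda>i. LINT \<omega>|episode M \<pi> s0. lift_reward (\<omega> i))"
    by (intro bounded_imp_summable[where B = "f (Some s0)"] Bochner_Integration.integral_nonneg)
       (auto simp: lift_reward_bounds lessThan_Suc_atMost[symmetric] simp del: sum.lessThan_Suc)
  from policy_value_sums[OF this] show ?thesis
    unfolding sums_def by (rule LIMSEQ_le_const2) (use b in auto)
qed

text \<open>The partial sums miss \<open>f (Some s0)\<close> by the expectation of \<open>f\<close>
  at time \<open>n\<close>, which vanishes in the limit because \<open>f\<close> is bounded by
  \<open>C\<close> and the probability of still running tends to 0.\<close>

lemma policy_value_eq:
  assumes f: "f None = 0" "\<And>x. 0 \<le> f x" and p: "\<pi> = (\<lambda>_. p)"
    and eq: "\<And>s. s \<in> S \<Longrightarrow> reward M s (p s) + exp_next M s (p s) f = f (Some s)"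
  shows "policy_value M \<pi> s0 = f (Some s0)"
proof -
  define C where "C = (\<Sum>s\<in>S. f (Some s))"
  let ?a = "lift_state (\<lambda>x. if x = None then 0 else 1)"
  have "(\<lambda>n. LINT \<omega>|episode M \<pi> s0. lift_state f (\<omega> n)) \<longlonglongrightarrow> 0"
  proof (rule tendsto_sandwich[OF _ _ tendsto_const])
    show "(\<lambda>n. C * (LINT \<omega>|episode M \<pi> s0. ?a (\<omega> n))) \<longlonglongrightarrow> 0"
      using tendsto_mult_left[OF expected_alive_tendsto_0, of C] by simp
    have "lift_state f x \<le> C * ?a x" for x
      using lift_state_bounds(2)[of f x] f by (auto simp: lift_state_def C_def split: option.splits)
    then have "(LINT \<omega>|episode M \<pi> s0. lift_state f (\<omega> n)) \<le> (LINT \<omega>|episode M \<pi> s0. C * ?a (\<omega> n))" for n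
      using f by (intro integral_mono integrable_lift integrable_mult_right) auto
    then show "\<forall>\<^sub>F n in sequentially. (LINT \<omega>|episode M \<pi> s0. lift_state f (\<omega> n)) \<le>
        C * (LINT \<omega>|episode M \<pi> s0. ?a (\<omega> n))"
      by simp
    show "\<forall>\<^sub>F n in sequentially. 0 \<le> (LINT \<omega>|episode M \<pi> s0. lift_state f (\<omega> n))"
      using f by (intro always_eventually allI Bochner_Integration.integral_nonneg lift_state_bounds)
  qed
  from tendsto_diff[OF tendsto_const this, of "f (Some s0)"]
  have "(\<lambda>i. LINT \<omega>|episode M \<pi> s0. lift_reward (\<omega> i)) sums f (Some s0)"
    unfolding sums_def by (subst sum_expected_reward_eq[where f = f, OF f p eq]) simp_all
  moreover from this have "(\<lambda>i. LINT \<omega>|episode M \<pi> s0. lift_reward (\<omega> i)) sums policy_value M \<pi> s0"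
    by (intro policy_value_sums sums_summable)
  ultimately show ?thesis by (metis sums_unique2)
qed

end

text \<open>\<open>opt_value\<close> depends on an arbitrary choice among optimal policies. A policy
  greedy for the Bellman solution attains it and no policy exceeds it; hence an optimal one exists,
  and whichever is chosen has this value.\<close>

lemma opt_value_bellman:
  obtains U :: "'s option \<Rightarrow> real" where "U None = 0" "\<And>x. 0 \<le> U x"
    "\<And>s. s \<in> S \<Longrightarrow> U (Some s) = opt_value M s"
    "\<And>s a. s \<in> S \<Longrightarrow> a \<in> A \<Longrightarrow> reward M s a + exp_next M s a U \<le> U (Some s)"
    "\<And>s. s \<in> S \<Longrightarrow> \<exists>a\<in>A. U (Some s) = reward M s a + exp_next M s a U"
proof -
  obtain U :: "'s option \<Rightarrow> real" where U: "U None = 0" "\<And>x. 0 \<le> U x"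
    "\<And>s a. s \<in> S \<Longrightarrow> a \<in> A \<Longrightarrow> reward M s a + exp_next M s a U \<le> U (Some s)"
    "\<And>s. s \<in> S \<Longrightarrow> \<exists>a\<in>A. U (Some s) = reward M s a + exp_next M s a U"
    using bellman_solution by blast
  then obtain p where p: "\<And>s. s \<in> S \<Longrightarrow> p s \<in> A"
      "\<And>s. s \<in> S \<Longrightarrow> U (Some s) = reward M s (p s) + exp_next M s (p s) U"
    by metis
  have pHD: "(\<lambda>_. p) \<in> HD_policies M" using p by (simp add: HD_policies_def)
  have val: "policy_value M (\<lambda>_. p) s = U (Some s)" if "s \<in> S" for s
    by (rule policy_value_eq[where f = U, OF pHD that U(1,2) refl]) (simp add: p)
  have le: "policy_value M \<pi> s \<le> U (Some s)" if "\<pi> \<in> HD_policies M" "s \<in> S" for \<pi> s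
    by (rule policy_value_le[where f = U, OF that U(1,2,3)])
  have "optimal_stationary M p"
    using p val le by (simp add: optimal_stationary_def)
  then have opt: "optimal_stationary M (SOME p. optimal_stationary M p)"
    by (rule someI[where P = "optimal_stationary M"])
  define q where "q = (SOME p. optimal_stationary M p)"
  have q: "optimal_stationary M q" using opt by (simp add: q_def)
  then have "(\<lambda>_. q) \<in> HD_policies M" by (auto simp: optimal_stationary_def HD_policies_def)
  then have "policy_value M (\<lambda>_. q) s = U (Some s)" if "s \<in> S" for s
  proof (intro antisym le that)
    have "policy_value M (\<lambda>_. p) s \<le> policy_value M (\<lambda>_. q) s"
      using q pHD that unfolding optimal_stationary_def by blast
    then show "U (Some s) \<le> policy_value M (\<lambda>_. q) s" using val[OF that] by simp
  qed
  then have "opt_value M s = U (Some s)" if "s \<in> S" for s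
    using that by (simp add: opt_value_def q_def[symmetric])
  then show thesis using that[of U] U by simp
qed

end

subsection \<open>The learning process\<close>

text \<open>The pathwise properties that hold almost surely. Given them, the analysis of the
  algorithm is deterministic.\<close>

definition valid_run :: "('s, 'a) path_problem \<Rightarrow> ('s, 'a) learner \<Rightarrow> (nat \<Rightarrow> ('s, 'a) transition) \<Rightarrow> bool" where
  "valid_run M L \<omega> \<longleftrightarrow> (\<forall>t. fst (\<omega> t) = current_state M (map \<omega> [0..<t]) \<and>
     fst (snd (\<omega> t)) = L (map \<omega> [0..<t]) (fst (\<omega> t)) \<and>
     fst (\<omega> t) \<in> states M \<and> fst (snd (\<omega> t)) \<in> actions M \<and> snd (snd (\<omega> t)) \<in> successors M)"

lemma current_state_0 [simp]: "current_state M [] = init M"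
  by (simp add: current_state_def)

lemma current_state_Suc [simp]:
  "current_state M (h @ [y]) = (case snd (snd y) of None \<Rightarrow> init M | Some s' \<Rightarrow> s')"
  by (simp add: current_state_def split: prod.split option.split)

context nonneg_path_problem
begin

context
  fixes L :: "('s, 'a) learner"
  assumes L: "\<And>h s. s \<in> S \<Longrightarrow> L h s \<in> A"
begin

lemma AE_valid_run: "AE \<omega> in learning M L. valid_run M L \<omega>"
proof -
  have "AE \<omega> in learning M L. \<forall>t. \<omega> t \<in> set_pmf (learning_step M L (map \<omega> [0..<t]))"
    unfolding learning_def by (rule AE_trajectories_support)
  then show ?thesis
  proof eventually_elim
    case (elim \<omega>)
    have step: "fst (\<omega> t) = current_state M (map \<omega> [0..<t])"
        "fst (snd (\<omega> t)) = L (map \<omega> [0..<t]) (fst (\<omega> t))"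
        "snd (snd (\<omega> t)) \<in> set_pmf (trans M (fst (\<omega> t)) (fst (snd (\<omega> t))))" for t
      using elim[rule_format, of t] by (auto simp: learning_step_def Let_def)
    have S: "current_state M (map \<omega> [0..<t]) \<in> S" for t
    proof (induction t)
      case (Suc t)
      then have "snd (snd (\<omega> t)) \<in> X"
        using step[of t] set_trans[OF Suc L[OF Suc]] by auto
      then show ?case by (auto split: option.split)
    qed simp
    have "snd (snd (\<omega> t)) \<in> X" for t
      using step[of t] set_trans[OF S[of t] L[OF S[of t]]] by auto
    then show ?case using step S L by (auto simp: valid_run_def)
  qed
qed

text \<open>While no episode ends, \<open>w\<close> shrinks in expectation by the factor \<rho> at
  least, so \<open>w\<close> divided by the power of \<rho> is a nonnegative supermartingale. If the
  goal were never reached after time \<open>m\<close>, it would tend to infinity because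
  \<open>w\<close> is at least 1 on states; by Ville's inequality, exceeding every level has
  probability 0.\<close>

lemma AE_goal_after: "AE \<omega> in learning M L. \<exists>t\<ge>m. reaches_goal (\<omega> t)"
proof -
  interpret P: prob_space "learning M L"
    unfolding learning_def by (rule prob_space_trajectories)
  obtain w :: "'s option \<Rightarrow> real" where w: "w None = 0" "\<And>x. 0 \<le> w x"
    "\<And>s a. s \<in> S \<Longrightarrow> a \<in> A \<Longrightarrow> 1 + exp_next M s a w \<le> w (Some s)"
    using hitting_time_bound by blast
  \<comment> \<open>The summand 2 keeps \<rho> positive.\<close>
  define W where "W = 2 + (\<Sum>s\<in>S. w (Some s))"
  have W: "w (Some s) \<le> W" "1 \<le> w (Some s)" if s: "s \<in> S" for s
  proof -
    have "w (Some s) \<le> (\<Sum>s\<in>S. w (Some s))" using s w by (intro member_le_sum) auto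
    then show "w (Some s) \<le> W" by (simp add: W_def)
    obtain a where a: "a \<in> A" using A_ne by auto
    have "0 \<le> exp_next M s a w" by (intro mean_on_nonneg w) simp
    then show "1 \<le> w (Some s)" using w(3)[OF s a] by simp
  qed
  have W2: "2 \<le> W" using w by (simp add: W_def sum_nonneg)
  define \<rho> where "\<rho> = 1 - 1 / W"
  have \<rho>: "0 < \<rho>" "\<rho> < 1" using W2 by (auto simp: \<rho>_def)
  \<comment> \<open>Factors are 1 before time \<open>m\<close>, so the process starts there;
    reaching the goal sets the product to 0 because \<open>w None = 0\<close>.\<close>
  define F where "F h y = (if length h < m \<or> current_state M h \<notin> S then 1
      else w (snd (snd y)) / (w (Some (current_state M h)) * \<rho>))" for h and y :: "('s, 'a) transition"
  have F_nonneg: "0 \<le> F h y" for h y using w \<rho> by (simp add: F_def)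
  have F_exp: "(\<integral>\<^sup>+y. ennreal (F h y) \<partial>learning_step M L h) \<le> 1" for h
  proof (cases "length h < m \<or> current_state M h \<notin> S")
    case True
    then show ?thesis by (simp add: F_def)
  next
    case False
    let ?s = "current_state M h"
    let ?a = "L h ?s"
    have s: "?s \<in> S" and a: "?a \<in> A" using False L by auto
    have "finite (set_pmf (trans M ?s ?a))" using set_trans[OF s a] by (rule finite_subset) simp
    then have "(\<integral>\<^sup>+y. ennreal (F h y) \<partial>learning_step M L h) =
        ennreal (LINT x|trans M ?s ?a. w x / (w (Some ?s) * \<rho>))"
      using False w \<rho> by (simp add: F_def learning_step_def Let_def nn_integral_eq_integral integrable_measure_pmf_finite)
    also have "(LINT x|trans M ?s ?a. w x / (w (Some ?s) * \<rho>)) = exp_next M ?s ?a w / (w (Some ?s) * \<rho>)"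
      by (simp add: expectation_trans[OF s a])
    finally have eq: "(\<integral>\<^sup>+y. ennreal (F h y) \<partial>learning_step M L h) =
        ennreal (exp_next M ?s ?a w / (w (Some ?s) * \<rho>))" .
    have "exp_next M ?s ?a w / (w (Some ?s) * \<rho>) \<le> 1"
    proof -
      have "w (Some ?s) * \<rho> = w (Some ?s) - w (Some ?s) / W" by (simp add: \<rho>_def algebra_simps)
      moreover have "w (Some ?s) / W \<le> 1" using W[OF s] W2 by simp
      ultimately have "exp_next M ?s ?a w \<le> w (Some ?s) * \<rho>" using w(3)[OF s a] by linarith
      moreover have "0 < w (Some ?s) * \<rho>" using W[OF s] \<rho> by simp
      ultimately show ?thesis by simp
    qed
    then show ?thesis unfolding eq by (simp add: ennreal_le_1)
  qed
  define N where "N k = {\<omega> \<in> space (learning M L). \<exists>n. real (Suc k) \<le> (\<Prod>t<n. F (map \<omega> [0..<t]) (\<omega> t))}" for k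
  note [measurable] = measurable_prefix_fun[where Y = F and \<kappa> = "learning_step M L"]
  have N_sets: "N k \<in> sets (learning M L)" for k
    unfolding N_def learning_def by measurable
  have N_le: "P.prob (N k) \<le> 1 / real (Suc k)" for k
    unfolding N_def learning_def by (rule ville[OF F_nonneg F_exp]) simp
  have "P.prob (\<Inter>k. N k) = 0"
  proof (rule antisym[OF _ measure_nonneg])
    have "P.prob (\<Inter>k. N k) \<le> 1 / real (Suc k)" for k
      by (rule order_trans[OF P.finite_measure_mono N_le[of k]]) (auto simp: N_sets)
    moreover have "(\<lambda>k. 1 / real (Suc k)) \<longlonglongrightarrow> 0" by real_asymp
    ultimately show "P.prob (\<Inter>k. N k) \<le> 0" by (intro LIMSEQ_le_const) auto
  qed
  then have "AE \<omega> in learning M L. \<omega> \<notin> (\<Inter>k. N k)"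
    by (subst P.prob_eq_0[symmetric]) (auto simp: N_sets)
  with AE_valid_run show ?thesis
  proof eventually_elim
    case (elim \<omega>)
    then obtain k where k: "\<omega> \<notin> N k" by auto
    show ?case
    proof (rule ccontr)
      assume neg: "\<not> (\<exists>t\<ge>m. reaches_goal (\<omega> t))"
      let ?s = "\<lambda>t. current_state M (map \<omega> [0..<t])"
      have s: "?s t \<in> S" for t using elim(1)[unfolded valid_run_def, rule_format, of t] by metis
      have next_s: "snd (snd (\<omega> t)) = Some (?s (Suc t))" if "m \<le> t" for t
        using neg that by (auto simp: reaches_goal_def split: option.split)
      have "(\<Prod>t<m + n. F (map \<omega> [0..<t]) (\<omega> t)) = w (Some (?s (m + n))) / (w (Some (?s m)) * \<rho> ^ n)" for n
      proof (induction n)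
        case 0
        have "(\<Prod>t<m. F (map \<omega> [0..<t]) (\<omega> t)) = 1"
          by (rule prod.neutral) (simp add: F_def)
        then show ?case using W(2)[OF s[of m]] by simp
      next
        case (Suc n)
        have "F (map \<omega> [0..<m + n]) (\<omega> (m + n)) = w (Some (?s (Suc (m + n)))) / (w (Some (?s (m + n))) * \<rho>)"
          using s[of "m + n"] next_s[of "m + n"] by (simp add: F_def del: upt_Suc)
        then show ?case using Suc W(2)[OF s[of "m + n"]] by (simp del: upt_Suc)
      qed
      moreover have "1 / W / \<rho> ^ n \<le> w (Some (?s (m + n))) / (w (Some (?s m)) * \<rho> ^ n)" for n
      proof -
        have "1 / W \<le> w (Some (?s (m + n))) / w (Some (?s m))"
          using W[OF s[of m]] W(2)[OF s[of "m + n"]] W2 by (intro frac_le) auto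
        then have "1 / W / \<rho> ^ n \<le> w (Some (?s (m + n))) / w (Some (?s m)) / \<rho> ^ n"
          using \<rho> by (intro divide_right_mono) auto
        then show ?thesis by simp
      qed
      moreover obtain n where "\<rho> ^ n < 1 / (W * real (Suc k))"
        using real_arch_pow_inv[of "1 / (W * real (Suc k))" \<rho>] \<rho> W2 by auto
      then have "\<rho> ^ n * (W * real (Suc k)) \<le> 1"
        using W2 by (simp add: less_divide_eq del: of_nat_Suc)
      then have "real (Suc k) * W * \<rho> ^ n \<le> 1" by (simp only: mult_ac)
      then have "real (Suc k) \<le> 1 / W / \<rho> ^ n"
        using \<rho> W2 by (simp add: le_divide_eq del: of_nat_Suc)
      ultimately have "real (Suc k) \<le> (\<Prod>t<m + n. F (map \<omega> [0..<t]) (\<omega> t))" by (metis order_trans)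
      then show False using k by (auto simp: N_def learning_def)
    qed
  qed
qed

lemma AE_infinite_goals: "AE \<omega> in learning M L. infinite {t. reaches_goal (\<omega> t)}"
proof -
  have "AE \<omega> in learning M L. \<forall>m. \<exists>t\<ge>m. reaches_goal (\<omega> t)"
    using AE_goal_after by (simp add: AE_all_countable)
  then show ?thesis
    by eventually_elim (simp add: infinite_nat_iff_unbounded_le)
qed

end

end

subsection \<open>Variance\<close>

lemma mean_square_shift:
  assumes "sum p X = 1"
  shows "mean_on X p (\<lambda>x. (f x - c)\<^sup>2) = variance_on X p f + (mean_on X p f - c)\<^sup>2"
proof -
  let ?m = "mean_on X p f"
  have "mean_on X p (\<lambda>x. (f x - c)\<^sup>2) = mean_on X p (\<lambda>x. ((f x)\<^sup>2 - 2 * c * f x) + c\<^sup>2)"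
    by (rule mean_on_cong) (simp add: power2_eq_square algebra_simps)
  also have "\<dots> = mean_on X p (\<lambda>x. (f x)\<^sup>2) - 2 * c * ?m + c\<^sup>2"
    by (simp add: mean_on_add mean_on_diff mean_on_cmult mean_on_const[OF assms])
  finally show ?thesis by (simp add: variance_on_def power2_eq_square algebra_simps)
qed

lemma variance_on_eq:
  assumes "sum p X = 1"
  shows "variance_on X p f = mean_on X p (\<lambda>x. (f x - mean_on X p f)\<^sup>2)"
  using mean_square_shift[OF assms, of f "mean_on X p f"] by simp

lemma variance_on_nonneg:
  assumes "sum p X = 1" "\<And>x. x \<in> X \<Longrightarrow> 0 \<le> p x"
  shows "0 \<le> variance_on X p f"
  unfolding variance_on_eq[OF assms(1)] by (intro mean_on_nonneg assms) auto

lemma variance_on_le_mean_square: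
  assumes "sum p X = 1"
  shows "variance_on X p f \<le> mean_on X p (\<lambda>x. (f x - c)\<^sup>2)"
  using mean_square_shift[OF assms, of f c] by simp

lemma variance_on_add_le:
  assumes "sum p X = 1" "\<And>x. x \<in> X \<Longrightarrow> 0 \<le> p x"
  shows "variance_on X p (\<lambda>x. f x + g x) \<le> 2 * variance_on X p f + 2 * variance_on X p g"
proof -
  let ?f = "mean_on X p f" and ?g = "mean_on X p g"
  have "variance_on X p (\<lambda>x. f x + g x) \<le> mean_on X p (\<lambda>x. (f x + g x - (?f + ?g))\<^sup>2)"
    by (rule variance_on_le_mean_square[OF assms(1)])
  also have "\<dots> \<le> mean_on X p (\<lambda>x. 2 * (f x - ?f)\<^sup>2 + 2 * (g x - ?g)\<^sup>2)"
  proof (rule mean_on_mono[OF assms(2)])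
    fix x
    have "0 \<le> ((f x - ?f) - (g x - ?g))\<^sup>2" by simp
    then show "(f x + g x - (?f + ?g))\<^sup>2 \<le> 2 * (f x - ?f)\<^sup>2 + 2 * (g x - ?g)\<^sup>2"
      by (simp add: power2_eq_square algebra_simps)
  qed
  finally show ?thesis
    by (simp add: mean_on_add mean_on_cmult variance_on_eq[OF assms(1)])
qed

text \<open>Up to a constant the function is \<open>(f x - c)\<^sup>2\<close>, and squaring is
  Lipschitz with constant \<open>2 * R\<close> on the interval of radius \<open>R\<close>.\<close>

lemma variance_on_square_le:
  assumes "sum p X = 1" "\<And>x. x \<in> X \<Longrightarrow> 0 \<le> p x"
    and "\<And>x. x \<in> X \<Longrightarrow> \<bar>f x - c\<bar> \<le> R" "\<bar>mean_on X p f - c\<bar> \<le> R"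
  shows "variance_on X p (\<lambda>x. (f x)\<^sup>2 - 2 * c * f x) \<le> 4 * R\<^sup>2 * variance_on X p f"
proof -
  let ?m = "mean_on X p f"
  have "variance_on X p (\<lambda>x. (f x)\<^sup>2 - 2 * c * f x) \<le>
      mean_on X p (\<lambda>x. ((f x)\<^sup>2 - 2 * c * f x - (?m\<^sup>2 - 2 * c * ?m))\<^sup>2)"
    by (rule variance_on_le_mean_square[OF assms(1)])
  also have "\<dots> \<le> mean_on X p (\<lambda>x. 4 * R\<^sup>2 * (f x - ?m)\<^sup>2)"
  proof (rule mean_on_mono[OF assms(2)])
    fix x assume x: "x \<in> X"
    have "(f x)\<^sup>2 - 2 * c * f x - (?m\<^sup>2 - 2 * c * ?m) = ((f x - c) + (?m - c)) * (f x - ?m)"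
      by (simp add: power2_eq_square algebra_simps)
    moreover have "((f x - c) + (?m - c))\<^sup>2 \<le> (2 * R)\<^sup>2"
      using assms(3)[OF x] assms(4) by (intro abs_le_square_iff[THEN iffD1]) auto
    ultimately show "((f x)\<^sup>2 - 2 * c * f x - (?m\<^sup>2 - 2 * c * ?m))\<^sup>2 \<le> 4 * R\<^sup>2 * (f x - ?m)\<^sup>2"
      using mult_right_mono[of "((f x - c) + (?m - c))\<^sup>2" "(2 * R)\<^sup>2" "(f x - ?m)\<^sup>2"]
      by (simp add: power_mult_distrib)
  qed
  finally show ?thesis by (simp add: mean_on_cmult variance_on_eq[OF assms(1)])
qed

text \<open>
  The map \<open>v \<mapsto> p v + max (c1 * sqrt (variance v * y)) (c2 * B * y)\<close> is monotone on \<open>[0, B]\<close>: where the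
  variance term is active, its slope is at most \<open>2 * c1\<^sup>2 / c2 \<le> 1\<close>.
\<close>

lemma bernstein_bonus_mono:
  assumes p: "sum p X = 1" "\<And>x. x \<in> X \<Longrightarrow> 0 \<le> p x"
    and f: "\<And>x. x \<in> X \<Longrightarrow> 0 \<le> f x" "\<And>x. x \<in> X \<Longrightarrow> f x \<le> B" "\<And>x. x \<in> X \<Longrightarrow> f x \<le> g x"
    and c: "0 < c1" "2 * c1\<^sup>2 \<le> c2" and y: "0 \<le> y" "0 < B"
  shows "mean_on X p f + max (c1 * sqrt (variance_on X p f * y)) (c2 * B * y) \<le>
         mean_on X p g + max (c1 * sqrt (variance_on X p g * y)) (c2 * B * y)"
proof -
  let ?d = "\<lambda>x. g x - f x"
  let ?mf = "mean_on X p f" and ?mg = "mean_on X p g" and ?md = "mean_on X p ?d"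
  have md: "?md = ?mg - ?mf" by (rule mean_on_diff)
  have d0: "0 \<le> ?md" using p f by (intro mean_on_nonneg) auto
  have mf: "?mf \<le> B"
    using mean_on_mono[of X p f "\<lambda>_. B"] p f by (simp add: mean_on_const)
  let ?sf = "sqrt (variance_on X p f * y)" and ?sg = "sqrt (variance_on X p g * y)"
  have vf: "0 \<le> variance_on X p f" and vg: "0 \<le> variance_on X p g" and vd: "0 \<le> variance_on X p ?d"
    using variance_on_nonneg[OF p] by auto
  have var: "variance_on X p f - variance_on X p g \<le> 2 * B * ?md"
  proof -
    have "mean_on X p (\<lambda>x. (g x)\<^sup>2) = mean_on X p (\<lambda>x. (f x)\<^sup>2 + (2 * (f x * ?d x) + (?d x)\<^sup>2))"
      by (rule mean_on_cong) (simp add: power2_eq_square algebra_simps)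
    also have "\<dots> = mean_on X p (\<lambda>x. (f x)\<^sup>2) + (2 * mean_on X p (\<lambda>x. f x * ?d x) + mean_on X p (\<lambda>x. (?d x)\<^sup>2))"
      by (simp only: mean_on_add mean_on_cmult)
    finally have "variance_on X p g - variance_on X p f =
        2 * mean_on X p (\<lambda>x. f x * ?d x) - 2 * ?mf * ?md + variance_on X p ?d"
      unfolding variance_on_def md by (simp add: power2_eq_square algebra_simps)
    moreover have "0 \<le> mean_on X p (\<lambda>x. f x * ?d x)" using p f by (intro mean_on_nonneg) auto
    moreover have "?mf * ?md \<le> B * ?md" using mf d0 by (rule mult_right_mono)
    ultimately show ?thesis using vd by linarith
  qed
  show ?thesis
  proof (cases "c1 * ?sf \<le> c2 * B * y")
    case True
    then show ?thesis using d0 md by (simp add: max_def)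
  next
    case False
    have "c1 * ?sf \<le> ?md + c1 * ?sg"
    proof (cases "?sf \<le> ?sg")
      case True
      then have "c1 * ?sf \<le> c1 * ?sg" using c by (intro mult_left_mono) auto
      then show ?thesis using d0 by simp
    next
      case lt: False
      have "y \<noteq> 0" using False by auto
      then have By: "0 < B * y" using y by simp
      have "2 * c1\<^sup>2 * (B * y) \<le> c2 * (B * y)" using c By by (intro mult_right_mono) auto
      \<comment> \<open>The variance term is active and \<open>2 * c1\<^sup>2 \<le> c2\<close>,
        which bounds \<open>?sf\<close> from below by \<open>2 * c1 * (B * y)\<close>. This lower
        bound on the sum of the roots converts the difference of variances into a difference of
        roots.\<close>
      then have "c1 * (2 * c1 * (B * y)) < c1 * ?sf" using False by (simp add: power2_eq_square algebra_simps)
      then have s: "2 * c1 * (B * y) < ?sf" using c by simp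
      have "(?sf - ?sg) * (2 * c1 * (B * y)) \<le> (?sf - ?sg) * (?sf + ?sg)"
        using s lt vg y by (intro mult_left_mono) (auto intro: add_increasing2)
      also have "\<dots> = (variance_on X p f - variance_on X p g) * y"
      proof -
        have "(?sf - ?sg) * (?sf + ?sg) = ?sf\<^sup>2 - ?sg\<^sup>2" by (simp add: power2_eq_square algebra_simps)
        then show ?thesis using vf vg y by (simp add: algebra_simps)
      qed
      also have "\<dots> \<le> (2 * B * ?md) * y" by (rule mult_right_mono[OF var y(1)])
      finally have "(2 * (B * y)) * (c1 * (?sf - ?sg)) \<le> (2 * (B * y)) * ?md"
        by (simp add: algebra_simps)
      then have "c1 * (?sf - ?sg) \<le> ?md" using By by (subst (asm) mult_le_cancel_left_pos) auto
      then show ?thesis by (simp add: algebra_simps)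
    qed
    then show ?thesis using md False by (simp add: max_def)
  qed
qed

subsection \<open>Runs of VI-SP\<close>

lemma Vval_vi_update:
  "Vval (vi_update M c1 c2 B \<delta> (s, a, s') m) =
     (Vval m)(Some s := Max (Qval (vi_update M c1 c2 B \<delta> (s, a, s') m) s ` actions M))"
  by (simp only: vi_update_def Let_def prod.case vi_memory.simps)

text \<open>One run is fixed, so every fact here is pathwise and holds on each valid run.\<close>

locale vi_path = nonneg_path_problem M
  for M :: "('s::countable, 'a::countable) path_problem" +
  fixes c1 c2 B \<delta> :: real and L :: "('s, 'a) learner" and \<omega> :: "nat \<Rightarrow> ('s, 'a) transition"
  assumes B: "1 \<le> B" and c: "0 < c1" "2 * c1\<^sup>2 \<le> c2" and \<delta>: "0 < \<delta>" "\<delta> < 1"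
    and run: "runs_VI_SP M c1 c2 B \<delta> L" and valid: "valid_run M L \<omega>"
begin

text \<open>
  \<open>t\<close> counts from 0. In the notation of the paper at time \<open>t + 1\<close>: \<open>vis\<close> is \<open>n\<close>, \<open>emp\<close> is \<open>P\<close> with a bar,
  \<open>ker\<close> is \<open>P\<close>, \<open>io\<close> is \<open>\<iota>\<close> and \<open>bonus\<close> is \<open>b\<close>; but \<open>V t\<close> and \<open>Q t\<close> are the values before the update.
\<close>

definition "st t = fst (\<omega> t)"
definition "ac t = fst (snd (\<omega> t))"
definition "nx t = snd (snd (\<omega> t))"
definition "mem t = vi_run M c1 c2 B \<delta> (map \<omega> [0..<t])"
definition "Q t = Qval (mem t)"
definition "V t = Vval (mem t)"
definition "vis t = real (tot (mem (Suc t)) (st t) (ac t))"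
definition "emp t x = real (cnt (mem (Suc t)) (st t) (ac t) x) / vis t"
definition "ker t = pmf (trans M (st t) (ac t))"
definition "io t = log_term M \<delta> (B * vis t)"
definition "y t = io t / vis t"
definition "bonus t = max (c1 * sqrt (variance_on X (emp t) (V t) * y t)) (c2 * B * y t)"
definition "rew t = reward M (st t) (ac t)"

lemma path: "st t \<in> S" "ac t \<in> A" "nx t \<in> X" "st 0 = init M"
    "st (Suc t) = (case nx t of None \<Rightarrow> init M | Some s \<Rightarrow> s)"
  using valid[unfolded valid_run_def, rule_format, of t] valid[unfolded valid_run_def, rule_format, of 0]
    valid[unfolded valid_run_def, rule_format, of "Suc t"]
  by (auto simp: st_def ac_def nx_def)

lemma greedy: "a \<in> A \<Longrightarrow> Q t (st t) a \<le> Q t (st t) (ac t)"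
proof -
  assume a: "a \<in> A"
  have "ac t = L (map \<omega> [0..<t]) (st t)"
    using valid by (simp add: valid_run_def st_def ac_def)
  moreover have "is_arg_max (Q t (st t)) (\<lambda>a. a \<in> A) (L (map \<omega> [0..<t]) (st t))"
    using run path(1)[of t] by (auto simp: runs_VI_SP_def Q_def mem_def)
  ultimately show ?thesis using a by (auto simp: is_arg_max_linorder)
qed

lemma mem_0: "mem 0 = vi_init B"
  by (simp add: mem_def vi_run_def)

lemma mem_Suc: "mem (Suc t) = vi_update M c1 c2 B \<delta> (st t, ac t, nx t) (mem t)"
  by (simp add: mem_def vi_run_def st_def ac_def nx_def)

lemma tot_Suc: "tot (mem (Suc t)) s a = tot (mem t) s a + (if st t = s \<and> ac t = a then 1 else 0)"
  and cnt_Suc: "cnt (mem (Suc t)) s a x = cnt (mem t) s a x + (if st t = s \<and> ac t = a \<and> nx t = x then 1 else 0)"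
  by (auto simp: mem_Suc vi_update_def Let_def)

lemma tot_eq: "tot (mem t) s a = (\<Sum>i<t. if st i = s \<and> ac i = a then 1 else 0)"
  by (induction t) (simp_all add: mem_0 vi_init_def tot_Suc)

text \<open>Weighted transition counts as sums over past visits. In this form empirical means can be
  compared with the martingale sums of the concentration bounds.\<close>

lemma sum_cnt: "(\<Sum>x\<in>X. real (cnt (mem t) s a x) * f x) = (\<Sum>i<t. if st i = s \<and> ac i = a then f (nx i) else 0)"
proof (induction t)
  case 0
  then show ?case by (simp add: mem_0 vi_init_def)
next
  case (Suc t)
  have "(\<Sum>x\<in>X. real (cnt (mem (Suc t)) s a x) * f x) =
      (\<Sum>x\<in>X. real (cnt (mem t) s a x) * f x + (if st t = s \<and> ac t = a \<and> nx t = x then f x else 0))"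
    by (rule sum.cong) (auto simp: cnt_Suc algebra_simps)
  also have "\<dots> = (\<Sum>x\<in>X. real (cnt (mem t) s a x) * f x) +
      (\<Sum>x\<in>X. if nx t = x then (if st t = s \<and> ac t = a then f x else 0) else 0)"
    unfolding sum.distrib by (intro arg_cong2[where f = "(+)"] sum.cong) auto
  also have "(\<Sum>x\<in>X. if nx t = x then (if st t = s \<and> ac t = a then f x else 0) else 0) =
      (if st t = s \<and> ac t = a then f (nx t) else 0)"
    using path(3)[of t] by (simp add: sum.delta')
  finally show ?case using Suc by simp
qed

lemma vis_eq: "vis t = (\<Sum>i<Suc t. if st i = st t \<and> ac i = ac t then 1 else 0)"
  by (simp add: vis_def tot_eq del: sum.lessThan_Suc) (rule sum.cong, auto)

lemma vis_ge1: "1 \<le> vis t"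
  unfolding vis_eq by (simp add: sum_nonneg)

lemma vis_le: "t < n \<Longrightarrow> vis t \<le> real n"
proof -
  assume "t < n"
  have "vis t \<le> (\<Sum>i<Suc t. 1)" unfolding vis_eq by (rule sum_mono) simp
  then show ?thesis using \<open>t < n\<close> by simp
qed

lemma mean_emp: "mean_on X (emp t) f = (\<Sum>i<Suc t. if st i = st t \<and> ac i = ac t then f (nx i) else 0) / vis t"
proof -
  have "mean_on X (emp t) f = (\<Sum>x\<in>X. real (cnt (mem (Suc t)) (st t) (ac t) x) * f x) / vis t"
    unfolding mean_on_def emp_def sum_divide_distrib by (rule sum.cong) auto
  then show ?thesis by (simp only: sum_cnt)
qed

lemma emp_prob: "sum (emp t) X = 1" "0 \<le> emp t x"
proof -
  have "sum (emp t) X = mean_on X (emp t) (\<lambda>_. 1)" by (simp add: mean_on_def)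
  also have "\<dots> = 1" unfolding mean_emp using vis_ge1[of t] vis_eq[of t] by simp
  finally show "sum (emp t) X = 1" .
  show "0 \<le> emp t x" using vis_ge1[of t] by (simp add: emp_def)
qed

lemma ker_prob: "sum (ker t) X = 1" "0 \<le> ker t x"
  using sum_trans path by (auto simp: ker_def)

lemma Q_Suc: "Q (Suc t) s a = (if s = st t \<and> a = ac t
    then min (rew t + mean_on X (emp t) (V t) + bonus t) (Q t s a) else Q t s a)"
  and V_Suc: "V (Suc t) x = (if x = Some (st t) then Max (Q (Suc t) (st t) ` A) else V t x)"
proof -
  let ?n = "real (tot (mem t) (st t) (ac t) + 1)"
  have n: "vis t = ?n" by (simp add: vis_def tot_Suc)
  have e: "emp t = (\<lambda>x. real (((cnt (mem t))(st t := (cnt (mem t) (st t))(ac t :=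
      (cnt (mem t) (st t) (ac t))(nx t := cnt (mem t) (st t) (ac t) (nx t) + 1)))) (st t) (ac t) x) / ?n)"
    by (rule ext) (simp add: emp_def n cnt_Suc)
  have Q: "Q (Suc t) = (Q t)(st t := (Q t (st t))(ac t :=
      min (rew t + mean_on X (emp t) (V t) + bonus t) (Q t (st t) (ac t))))"
    unfolding bonus_def y_def io_def rew_def n e
    by (simp add: Q_def V_def mem_Suc vi_update_def Let_def)
  then show "Q (Suc t) s a = (if s = st t \<and> a = ac t
    then min (rew t + mean_on X (emp t) (V t) + bonus t) (Q t s a) else Q t s a)" by auto
  have "V (Suc t) = (V t)(Some (st t) := Max (Q (Suc t) (st t) ` A))"
    unfolding Q_def V_def mem_Suc by (rule Vval_vi_update)
  then show "V (Suc t) x = (if x = Some (st t) then Max (Q (Suc t) (st t) ` A) else V t x)" by simp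
qed

lemma log_term_pos: "0 < log_term M \<delta> x"
proof -
  have "1 \<le> card S" "1 \<le> card A"
    using A_ne init_S by (auto simp: Suc_le_eq card_gt_0_iff simp del: init_S)
  then have "1 * 1 \<le> real (card S) * real (card A)" by (intro mult_mono) auto
  then have "1 < real (card S) * real (card A) / \<delta>" using \<delta> by (simp add: less_divide_eq)
  then have "0 < ln (real (card S) * real (card A) / \<delta>)" by simp
  then show ?thesis unfolding log_term_def using lnln_nonneg[of x] by linarith
qed

lemma log_term_mono: "0 \<le> x \<Longrightarrow> x \<le> x' \<Longrightarrow> log_term M \<delta> x \<le> log_term M \<delta> x'"
  by (simp add: log_term_def lnln_mono)

lemma io_le: "t < n \<Longrightarrow> io t \<le> log_term M \<delta> (B * real n)"
  unfolding io_def using B vis_ge1[of t] vis_le[of t n]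
  by (intro log_term_mono mult_left_mono) auto

lemma y_pos: "0 < y t"
  using log_term_pos vis_ge1[of t] by (simp add: y_def io_def)

lemma c2_pos: "0 < c2"
  using c by (smt (verit) zero_less_power)

lemma bonus_nonneg: "0 \<le> bonus t"
  using c2_pos B y_pos[of t] by (simp add: bonus_def le_max_iff_disj)

section \<open>Range and monotonicity of the value estimates\<close>

lemma V_eq: "s \<in> S \<Longrightarrow> V t (Some s) = Max (Q t s ` A)"
proof (induction t)
  case 0
  have "(\<lambda>a. B) ` A = {B}" using A_ne by auto
  then show ?case by (simp add: V_def Q_def mem_0 vi_init_def)
next
  case (Suc t)
  then show ?case by (cases "s = st t") (auto simp: V_Suc Q_Suc cong: image_cong)
qed

lemma V_None [simp]: "V t None = 0"
  by (induction t) (simp_all add: V_Suc, simp add: V_def mem_0 vi_init_def)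

lemma Q_le_V: "s \<in> S \<Longrightarrow> a \<in> A \<Longrightarrow> Q t s a \<le> V t (Some s)"
  by (simp add: V_eq)

lemma V_le: "s \<in> S \<Longrightarrow> (\<And>a. a \<in> A \<Longrightarrow> Q t s a \<le> C) \<Longrightarrow> V t (Some s) \<le> C"
  using A_ne by (simp add: V_eq)

lemma V_st: "V t (Some (st t)) = Q t (st t) (ac t)"
  using path by (intro antisym V_le Q_le_V greedy) auto

lemma Q_decreasing: "Q (Suc t) s a \<le> Q t s a"
  by (simp add: Q_Suc)

lemma V_decreasing: "x \<in> X \<Longrightarrow> V (Suc t) x \<le> V t x"
  by (auto intro!: V_le order_trans[OF Q_decreasing Q_le_V])

lemma Q_le_B: "Q t s a \<le> B"
  by (induction t) (simp add: Q_def mem_0 vi_init_def, rule order_trans[OF Q_decreasing])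

lemma V_le_B: "x \<in> X \<Longrightarrow> V t x \<le> B"
  using B by (auto intro!: V_le Q_le_B)

lemma Q_nonneg_V_nonneg:
  "(s \<in> S \<longrightarrow> a \<in> A \<longrightarrow> 0 \<le> Q t s a) \<and> (x \<in> X \<longrightarrow> 0 \<le> V t x)"
proof (induction t arbitrary: s a x)
  case 0
  then show ?case using B by (simp add: Q_def V_def mem_0 vi_init_def)
next
  case (Suc t)
  have Q: "0 \<le> Q (Suc t) s a" if "s \<in> S" "a \<in> A" for s a
  proof -
    have "0 \<le> rew t + mean_on X (emp t) (V t) + bonus t"
      using Suc path by (intro add_nonneg_nonneg mean_on_nonneg bonus_nonneg emp_prob) (auto simp: rew_def reward_nonneg)
    moreover have "0 \<le> Q t s a" using Suc that by blast
    ultimately show ?thesis by (cases "s = st t \<and> a = ac t") (auto simp: Q_Suc)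
  qed
  obtain a where "a \<in> A" using A_ne by auto
  then have "0 \<le> V (Suc t) (Some s)" if "s \<in> S" for s
    using Q[OF that] Q_le_V[OF that] order_trans by blast
  then show ?case using Q by auto
qed

lemma Q_nonneg: "s \<in> S \<Longrightarrow> a \<in> A \<Longrightarrow> 0 \<le> Q t s a"
  and V_nonneg: "x \<in> X \<Longrightarrow> 0 \<le> V t x"
  using Q_nonneg_V_nonneg by blast+

text \<open>Only the entry of the visited pair changes, so each drop is the drop of the total over
  all pairs, a potential that starts at most at \<open>S * A * B\<close> and stays
  nonnegative.\<close>

lemma sum_Q_drop: "(\<Sum>t<n. Q t (st t) (ac t) - Q (Suc t) (st t) (ac t)) \<le> real (card S) * real (card A) * B"
proof -
  let ?T = "\<lambda>t. \<Sum>s\<in>S. \<Sum>a\<in>A. Q t s a"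
  have "Q t (st t) (ac t) - Q (Suc t) (st t) (ac t) = ?T t - ?T (Suc t)" for t
  proof -
    have "?T t - ?T (Suc t) = (\<Sum>s\<in>S. \<Sum>a\<in>A. Q t s a - Q (Suc t) s a)"
      by (simp add: sum_subtractf)
    also have "\<dots> = (\<Sum>s\<in>S. if s = st t then \<Sum>a\<in>A. Q t s a - Q (Suc t) s a else 0)"
      by (rule sum.cong) (auto simp: Q_Suc)
    also have "\<dots> = (\<Sum>a\<in>A. Q t (st t) a - Q (Suc t) (st t) a)"
      using path(1)[of t] by simp
    also have "\<dots> = (\<Sum>a\<in>A. if a = ac t then Q t (st t) a - Q (Suc t) (st t) a else 0)"
      by (rule sum.cong) (auto simp: Q_Suc)
    also have "\<dots> = Q t (st t) (ac t) - Q (Suc t) (st t) (ac t)"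
      using path(2)[of t] by simp
    finally show ?thesis by simp
  qed
  then have "(\<Sum>t<n. Q t (st t) (ac t) - Q (Suc t) (st t) (ac t)) = ?T 0 - ?T n"
    using sum_lessThan_telescope'[of ?T n] by simp
  also have "\<dots> \<le> ?T 0" using Q_nonneg by (simp add: sum_nonneg)
  also have "\<dots> \<le> (\<Sum>s\<in>S. \<Sum>a\<in>A. B)" by (intro sum_mono Q_le_B)
  finally show ?thesis by (simp add: algebra_simps)
qed

text \<open>The decrease at \<open>nx t\<close> is one of the nonnegative summands in the decrease
  of the total over all states.\<close>

lemma sum_V_drop: "(\<Sum>t<n. V t (nx t) - V (Suc t) (nx t)) \<le> real (card S) * B"
proof -
  let ?T = "\<lambda>t. \<Sum>s\<in>S. V t (Some s)"
  have "V t (nx t) - V (Suc t) (nx t) \<le> ?T t - ?T (Suc t)" for t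
  proof (cases "nx t")
    case None
    then show ?thesis by (simp add: sum_mono V_decreasing)
  next
    case (Some s)
    then have s: "s \<in> S" using path(3)[of t] by auto
    have "V t (Some s) - V (Suc t) (Some s) \<le> (\<Sum>s\<in>S. V t (Some s) - V (Suc t) (Some s))"
      using s by (intro member_le_sum) (auto simp: V_decreasing)
    then show ?thesis using Some by (simp add: sum_subtractf)
  qed
  then have "(\<Sum>t<n. V t (nx t) - V (Suc t) (nx t)) \<le> (\<Sum>t<n. ?T t - ?T (Suc t))"
    by (intro sum_mono)
  also have "\<dots> = ?T 0 - ?T n" by (rule sum_lessThan_telescope')
  also have "\<dots> \<le> ?T 0" by (simp add: sum_nonneg V_nonneg)
  also have "\<dots> \<le> (\<Sum>s\<in>S. B)" by (intro sum_mono V_le_B) auto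
  finally show ?thesis by simp
qed

text \<open>The visits to a pair are numbered 1, 2, 3 and so on, so each pair contributes a harmonic
  number. The bound \<open>1 + ln\<close> follows because \<open>harm (Suc m) - ln (Suc m)\<close>
  decreases from 1.\<close>

lemma sum_inverse_vis: "0 < n \<Longrightarrow> (\<Sum>t<n. 1 / vis t) \<le> real (card S) * real (card A) * (1 + ln (real n))"
proof -
  assume n: "0 < n"
  have eq: "(\<Sum>t<n. 1 / vis t) = (\<Sum>s\<in>S. \<Sum>a\<in>A. harm (tot (mem n) s a))" for n
  proof (induction n)
    case 0
    then show ?case by (simp add: mem_0 vi_init_def harm_def)
  next
    case (Suc n)
    have h: "harm (tot (mem (Suc n)) s a) = harm (tot (mem n) s a) +
        (if s = st n then if a = ac n then 1 / vis n else 0 else 0)" for s a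
      by (auto simp: vis_def tot_Suc harm_Suc inverse_eq_divide)
    have "(\<Sum>s\<in>S. \<Sum>a\<in>A. harm (tot (mem (Suc n)) s a)) =
        (\<Sum>s\<in>S. \<Sum>a\<in>A. harm (tot (mem n) s a)) +
        (\<Sum>s\<in>S. if s = st n then \<Sum>a\<in>A. if a = ac n then 1 / vis n else 0 else 0)"
      unfolding h sum.distrib by (intro arg_cong2[where f = "(+)"] refl sum.cong) auto
    also have "(\<Sum>s\<in>S. if s = st n then \<Sum>a\<in>A. if a = ac n then 1 / vis n else 0 else 0) = 1 / vis n"
      using path(1,2)[of n] by simp
    finally show ?case using Suc by simp
  qed
  have "harm (tot (mem n) s a) \<le> 1 + ln (real n)" for s a
  proof (cases "tot (mem n) s a = 0")
    case True
    then show ?thesis using n by (simp add: harm_def)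
  next
    case False
    have "tot (mem n) s a \<le> (\<Sum>i<n. 1)" unfolding tot_eq by (rule sum_mono) simp
    then have le: "tot (mem n) s a \<le> n" by simp
    have "harm (tot (mem n) s a) \<le> 1 + ln (real (tot (mem n) s a))"
      using decseqD[OF decseq_harm_diff_ln, of 0 "tot (mem n) s a - 1"] False by (simp add: harm_def)
    also have "\<dots> \<le> 1 + ln (real n)" using False le by simp
    finally show ?thesis .
  qed
  then have "(\<Sum>t<n. 1 / vis t) \<le> (\<Sum>s\<in>S. \<Sum>a\<in>A. 1 + ln (real n))"
    unfolding eq by (intro sum_mono)
  then show ?thesis by (simp add: algebra_simps)
qed

definition goals :: "nat \<Rightarrow> nat" where
  "goals n = card {t. t < n \<and> nx t = None}"

lemma goals_Suc: "goals (Suc n) = goals n + (if nx n = None then 1 else 0)"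
proof -
  have "{t. t < Suc n \<and> nx t = None} = {t. t < n \<and> nx t = None} \<union> (if nx n = None then {n} else {})"
    by (auto simp: less_Suc_eq)
  then show ?thesis by (auto simp: goals_def)
qed

text \<open>Along a run, the successor of time \<open>t\<close> is the state at time \<open>t + 1\<close> unless an episode ends.\<close>

lemma potential_sum:
  fixes \<phi> :: "nat \<Rightarrow> 's option \<Rightarrow> real"
  assumes "\<And>t. \<phi> t None = 0"
  shows "(\<Sum>t<n. \<phi> t (Some (st t)) - \<phi> (Suc t) (nx t)) =
    \<phi> 0 (Some (init M)) - \<phi> n (Some (st n)) + (\<Sum>t<n. if nx t = None then \<phi> (Suc t) (Some (init M)) else 0)"
proof (induction n)
  case 0
  then show ?case by (simp add: path)
next
  case (Suc n)
  then show ?case using path(5)[of n] assms by (cases "nx n") auto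
qed

text \<open>Every completed episode restarts at the initial state and contributes at least
  \<open>c\<close>. Applied to \<open>V\<close> with \<open>c\<close> the optimal value, to squares
  with \<open>c = 0\<close>, and to \<open>- U\<close>, which reverses the inequality.\<close>

lemma potential_sum_ge:
  fixes \<phi> :: "nat \<Rightarrow> 's option \<Rightarrow> real"
  assumes "\<And>t. \<phi> t None = 0" "\<And>t. c \<le> \<phi> t (Some (init M))"
  shows "\<phi> 0 (Some (init M)) - \<phi> n (Some (st n)) + real (goals n) * c \<le>
    (\<Sum>t<n. \<phi> t (Some (st t)) - \<phi> (Suc t) (nx t))"
proof -
  have "real (goals n) * c = (\<Sum>t<n. if nx t = None then c else 0)"
    by (induction n) (simp_all add: goals_Suc algebra_simps, simp add: goals_def)
  also have "\<dots> \<le> (\<Sum>t<n. if nx t = None then \<phi> (Suc t) (Some (init M)) else 0)"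
    using assms by (intro sum_mono) auto
  finally show ?thesis unfolding potential_sum[of \<phi>, OF assms(1)] by simp
qed

end

subsection \<open>Regret on the good event\<close>

lemma sum_sqrt_le:
  fixes f g :: "'i \<Rightarrow> real"
  assumes "\<And>i. i \<in> I \<Longrightarrow> 0 \<le> f i" "\<And>i. i \<in> I \<Longrightarrow> 0 \<le> g i"
  shows "(\<Sum>i\<in>I. sqrt (f i * g i)) \<le> sqrt ((\<Sum>i\<in>I. f i) * (\<Sum>i\<in>I. g i))"
proof (rule real_le_rsqrt)
  have "(\<Sum>i\<in>I. sqrt (f i * g i))\<^sup>2 = (\<Sum>i\<in>I. sqrt (f i) * sqrt (g i))\<^sup>2"
    by (simp add: real_sqrt_mult)
  also have "\<dots> \<le> (\<Sum>i\<in>I. (sqrt (f i))\<^sup>2) * (\<Sum>i\<in>I. (sqrt (g i))\<^sup>2)"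
    by (rule Cauchy_Schwarz_ineq_sum)
  also have "\<dots> = (\<Sum>i\<in>I. f i) * (\<Sum>i\<in>I. g i)"
    using assms by (simp cong: sum.cong)
  finally show "(\<Sum>i\<in>I. sqrt (f i * g i))\<^sup>2 \<le> (\<Sum>i\<in>I. f i) * (\<Sum>i\<in>I. g i)" .
qed

text \<open>Stated with free \<open>a\<close> so that rational factors can replace roots, such as
  3/2 for the root of 2 and 8 for the root of 50.\<close>

lemma sqrt_le_of_add_squares:
  fixes a b x :: real
  assumes "x \<le> a\<^sup>2 * u + b\<^sup>2" "0 \<le> a" "0 \<le> b" "0 \<le> u"
  shows "sqrt x \<le> a * sqrt u + b"
proof (rule real_le_lsqrt)
  show "0 \<le> a * sqrt u + b" using assms by simp
  have "(a * sqrt u + b)\<^sup>2 = a\<^sup>2 * u + b\<^sup>2 + 2 * (a * sqrt u) * b"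
    using assms by (simp add: power2_sum power_mult_distrib)
  moreover have "0 \<le> 2 * (a * sqrt u) * b" using assms by simp
  ultimately show "x \<le> (a * sqrt u + b)\<^sup>2" using assms(1) by linarith
qed

text \<open>The good event as assumptions. \<open>good_U\<close> and \<open>good_ker\<close> concern
  the empirical kernel, for one fixed function and for single entries; the other three are
  martingale bounds under the true kernel. In \<open>good_U2\<close> and \<open>good_W2\<close> the
  variance enters linearly, with coefficients 1/2 and 1/4 small enough to be absorbed by the very
  sums they help to bound. \<open>K\<close> is the concentration constant and \<open>D\<close> a
  common bound for \<open>K\<close>, \<open>c1\<close> and \<open>c2\<close>.\<close>

locale vi_good = vi_path M c1 c2 B \<delta> L \<omega>
  for M :: "('s::countable, 'a::countable) path_problem" and c1 c2 B \<delta> :: real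
    and L :: "('s, 'a) learner" and \<omega> :: "nat \<Rightarrow> ('s, 'a) transition" +
  fixes U :: "'s option \<Rightarrow> real" and Bs K D :: real
  assumes U: "U None = 0" "\<And>x. 0 \<le> U x" "\<And>x. x \<in> X \<Longrightarrow> U x \<le> Bs"
    and Bs: "1 \<le> Bs" "Bs \<le> B"
    and bellman_le: "\<And>s a. s \<in> S \<Longrightarrow> a \<in> A \<Longrightarrow> reward M s a + exp_next M s a U \<le> U (Some s)"
    and bellman_ex: "\<And>s. s \<in> S \<Longrightarrow> \<exists>a\<in>A. U (Some s) = reward M s a + exp_next M s a U"
    and K: "0 < K" "2 * K \<le> c1" "2 * K \<le> c2" and D: "8 \<le> D" "K \<le> D" "c1 \<le> D" "c2 \<le> D"
    and log_lb: "\<And>x. 1 / 8 \<le> log_term M \<delta> x"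
    and good_U: "\<And>t. \<bar>mean_on X (emp t) U - mean_on X (ker t) U\<bar> \<le>
      K * (sqrt (variance_on X (emp t) U * y t) + B * y t)"
    and good_ker: "\<And>t x. x \<in> X \<Longrightarrow> \<bar>emp t x - ker t x\<bar> \<le> K * (sqrt (emp t x * y t) + y t)"
    and good_V: "\<And>n. (\<Sum>t<n. mean_on X (ker t) (V t) - V t (nx t)) \<le>
      K * (sqrt ((\<Sum>t<n. variance_on X (ker t) (V t)) * log_term M \<delta> (B * real n)) + B * log_term M \<delta> (B * real n))"
    and good_U2: "\<And>n. (\<Sum>t<n. mean_on X (ker t) (\<lambda>x. (U x)\<^sup>2 - 2 * Bs * U x) - ((U (nx t))\<^sup>2 - 2 * Bs * U (nx t))) \<le>
      (\<Sum>t<n. variance_on X (ker t) U) / 2 + K * Bs\<^sup>2 * log_term M \<delta> (B * real n)"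
    and good_W2: "\<And>n. (\<Sum>t<n. mean_on X (ker t) (\<lambda>x. (V t x - U x)\<^sup>2) - (V t (nx t) - U (nx t))\<^sup>2) \<le>
      (\<Sum>t<n. variance_on X (ker t) (\<lambda>x. V t x - U x)) / 4 + K * B\<^sup>2 * log_term M \<delta> (B * real n)"
begin

lemma U_le_B: "x \<in> X \<Longrightarrow> U x \<le> B"
  using U(3)[of x] Bs by linarith

text \<open>The true mean of \<open>U\<close> is at most its empirical mean plus the concentration
  width, hence plus a bonus computed from \<open>U\<close>; monotonicity of the update then replaces
  \<open>U\<close> by the larger \<open>V t\<close>. The two claims need each other:
  \<open>Q\<close> uses the previous \<open>V\<close>, and \<open>V\<close> inherits from
  \<open>Q\<close> through the maximizing action of the Bellman equation.\<close>

lemma optimism: "(s \<in> S \<longrightarrow> a \<in> A \<longrightarrow> reward M s a + exp_next M s a U \<le> Q t s a) \<and> (x \<in> X \<longrightarrow> U x \<le> V t x)"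
proof (induction t arbitrary: s a x)
  case 0
  have "reward M s a + exp_next M s a U \<le> B" if "s \<in> S" "a \<in> A" for s a
    using bellman_le[OF that] U_le_B[of "Some s"] that by auto
  then show ?case using U_le_B U by (auto simp: Q_def V_def mem_0 vi_init_def)
next
  case (Suc t)
  have Q: "reward M s a + exp_next M s a U \<le> Q (Suc t) s a" if "s \<in> S" "a \<in> A" for s a
  proof (cases "s = st t \<and> a = ac t")
    case True
    let ?v = "\<lambda>f. sqrt (variance_on X (emp t) f * y t)"
    have "mean_on X (ker t) U \<le> mean_on X (emp t) U + K * (?v U + B * y t)"
      using good_U[of t] by linarith
    \<comment> \<open>The factor 2 in \<open>2 * K \<le> c1\<close> and
      \<open>2 * K \<le> c2\<close> pays for passing from a sum of two terms to their
      maximum.\<close>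
    also have "K * (?v U + B * y t) \<le> max (c1 * ?v U) (c2 * B * y t)"
    proof -
      have "2 * K * ?v U \<le> c1 * ?v U"
        using K variance_on_nonneg[OF emp_prob] y_pos[of t] by (intro mult_right_mono) auto
      moreover have "2 * K * (B * y t) \<le> c2 * (B * y t)"
        using K B y_pos[of t] by (intro mult_right_mono) auto
      ultimately show ?thesis by (simp add: algebra_simps)
    qed
    also have "mean_on X (emp t) U + max (c1 * ?v U) (c2 * B * y t) \<le> mean_on X (emp t) (V t) + bonus t"
      unfolding bonus_def using Suc U U_le_B c B y_pos[of t]
      by (intro bernstein_bonus_mono emp_prob) auto
    finally have "mean_on X (ker t) U \<le> mean_on X (emp t) (V t) + bonus t" by simp
    moreover have "reward M s a + exp_next M s a U \<le> Q t s a" using Suc that by blast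
    ultimately show ?thesis using True by (simp add: Q_Suc rew_def ker_def)
  next
    case False
    then show ?thesis using Suc that by (auto simp: Q_Suc)
  qed
  have "U (Some s) \<le> V (Suc t) (Some s)" if s: "s \<in> S" for s
  proof -
    obtain a where "a \<in> A" "U (Some s) = reward M s a + exp_next M s a U" using bellman_ex[OF s] by auto
    then show ?thesis using Q[OF s] Q_le_V[OF s] by (metis order_trans)
  qed
  then show ?case using Q U(1) by auto
qed

lemma U_le_V: "x \<in> X \<Longrightarrow> U x \<le> V t x"
  using optimism by blast

definition "W t x = V t x - U x"
definition "N = real (card S)"
definition "NA = real (card A)"
definition "vU t = variance_on X (ker t) U"
definition "vW t = variance_on X (ker t) (W t)"

lemma W_bounds: "x \<in> X \<Longrightarrow> 0 \<le> W t x" "x \<in> X \<Longrightarrow> W t x \<le> B"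
  using U_le_V[of x t] V_le_B[of x t] U(2)[of x] by (auto simp: W_def)

lemma N_ge1: "1 \<le> N" "1 \<le> NA"
  using A_ne init_S by (auto simp: N_def NA_def Suc_le_eq card_gt_0_iff simp del: init_S)

lemma vU_nonneg: "0 \<le> vU t" and vW_nonneg: "0 \<le> vW t"
  by (auto simp: vU_def vW_def intro!: variance_on_nonneg ker_prob)

section \<open>The empirical kernel compared with the true one\<close>

lemma card_X: "real (card X) \<le> 2 * N"
proof -
  have "card X = Suc (card S)" by (simp add: card_image)
  then show ?thesis using N_ge1 by (simp add: N_def)
qed

text \<open>The entrywise bound has the empirical probability itself under the root;
  \<open>D * sqrt (e * y) \<le> e / 2 + D\<^sup>2 * y / 2\<close> absorbs it on the left.\<close>

lemma emp_le: "x \<in> X \<Longrightarrow> emp t x \<le> 2 * ker t x + 3 * D\<^sup>2 * y t"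
proof -
  assume x: "x \<in> X"
  let ?e = "emp t x" and ?y = "y t"
  have e: "0 \<le> ?e" and y: "0 \<le> ?y" using emp_prob y_pos[of t] by auto
  have "?e - ker t x \<le> K * (sqrt (?e * ?y) + ?y)" using good_ker[OF x, of t] by linarith
  also have "\<dots> \<le> D * (sqrt (?e * ?y) + ?y)" using D e y by (intro mult_right_mono) auto
  finally have "?e - ker t x \<le> D * sqrt (?e * ?y) + D * ?y" by (simp only: distrib_left)
  moreover have "D * sqrt (?e * ?y) \<le> ?e / 2 + D\<^sup>2 * ?y / 2"
  proof -
    have "0 \<le> (sqrt ?e - D * sqrt ?y)\<^sup>2" by simp
    also have "\<dots> = ?e + D\<^sup>2 * ?y - 2 * (D * sqrt (?e * ?y))"
      using e y by (simp add: power2_diff power_mult_distrib real_sqrt_mult)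
    finally show ?thesis by simp
  qed
  moreover have "D * ?y \<le> D\<^sup>2 * ?y" using D y by (intro mult_right_mono) (auto simp: self_le_power)
  ultimately show ?thesis by linarith
qed

lemma abs_emp_diff_le: "x \<in> X \<Longrightarrow> \<bar>emp t x - ker t x\<bar> \<le> 2 * D * sqrt (ker t x * y t) + 3 * D\<^sup>2 * y t"
proof -
  assume x: "x \<in> X"
  let ?y = "y t"
  have y: "0 \<le> ?y" using y_pos[of t] by simp
  have k: "0 \<le> ker t x" by (rule ker_prob)
  have "emp t x * ?y \<le> (2 * ker t x + 3 * D\<^sup>2 * ?y) * ?y" by (rule mult_right_mono[OF emp_le[OF x] y])
  also have "\<dots> \<le> 2\<^sup>2 * (ker t x * ?y) + (2 * D * ?y)\<^sup>2"
  proof -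
    have "0 \<le> ker t x * ?y" "0 \<le> D\<^sup>2 * ?y\<^sup>2" using k y by auto
    then show ?thesis by (simp add: power2_eq_square algebra_simps)
  qed
  finally have "sqrt (emp t x * ?y) \<le> 2 * sqrt (ker t x * ?y) + 2 * D * ?y"
    using D k y by (intro sqrt_le_of_add_squares) auto
  then have "D * (sqrt (emp t x * ?y) + ?y) \<le> D * (2 * sqrt (ker t x * ?y) + 2 * D * ?y + ?y)"
    using D by (intro mult_left_mono) auto
  moreover have "\<bar>emp t x - ker t x\<bar> \<le> D * (sqrt (emp t x * ?y) + ?y)"
    using D y emp_prob(2)[of t x] by (intro order_trans[OF good_ker[OF x]] mult_right_mono) auto
  moreover have "D * ?y \<le> D\<^sup>2 * ?y" using D y by (intro mult_right_mono) (auto simp: self_le_power)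
  ultimately show ?thesis by (simp add: power2_eq_square algebra_simps)
qed

text \<open>Centring at the true mean can only enlarge the empirical second moment, and then the
  weights are replaced by \<open>emp_le\<close>. Each of the at most \<open>2 * N\<close> successors
  adds an error of order \<open>B\<^sup>2 * y t\<close>; bounding \<open>N\<close> by its square
  makes the remainder a perfect square.\<close>

lemma sqrt_var_emp_le:
  assumes f: "\<And>x. x \<in> X \<Longrightarrow> 0 \<le> f x" "\<And>x. x \<in> X \<Longrightarrow> f x \<le> B"
  shows "sqrt (variance_on X (emp t) f * y t) \<le>
    3 / 2 * sqrt (variance_on X (ker t) f * y t) + 3 * D * N * B * y t"
proof -
  let ?y = "y t"
  define m where "m = mean_on X (ker t) f"
  have y: "0 \<le> ?y" using y_pos[of t] by simp
  have m: "0 \<le> m" "m \<le> B"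
    using mean_on_mono[of X "ker t" f "\<lambda>_. B"] f ker_prob
    by (auto simp: m_def mean_on_const intro!: mean_on_nonneg)
  have v: "variance_on X (ker t) f = (\<Sum>x\<in>X. ker t x * (f x - m)\<^sup>2)"
    unfolding variance_on_eq[OF ker_prob(1)] m_def[symmetric] by (rule mean_on_def)
  have sq: "(f x - m)\<^sup>2 \<le> B\<^sup>2" if "x \<in> X" for x
    using f[OF that] m by (intro abs_le_square_iff[THEN iffD1]) auto
  have "variance_on X (emp t) f \<le> mean_on X (emp t) (\<lambda>x. (f x - m)\<^sup>2)"
    by (rule variance_on_le_mean_square[OF emp_prob(1)])
  also have "\<dots> \<le> (\<Sum>x\<in>X. 2 * (ker t x * (f x - m)\<^sup>2) + 3 * D\<^sup>2 * ?y * B\<^sup>2)"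
    unfolding mean_on_def
  proof (rule sum_mono)
    fix x assume x: "x \<in> X"
    have "emp t x * (f x - m)\<^sup>2 \<le> (2 * ker t x + 3 * D\<^sup>2 * ?y) * (f x - m)\<^sup>2"
      by (rule mult_right_mono[OF emp_le[OF x]]) simp
    moreover have "3 * D\<^sup>2 * ?y * (f x - m)\<^sup>2 \<le> 3 * D\<^sup>2 * ?y * B\<^sup>2"
      using y by (intro mult_left_mono sq x) auto
    ultimately show "emp t x * (f x - m)\<^sup>2 \<le> 2 * (ker t x * (f x - m)\<^sup>2) + 3 * D\<^sup>2 * ?y * B\<^sup>2"
      by (simp add: algebra_simps)
  qed
  also have "\<dots> = 2 * variance_on X (ker t) f + real (card X) * (3 * D\<^sup>2 * ?y * B\<^sup>2)"
    unfolding v by (simp only: sum.distrib sum_constant) (simp only: sum_distrib_left)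
  also have "\<dots> \<le> 2 * variance_on X (ker t) f + (2 * N) * (3 * D\<^sup>2 * ?y * B\<^sup>2)"
    using y by (intro add_left_mono mult_right_mono card_X) auto
  finally have "variance_on X (emp t) f * ?y \<le> (2 * variance_on X (ker t) f + 6 * N * D\<^sup>2 * ?y * B\<^sup>2) * ?y"
    using y by (intro mult_right_mono) (auto simp: algebra_simps)
  also have "\<dots> \<le> (3 / 2)\<^sup>2 * (variance_on X (ker t) f * ?y) + (3 * D * N * B * ?y)\<^sup>2"
  proof -
    have "0 \<le> variance_on X (ker t) f * ?y"
      using y variance_on_nonneg[OF ker_prob] by simp
    moreover have "N * (D\<^sup>2 * ?y\<^sup>2 * B\<^sup>2) \<le> N\<^sup>2 * (D\<^sup>2 * ?y\<^sup>2 * B\<^sup>2)"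
      using N_ge1 by (intro mult_right_mono) (auto simp: self_le_power)
    moreover have "0 \<le> N * (D\<^sup>2 * ?y\<^sup>2 * B\<^sup>2)" using N_ge1 by simp
    ultimately show ?thesis by (simp add: power2_eq_square algebra_simps)
  qed
  finally show ?thesis
    using D N_ge1 B y variance_on_nonneg[OF ker_prob]
    by (intro sqrt_le_of_add_squares) auto
qed

text \<open>\<open>W t\<close> depends on the data, so only the entrywise bounds are available. Both
  kernels have mass 1, so \<open>W t\<close> may be centred at its true mean; Cauchy-Schwarz then
  yields its variance instead of its second moment, times the number of successors.\<close>

lemma mean_W_diff_le:
  "mean_on X (emp t) (W t) - mean_on X (ker t) (W t) \<le> 3 * D * sqrt (N * vW t * y t) + 6 * D\<^sup>2 * N * B * y t"
proof -
  let ?m = "mean_on X (ker t) (W t)" and ?y = "y t"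
  have y: "0 \<le> ?y" using y_pos[of t] by simp
  have m: "0 \<le> ?m" "?m \<le> B"
    using mean_on_mono[of X "ker t" "W t" "\<lambda>_. B"] W_bounds ker_prob
    by (auto simp: mean_on_const intro!: mean_on_nonneg)
  have "mean_on X (emp t) (W t) - ?m = (\<Sum>x\<in>X. (emp t x - ker t x) * (W t x - ?m))"
  proof -
    have "(\<Sum>x\<in>X. (emp t x - ker t x) * (W t x - ?m)) =
        (\<Sum>x\<in>X. emp t x * W t x) - (\<Sum>x\<in>X. ker t x * W t x) - ((\<Sum>x\<in>X. emp t x) * ?m - (\<Sum>x\<in>X. ker t x) * ?m)"
      unfolding sum_distrib_right sum_subtractf[symmetric] by (rule sum.cong) (auto simp: algebra_simps)
    then show ?thesis using emp_prob(1) ker_prob(1) by (simp add: mean_on_def del: sum.insert)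
  qed
  also have "\<dots> \<le> (\<Sum>x\<in>X. 2 * D * sqrt ?y * sqrt (ker t x * (W t x - ?m)\<^sup>2 * 1) + 3 * D\<^sup>2 * ?y * B)"
  proof (rule sum_mono)
    fix x assume x: "x \<in> X"
    have b: "\<bar>W t x - ?m\<bar> \<le> B" using W_bounds[OF x, of t] m by auto
    have "(emp t x - ker t x) * (W t x - ?m) \<le> \<bar>emp t x - ker t x\<bar> * \<bar>W t x - ?m\<bar>"
      by (metis abs_ge_self abs_mult)
    also have "\<dots> \<le> (2 * D * sqrt (ker t x * ?y) + 3 * D\<^sup>2 * ?y) * \<bar>W t x - ?m\<bar>"
      by (intro mult_right_mono abs_emp_diff_le x) simp
    also have "\<dots> = 2 * D * sqrt ?y * sqrt (ker t x * (W t x - ?m)\<^sup>2 * 1) + 3 * D\<^sup>2 * ?y * \<bar>W t x - ?m\<bar>"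
      by (simp add: real_sqrt_mult algebra_simps)
    also have "3 * D\<^sup>2 * ?y * \<bar>W t x - ?m\<bar> \<le> 3 * D\<^sup>2 * ?y * B"
      using y by (intro mult_left_mono b) auto
    finally show "(emp t x - ker t x) * (W t x - ?m) \<le>
        2 * D * sqrt ?y * sqrt (ker t x * (W t x - ?m)\<^sup>2 * 1) + 3 * D\<^sup>2 * ?y * B" by simp
  qed
  also have "\<dots> = 2 * D * sqrt ?y * (\<Sum>x\<in>X. sqrt (ker t x * (W t x - ?m)\<^sup>2 * 1)) + real (card X) * (3 * D\<^sup>2 * ?y * B)"
    by (simp only: sum.distrib sum_constant) (simp only: sum_distrib_left)
  also have "\<dots> \<le> 2 * D * sqrt ?y * (3 / 2 * sqrt (N * vW t)) + (2 * N) * (3 * D\<^sup>2 * ?y * B)"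
  proof (intro add_mono mult_left_mono mult_right_mono card_X)
    have "(\<Sum>x\<in>X. sqrt (ker t x * (W t x - ?m)\<^sup>2 * 1)) \<le> sqrt ((\<Sum>x\<in>X. ker t x * (W t x - ?m)\<^sup>2) * (\<Sum>x\<in>X. 1))"
      by (rule sum_sqrt_le) (auto simp: ker_prob)
    also have "(\<Sum>x\<in>X. ker t x * (W t x - ?m)\<^sup>2) = vW t"
      by (simp add: vW_def variance_on_eq[OF ker_prob(1)] mean_on_def del: sum.insert)
    also have "sqrt (vW t * (\<Sum>x\<in>X. 1)) \<le> 3 / 2 * sqrt (N * vW t) + 0"
    proof (rule sqrt_le_of_add_squares)
      have "vW t * real (card X) \<le> vW t * (2 * N)" using vW_nonneg by (intro mult_left_mono card_X)
      moreover have "0 \<le> N * vW t" using N_ge1 vW_nonneg[of t] by simp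
      ultimately show "vW t * (\<Sum>x\<in>X. 1) \<le> (3 / 2)\<^sup>2 * (N * vW t) + 0\<^sup>2"
        by (simp only: sum_constant mult_1_right power2_eq_square mult.commute[of "vW t" "2 * N"])
    qed (use N_ge1 vW_nonneg[of t] in auto)
    finally show "(\<Sum>x\<in>X. sqrt (ker t x * (W t x - ?m)\<^sup>2 * 1)) \<le> 3 / 2 * sqrt (N * vW t)" by simp
  qed (use D y B in auto)
  also have "2 * D * sqrt ?y * (3 / 2 * sqrt (N * vW t)) = 3 * D * sqrt (N * vW t * ?y)"
    by (simp add: real_sqrt_mult)
  finally show ?thesis by (simp add: algebra_simps)
qed

definition "err t = 5 * D * sqrt (vU t * y t) + 6 * D * sqrt (N * vW t * y t) + 20 * D\<^sup>2 * N * B * y t"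

lemma err_nonneg: "0 \<le> err t"
  using D B N_ge1 vU_nonneg[of t] vW_nonneg[of t] y_pos[of t] by (simp add: err_def)

text \<open>The \<open>U\<close> part is controlled by \<open>good_U\<close>, the \<open>W\<close>
  part by \<open>mean_W_diff_le\<close>, and the bonus by splitting the empirical variance of the
  sum and passing to the true kernel. \<open>D \<ge> 8\<close> lets the terms \<open>D * z\<close>
  disappear in multiples of \<open>D\<^sup>2 * z\<close>.\<close>

lemma step_error: "mean_on X (emp t) (V t) + bonus t - mean_on X (ker t) (V t) \<le> err t"
proof -
  define u where "u = sqrt (vU t * y t)"
  define w where "w = sqrt (vW t * y t)"
  define nw where "nw = sqrt (N * vW t * y t)"
  define z where "z = N * B * y t"
  define By where "By = B * y t"
  define eu where "eu = sqrt (variance_on X (emp t) U * y t)"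
  define ew where "ew = sqrt (variance_on X (emp t) (W t) * y t)"
  define ev where "ev = sqrt (variance_on X (emp t) (V t) * y t)"
  have y: "0 \<le> y t" using y_pos[of t] by simp
  have V: "V t = (\<lambda>x. U x + W t x)" by (simp add: W_def fun_eq_iff)
  have By: "0 \<le> By" "By \<le> z"
    using N_ge1 B y mult_right_mono[of 1 N "B * y t"] by (simp_all add: By_def z_def mult.assoc)
  have z: "0 \<le> z" using By by linarith
  have nw: "w \<le> nw"
    using N_ge1 vW_nonneg[of t] y mult_right_mono[of 1 N "vW t * y t"] by (simp add: w_def nw_def mult.assoc)
  have emp_pos: "0 \<le> variance_on X (emp t) f" for f by (rule variance_on_nonneg[OF emp_prob])
  have pos: "0 \<le> u" "0 \<le> w" "0 \<le> nw" "0 \<le> eu" "0 \<le> ew" "0 \<le> ev"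
    using N_ge1 vU_nonneg[of t] vW_nonneg[of t] y emp_pos
    by (auto simp: u_def w_def nw_def eu_def ew_def ev_def)
  have eu: "eu \<le> 3 / 2 * u + 3 * D * z"
    using sqrt_var_emp_le[of U t] U U_le_B by (simp add: vU_def eu_def u_def z_def mult.assoc)
  have ew: "ew \<le> 3 / 2 * w + 3 * D * z"
    using sqrt_var_emp_le[of "W t" t] W_bounds by (simp add: vW_def ew_def w_def z_def mult.assoc)
  have ev: "ev \<le> 3 / 2 * (eu + ew)"
    unfolding ev_def
  proof (rule real_le_lsqrt)
    have "variance_on X (emp t) (V t) * y t \<le> (2 * variance_on X (emp t) U + 2 * variance_on X (emp t) (W t)) * y t"
      unfolding V by (rule mult_right_mono[OF variance_on_add_le[OF emp_prob] y])
    also have "\<dots> = 2 * (eu\<^sup>2 + ew\<^sup>2)" using emp_pos y by (simp add: eu_def ew_def algebra_simps)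
    also have "\<dots> \<le> (3 / 2 * (eu + ew))\<^sup>2"
    proof -
      have "0 \<le> eu * ew" using pos by simp
      moreover have "0 \<le> eu\<^sup>2" "0 \<le> ew\<^sup>2" by auto
      ultimately show ?thesis unfolding power2_sum power_mult_distrib by (simp add: power2_eq_square)
    qed
    finally show "variance_on X (emp t) (V t) * y t \<le> (3 / 2 * (eu + ew))\<^sup>2" .
    show "0 \<le> 3 / 2 * (eu + ew)" using pos by simp
  qed
  have DDz: "D * z \<le> D\<^sup>2 * z / 8" "0 \<le> D\<^sup>2 * z"
    using D z mult_right_mono[of 8 D "D * z"] by (simp_all add: power2_eq_square mult.assoc)
  have DBy: "D * By \<le> D * z" using D By by (intro mult_left_mono) auto
  have 1: "mean_on X (emp t) U - mean_on X (ker t) U \<le> D * eu + D * By"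
  proof -
    have "K * (eu + By) \<le> D * (eu + By)"
      using D pos By by (intro mult_right_mono) auto
    then show ?thesis using good_U[of t] unfolding eu_def[symmetric] By_def[symmetric] distrib_left by linarith
  qed
  have 2: "bonus t \<le> D * ev + D * By"
  proof -
    have "c1 * ev \<le> D * ev" using D pos by (intro mult_right_mono) auto
    moreover have "c2 * By \<le> D * By" using D By by (intro mult_right_mono) auto
    moreover have "0 \<le> D * ev" "0 \<le> D * By" using D By pos by auto
    moreover have "bonus t = max (c1 * ev) (c2 * By)" by (simp add: bonus_def ev_def By_def mult.assoc)
    ultimately show ?thesis by linarith
  qed
  have Deu: "D * eu \<le> 3 / 2 * (D * u) + 3 * (D\<^sup>2 * z)"
    using mult_left_mono[OF eu, of D] D by (simp add: power2_eq_square algebra_simps)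
  have Dew: "D * ew \<le> 3 / 2 * (D * w) + 3 * (D\<^sup>2 * z)"
    using mult_left_mono[OF ew, of D] D by (simp add: power2_eq_square algebra_simps)
  have Dev: "D * ev \<le> 3 / 2 * (D * eu) + 3 / 2 * (D * ew)"
    using mult_left_mono[OF ev, of D] D by (simp add: algebra_simps)
  have Dw: "D * w \<le> D * nw" "0 \<le> D * nw" "0 \<le> D * u"
    using D nw pos by (auto intro!: mult_left_mono)
  have 3: "mean_on X (emp t) (W t) - mean_on X (ker t) (W t) \<le> 3 * (D * nw) + 6 * (D\<^sup>2 * z)"
    using mean_W_diff_le[of t] by (simp add: nw_def z_def mult.assoc)
  have "mean_on X (emp t) (V t) + bonus t - mean_on X (ker t) (V t) =
      (mean_on X (emp t) U - mean_on X (ker t) U) + (mean_on X (emp t) (W t) - mean_on X (ker t) (W t)) + bonus t"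
    unfolding V by (simp add: mean_on_add)
  \<comment> \<open>The coefficients add up to 15/4, 21/4 and 73/4, rounded up to 5, 6 and
    20.\<close>
  also have "\<dots> \<le> 5 * (D * u) + 6 * (D * nw) + 20 * (D\<^sup>2 * z)"
    using 1 2 3 Deu Dew Dev Dw DBy DDz by linarith
  also have "\<dots> = err t" by (simp add: err_def u_def nw_def z_def mult.assoc)
  finally show ?thesis .
qed

lemma sum_sqrt_mult_y_le:
  assumes "\<And>t. 0 \<le> v t"
  shows "(\<Sum>t<n. sqrt (v t * y t)) \<le> sqrt ((\<Sum>t<n. v t) * (\<Sum>t<n. y t))"
  by (rule sum_sqrt_le) (use assms y_pos in \<open>auto intro: less_imp_le\<close>)

section \<open>Sums over the first \<open>n\<close> steps\<close>

context
  fixes n :: nat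
  assumes n: "0 < n"
begin

text \<open>The regret will be of order \<open>F + B * G\<close>; \<open>H\<close> is the contribution of \<open>W\<close>, absorbed in \<open>H_le\<close>.\<close>

definition "lt = log_term M \<delta> (B * real n)"
definition "Lam = log_factor M B \<delta> n"
definition "XU = (\<Sum>t<n. vU t)"
definition "XW = (\<Sum>t<n. vW t)"
definition "G = N\<^sup>2 * NA * Lam"
definition "F = sqrt (XU * (N * NA * Lam))"
definition "H = sqrt (G * XW)"

lemma lt_le: "0 < lt" "lt \<le> Lam" "1 \<le> 8 * Lam" "1 \<le> D * Lam"
proof -
  show lt: "0 < lt" unfolding lt_def by (rule log_term_pos)
  have "lt * 1 \<le> lt * max 1 (ln (real n))" using lt by (intro mult_left_mono) auto
  then show le: "lt \<le> Lam" by (simp add: Lam_def log_factor_def lt_def)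
  have "1 / 8 \<le> lt" unfolding lt_def by (rule log_lb)
  then show "1 \<le> 8 * Lam" using le by simp
  also have "8 * Lam \<le> D * Lam" using D lt le by (intro mult_right_mono) auto
  finally show "1 \<le> D * Lam" .
qed

lemma Lam_pos: "0 < Lam"
  using lt_le by linarith

lemma sizes: "1 \<le> N * NA" "N * NA \<le> N\<^sup>2 * NA" "N * NA * Lam \<le> G" "Lam \<le> N * NA * Lam" "Lam \<le> G" "0 < G"
proof -
  show 1: "1 \<le> N * NA" using mult_mono[of 1 N 1 NA] N_ge1 by simp
  show 2: "N * NA \<le> N\<^sup>2 * NA" using N_ge1 by (intro mult_right_mono) (auto simp: self_le_power)
  show 3: "N * NA * Lam \<le> G" unfolding G_def by (rule mult_right_mono[OF 2]) (use Lam_pos in simp)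
  show 4: "Lam \<le> N * NA * Lam" using mult_right_mono[OF 1, of Lam] Lam_pos by simp
  show "Lam \<le> G" "0 < G" using 3 4 Lam_pos by linarith+
qed

lemma X_nonneg: "0 \<le> XU" "0 \<le> XW"
  by (auto simp: XU_def XW_def intro!: sum_nonneg vU_nonneg vW_nonneg)

lemma FH_nonneg: "0 \<le> F" "0 \<le> H"
  using X_nonneg sizes Lam_pos N_ge1 by (auto simp: F_def H_def)

text \<open>The factor \<open>max 1 (ln n)\<close> of \<open>log_factor\<close> enters here, through
  the harmonic sums over visits.\<close>

lemma sum_y_le: "(\<Sum>t<n. y t) \<le> 2 * (N * NA * Lam)"
proof -
  have "(\<Sum>t<n. y t) \<le> (\<Sum>t<n. lt * (1 / vis t))"
  proof (rule sum_mono)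
    fix t assume "t \<in> {..<n}"
    then have "io t \<le> lt" unfolding lt_def by (intro io_le) simp
    then show "y t \<le> lt * (1 / vis t)"
      using vis_ge1[of t] by (simp add: y_def divide_right_mono)
  qed
  also have "\<dots> = lt * (\<Sum>t<n. 1 / vis t)" by (rule sum_distrib_left[symmetric])
  also have "\<dots> \<le> lt * (N * NA * (1 + ln (real n)))"
    using sum_inverse_vis[OF n] lt_le(1) by (intro mult_left_mono) (auto simp: N_def NA_def)
  also have "\<dots> \<le> lt * (N * NA * (2 * max 1 (ln (real n))))"
    using lt_le(1) N_ge1 by (intro mult_left_mono) auto
  finally show ?thesis by (simp add: Lam_def log_factor_def lt_def mult_ac)
qed

lemma sum_err_le: "(\<Sum>t<n. err t) \<le> 8 * D * F + 9 * D * H + 40 * D\<^sup>2 * B * G"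
proof -
  have aux: "sqrt (x * (\<Sum>t<n. y t)) \<le> 3 / 2 * sqrt (x * (N * NA * Lam))" if "0 \<le> x" for x
  proof -
    have p: "0 \<le> x * (N * NA * Lam)" using that N_ge1 Lam_pos by simp
    have "x * (\<Sum>t<n. y t) \<le> x * (2 * (N * NA * Lam))" by (rule mult_left_mono[OF sum_y_le that])
    also have "\<dots> \<le> (3 / 2)\<^sup>2 * (x * (N * NA * Lam)) + 0\<^sup>2" using p by (simp add: power2_eq_square)
    finally have "sqrt (x * (\<Sum>t<n. y t)) \<le> 3 / 2 * sqrt (x * (N * NA * Lam)) + 0"
      using p by (intro sqrt_le_of_add_squares) auto
    then show ?thesis by simp
  qed
  have 1: "(\<Sum>t<n. sqrt (vU t * y t)) \<le> 3 / 2 * F"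
    using order_trans[OF sum_sqrt_mult_y_le[OF vU_nonneg] aux[OF X_nonneg(1), unfolded XU_def]]
    by (simp add: F_def XU_def)
  have 2: "(\<Sum>t<n. sqrt (N * vW t * y t)) \<le> 3 / 2 * H"
  proof -
    have "(\<Sum>t<n. sqrt (N * vW t * y t)) \<le> sqrt ((\<Sum>t<n. N * vW t) * (\<Sum>t<n. y t))"
      using N_ge1 vW_nonneg by (intro sum_sqrt_mult_y_le) auto
    also have "(\<Sum>t<n. N * vW t) = N * XW" by (simp add: XW_def sum_distrib_left)
    also have "sqrt (N * XW * (\<Sum>t<n. y t)) \<le> 3 / 2 * sqrt (N * XW * (N * NA * Lam))"
      using N_ge1 X_nonneg by (intro aux) auto
    also have "N * XW * (N * NA * Lam) = G * XW" by (simp add: G_def power2_eq_square mult_ac)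
    finally show ?thesis by (simp add: H_def)
  qed
  have 3: "N * B * (\<Sum>t<n. y t) \<le> 2 * (B * G)"
  proof -
    have "N * B * (\<Sum>t<n. y t) \<le> N * B * (2 * (N * NA * Lam))"
      using N_ge1 B by (intro mult_left_mono[OF sum_y_le]) auto
    then show ?thesis by (simp add: G_def power2_eq_square mult_ac)
  qed
  have "(\<Sum>t<n. err t) = 5 * D * (\<Sum>t<n. sqrt (vU t * y t)) + 6 * D * (\<Sum>t<n. sqrt (N * vW t * y t)) +
      20 * D\<^sup>2 * (N * B * (\<Sum>t<n. y t))"
    by (simp add: err_def sum.distrib sum_distrib_left mult.assoc)
  also have "\<dots> \<le> 5 * D * (3 / 2 * F) + 6 * D * (3 / 2 * H) + 20 * D\<^sup>2 * (2 * (B * G))"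
    using D 1 2 3 by (intro add_mono mult_left_mono) auto
  also have "\<dots> \<le> 8 * D * F + 9 * D * H + 40 * D\<^sup>2 * B * G"
  proof -
    have "0 \<le> D * F" using D FH_nonneg by simp
    then show ?thesis by (simp add: mult.assoc)
  qed
  finally show ?thesis .
qed

lemma sum_Q_drop': "(\<Sum>t<n. Q t (st t) (ac t) - Q (Suc t) (st t) (ac t)) \<le> N * NA * B"
  using sum_Q_drop by (simp add: N_def NA_def)

lemma ker_mean_bellman: "rew t + mean_on X (ker t) U \<le> U (Some (st t))"
  using bellman_le path by (simp add: rew_def ker_def)

text \<open>By greediness the value of the current state is the entry about to be updated. After the
  update this entry is at most the empirical target, which exceeds the target under the true kernel
  by at most \<open>err t\<close>.\<close>

lemma V_step: "V t (Some (st t)) \<le> (Q t (st t) (ac t) - Q (Suc t) (st t) (ac t)) + rew t + mean_on X (ker t) (V t) + err t"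
  using step_error[of t] by (simp add: V_st Q_Suc)

lemma mean_ker_W: "mean_on X (ker t) (W t) = mean_on X (ker t) (V t) - mean_on X (ker t) U"
  by (simp add: W_def[abs_def] mean_on_diff)

text \<open>The variance of \<open>W t\<close> is the mean of its square minus the square of its
  mean. Since \<open>W t\<close> at the current state exceeds that mean by at most drop plus error,
  replacing the mean by it costs \<open>2 * B\<close> times as much, and the squares telescope along
  the run up to a martingale.\<close>

lemma XW_le: "XW \<le> 11 * D * B\<^sup>2 * G + 8 / 3 * B * (\<Sum>t<n. err t)"
proof -
  let ?drop = "\<lambda>t. Q t (st t) (ac t) - Q (Suc t) (st t) (ac t)"
  let ?m = "\<lambda>t. mean_on X (ker t) (W t)"
  have m: "0 \<le> ?m t" "?m t \<le> B" for t
    using mean_on_mono[of X "ker t" "W t" "\<lambda>_. B"] W_bounds ker_prob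
    by (auto simp: mean_on_const intro!: mean_on_nonneg)
  have bnd: "vW t \<le> (mean_on X (ker t) (\<lambda>x. (W t x)\<^sup>2) - (W t (nx t))\<^sup>2)
      + 2 * B * (V t (nx t) - V (Suc t) (nx t))
      - ((W t (Some (st t)))\<^sup>2 - (W (Suc t) (nx t))\<^sup>2) + 2 * B * (?drop t + err t)" for t
  proof -
    let ?a = "W t (nx t)" and ?b = "W (Suc t) (nx t)" and ?w = "W t (Some (st t))"
    have nx: "nx t \<in> X" and s: "Some (st t) \<in> X" using path by auto
    have "?a\<^sup>2 - ?b\<^sup>2 = (?a - ?b) * (?a + ?b)" by (simp add: power2_eq_square algebra_simps)
    also have "\<dots> \<le> (?a - ?b) * (2 * B)"
      using W_bounds[OF nx, of t] W_bounds[OF nx, of "Suc t"] V_decreasing[OF nx, of t]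
      by (intro mult_left_mono) (auto simp: W_def)
    finally have 1: "?a\<^sup>2 - ?b\<^sup>2 \<le> 2 * B * (V t (nx t) - V (Suc t) (nx t))"
      by (simp add: W_def mult.commute)
    have drop: "0 \<le> ?drop t" using Q_decreasing by simp
    \<comment> \<open>The Bellman inequality for \<open>U\<close> is subtracted from
      \<open>V_step\<close>; the rewards cancel.\<close>
    have "?w - ?m t \<le> ?drop t + err t"
      using V_step[of t] ker_mean_bellman[of t] unfolding mean_ker_W by (simp add: W_def)
    then have "(?w - ?m t) * (?w + ?m t) \<le> (?drop t + err t) * (?w + ?m t)"
      using W_bounds[OF s, of t] m[of t] by (intro mult_right_mono) auto
    also have "\<dots> \<le> (?drop t + err t) * (2 * B)"
      using W_bounds[OF s, of t] m[of t] drop err_nonneg[of t] by (intro mult_left_mono) auto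
    finally have 2: "?w\<^sup>2 - (?m t)\<^sup>2 \<le> 2 * B * (?drop t + err t)"
      by (simp add: power2_eq_square algebra_simps)
    have "vW t = mean_on X (ker t) (\<lambda>x. (W t x)\<^sup>2) - (?m t)\<^sup>2" by (simp add: vW_def variance_on_def)
    then show ?thesis using 1 2 by linarith
  qed
  have "XW \<le> (\<Sum>t<n. (mean_on X (ker t) (\<lambda>x. (W t x)\<^sup>2) - (W t (nx t))\<^sup>2)
      + 2 * B * (V t (nx t) - V (Suc t) (nx t))
      - ((W t (Some (st t)))\<^sup>2 - (W (Suc t) (nx t))\<^sup>2) + 2 * B * (?drop t + err t))"
    unfolding XW_def by (rule sum_mono) (rule bnd)
  also have "\<dots> = (\<Sum>t<n. mean_on X (ker t) (\<lambda>x. (W t x)\<^sup>2) - (W t (nx t))\<^sup>2)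
      + 2 * B * (\<Sum>t<n. V t (nx t) - V (Suc t) (nx t))
      - (\<Sum>t<n. (W t (Some (st t)))\<^sup>2 - (W (Suc t) (nx t))\<^sup>2)
      + 2 * B * ((\<Sum>t<n. ?drop t) + (\<Sum>t<n. err t))"
    by (simp only: sum.distrib sum_subtractf sum_distrib_left distrib_left right_diff_distrib)
  also have "\<dots> \<le> (XW / 4 + D * B\<^sup>2 * Lam) + 2 * B * (N * B) + B\<^sup>2
      + 2 * B * (N * NA * B + (\<Sum>t<n. err t))"
  proof -
    have "K * B\<^sup>2 * lt \<le> D * B\<^sup>2 * Lam"
      using K D lt_le by (intro mult_mono) auto
    then have "(\<Sum>t<n. mean_on X (ker t) (\<lambda>x. (W t x)\<^sup>2) - (W t (nx t))\<^sup>2) \<le> XW / 4 + D * B\<^sup>2 * Lam"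
      using good_W2[of n] by (simp add: W_def[abs_def] XW_def vW_def lt_def)
    moreover have "2 * B * (\<Sum>t<n. V t (nx t) - V (Suc t) (nx t)) \<le> 2 * B * (N * B)"
      using sum_V_drop B by (intro mult_left_mono) (auto simp: N_def)
    moreover have "- B\<^sup>2 \<le> (\<Sum>t<n. (W t (Some (st t)))\<^sup>2 - (W (Suc t) (nx t))\<^sup>2)"
    proof -
      have s: "Some (st n) \<in> X" using path by auto
      have "(W n (Some (st n)))\<^sup>2 \<le> B\<^sup>2" using W_bounds[OF s, of n] by (intro power_mono) auto
      then show ?thesis
        using potential_sum_ge[of "\<lambda>t x. (W t x)\<^sup>2" 0 n] U(1) by (simp add: W_def) (smt (verit) zero_le_power2)
    qed
    moreover have "2 * B * ((\<Sum>t<n. ?drop t) + (\<Sum>t<n. err t)) \<le> 2 * B * (N * NA * B + (\<Sum>t<n. err t))"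
      using sum_Q_drop' B by (intro mult_left_mono add_right_mono) auto
    ultimately show ?thesis by linarith
  qed
  \<comment> \<open>A quarter of \<open>XW\<close> from \<open>good_W2\<close> has moved to the
    left; dividing by 3/4 turns the coefficient 2 of the error sum into 8/3.\<close>
  finally have main: "3 / 4 * XW \<le> D * B\<^sup>2 * Lam + 2 * B * (N * B) + B\<^sup>2 + 2 * B * (N * NA * B + (\<Sum>t<n. err t))"
    by simp
  have NG: "N * NA \<le> 8 * G"
  proof -
    have "N * NA * 1 \<le> N * NA * (8 * Lam)" using lt_le sizes by (intro mult_left_mono) auto
    then show ?thesis using sizes by linarith
  qed
  have N1: "N \<le> N * NA" using N_ge1 by simp
  have "2 * B * (N * B) + B\<^sup>2 + 2 * B * (N * NA * B) = B\<^sup>2 * (2 * N + 1 + 2 * (N * NA))"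
    by (simp add: power2_eq_square algebra_simps)
  also have "\<dots> \<le> B\<^sup>2 * (40 * G)"
    using NG N1 sizes by (intro mult_left_mono) auto
  also have "\<dots> \<le> B\<^sup>2 * (5 * D * G)"
    using D sizes by (intro mult_left_mono mult_right_mono) auto
  finally have 1: "2 * B * (N * B) + B\<^sup>2 + 2 * B * (N * NA * B) \<le> 5 * (D * B\<^sup>2 * G)" by (simp add: mult_ac)
  have 2: "D * B\<^sup>2 * Lam \<le> D * B\<^sup>2 * G" using sizes D by (intro mult_left_mono) auto
  have 3: "0 \<le> D * B\<^sup>2 * G" using sizes D by simp
  have "3 / 4 * XW \<le> 6 * (D * B\<^sup>2 * G) + 2 * B * (\<Sum>t<n. err t)"
    using main 1 2 by (simp add: distrib_left)
  then show ?thesis using 3 by (simp add: mult.assoc)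
qed

text \<open>Inserting \<open>sum_err_le\<close> into \<open>XW_le\<close> gives a quadratic
  inequality in \<open>H\<close>. The linear term is split as \<open>24 * (D * b) * H \<le>
  H\<^sup>2 / 2 + 288 * (D\<^sup>2 * b\<^sup>2)\<close>, and what remains is dominated by the square
  of the claimed bound.\<close>

lemma H_le: "H \<le> F + 40 * D * B * G"
proof -
  define b where "b = B * G"
  have b: "0 < b" using B sizes by (simp add: b_def)
  have pos: "0 \<le> XW" "0 < G" using X_nonneg sizes by auto
  have H2: "H\<^sup>2 = G * XW" using pos by (simp add: H_def)
  have "B * (\<Sum>t<n. err t) \<le> B * (8 * D * F + 9 * D * H + 40 * D\<^sup>2 * B * G)"
    using sum_err_le B by (intro mult_left_mono) auto
  then have "XW \<le> 11 * D * B\<^sup>2 * G + 8 / 3 * (B * (8 * D * F + 9 * D * H + 40 * D\<^sup>2 * B * G))"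
    using XW_le by simp
  then have "G * XW \<le> G * (11 * D * B\<^sup>2 * G + 8 / 3 * (B * (8 * D * F + 9 * D * H + 40 * D\<^sup>2 * B * G)))"
    using pos by (intro mult_left_mono) auto
  also have "\<dots> = 11 * (D * b\<^sup>2) + 64 / 3 * (D * b * F) + 24 * (D * b) * H + 320 / 3 * (D\<^sup>2 * b\<^sup>2)"
    by (simp add: b_def power2_eq_square algebra_simps)
  also have "24 * (D * b) * H \<le> H\<^sup>2 / 2 + 288 * (D\<^sup>2 * b\<^sup>2)"
  proof -
    have "0 \<le> (H - 24 * (D * b))\<^sup>2" by simp
    then show ?thesis by (simp add: power2_diff power_mult_distrib algebra_simps)
  qed
  finally have "H\<^sup>2 \<le> 22 * (D * b\<^sup>2) + 128 / 3 * (D * b * F) + 2368 / 3 * (D\<^sup>2 * b\<^sup>2)"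
    unfolding H2[symmetric] by simp
  moreover have "8 * (D * b\<^sup>2) \<le> D\<^sup>2 * b\<^sup>2"
    using D mult_right_mono[of 8 D "D * b\<^sup>2"] by (simp add: power2_eq_square mult.assoc)
  moreover have "0 \<le> D * b * F" "0 \<le> D\<^sup>2 * b\<^sup>2" using D b FH_nonneg by auto
  moreover have "0 \<le> F\<^sup>2" by simp
  ultimately have "H\<^sup>2 \<le> F\<^sup>2 + 80 * (D * b * F) + 1600 * (D\<^sup>2 * b\<^sup>2)" by linarith
  also have "\<dots> = (F + 40 * D * b)\<^sup>2" by (simp add: power2_sum power_mult_distrib)
  finally have "H\<^sup>2 \<le> (F + 40 * D * b)\<^sup>2" .
  then have "H \<le> F + 40 * D * b"
    by (rule power2_le_imp_le) (use D b FH_nonneg in simp)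
  then show ?thesis by (simp add: b_def mult.assoc)
qed

lemma martingale_V_le: "(\<Sum>t<n. mean_on X (ker t) (V t) - V t (nx t)) \<le> 2 * D * F + 2 * D * H + D * B * G"
proof -
  have V: "V t = (\<lambda>x. U x + W t x)" for t by (simp add: W_def fun_eq_iff)
  have "(\<Sum>t<n. variance_on X (ker t) (V t)) \<le> (\<Sum>t<n. 2 * vU t + 2 * vW t)"
    unfolding V vU_def vW_def by (intro sum_mono variance_on_add_le ker_prob)
  also have "\<dots> = 2 * XU + 2 * XW" by (simp add: XU_def XW_def sum.distrib sum_distrib_left)
  finally have "(\<Sum>t<n. variance_on X (ker t) (V t)) * lt \<le> (2 * XU + 2 * XW) * lt"
    using lt_le by (intro mult_right_mono) auto
  also have "\<dots> = 2 * (XU * lt) + 2 * (XW * lt)" by (simp add: algebra_simps)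
  also have "XU * lt \<le> F\<^sup>2"
  proof -
    have "XU * lt \<le> XU * (N * NA * Lam)" by (rule mult_left_mono[OF order_trans[OF lt_le(2) sizes(4)] X_nonneg(1)])
    then show ?thesis using X_nonneg N_ge1 Lam_pos by (simp add: F_def)
  qed
  also have "XW * lt \<le> H\<^sup>2"
  proof -
    have "XW * lt \<le> XW * G" using X_nonneg lt_le sizes by (intro mult_left_mono) auto
    then show ?thesis using X_nonneg sizes by (simp add: H_def mult.commute)
  qed
  finally have v: "(\<Sum>t<n. variance_on X (ker t) (V t)) * lt \<le> 2 * F\<^sup>2 + 2 * H\<^sup>2" by simp
  have "sqrt ((\<Sum>t<n. variance_on X (ker t) (V t)) * lt) \<le> 2 * F + 2 * H"
  proof (rule real_le_lsqrt)
    have "0 \<le> F * H" "0 \<le> F\<^sup>2" "0 \<le> H\<^sup>2" using FH_nonneg by auto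
    then have "2 * F\<^sup>2 + 2 * H\<^sup>2 \<le> (2 * F + 2 * H)\<^sup>2"
      unfolding power2_sum power_mult_distrib by (simp add: mult.assoc)
    with v show "(\<Sum>t<n. variance_on X (ker t) (V t)) * lt \<le> (2 * F + 2 * H)\<^sup>2" by linarith
  qed (use FH_nonneg in simp)
  moreover have "B * lt \<le> B * G" using B lt_le sizes by (intro mult_left_mono) auto
  ultimately have "K * (sqrt ((\<Sum>t<n. variance_on X (ker t) (V t)) * lt) + B * lt) \<le> D * (2 * F + 2 * H + B * G)"
    using K D B lt_le FH_nonneg sizes v
    by (intro mult_mono add_mono) (auto intro!: add_nonneg_nonneg mult_nonneg_nonneg sum_nonneg variance_on_nonneg ker_prob)
  then show ?thesis using good_V[of n] by (simp add: lt_def algebra_simps)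
qed

text \<open>Nonnegative rewards give \<open>?m t \<le> U (Some (st t))\<close>, so the difference of
  their squares is at most \<open>2 * Bs\<close> times a first-order difference. The sum of
  \<open>U (Some (st t)) - U (nx t)\<close> telescopes to at most one initial value per completed
  episode plus \<open>Bs\<close>: this produces the optimal initial value times \<open>Bs\<close>,
  instead of \<open>Bs\<^sup>2\<close>, per episode. The fluctuations of \<open>U\<^sup>2\<close>
  and of \<open>- 2 * Bs * U\<close> are treated as one martingale.\<close>

lemma XU_le: "XU \<le> 4 * Bs * real (goals n) * U (Some (init M)) + 8 * D * Bs\<^sup>2 * Lam"
proof -
  let ?f = "\<lambda>x. (U x)\<^sup>2 - 2 * Bs * U x"
  let ?m = "\<lambda>t. mean_on X (ker t) U"
  have bnd: "vU t \<le> (mean_on X (ker t) ?f - ?f (nx t)) - ((U (Some (st t)))\<^sup>2 - (U (nx t))\<^sup>2)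
      + 2 * Bs * (U (Some (st t)) - U (nx t))" for t
  proof -
    have s: "Some (st t) \<in> X" using path by auto
    have m: "0 \<le> ?m t" "?m t \<le> Bs"
      using mean_on_mono[of X "ker t" U "\<lambda>_. Bs"] U ker_prob by (auto simp: mean_on_const intro!: mean_on_nonneg)
    have "?m t \<le> U (Some (st t))"
      using ker_mean_bellman[of t] reward_nonneg path by (simp add: rew_def) (smt (verit) path)
    then have "(U (Some (st t)) - ?m t) * (U (Some (st t)) + ?m t) \<le> (U (Some (st t)) - ?m t) * (2 * Bs)"
      using U(3)[OF s] m by (intro mult_left_mono) auto
    then have "(U (Some (st t)))\<^sup>2 - (?m t)\<^sup>2 \<le> 2 * Bs * (U (Some (st t)) - ?m t)"
      by (simp add: power2_eq_square algebra_simps)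
    moreover have "vU t = mean_on X (ker t) (\<lambda>x. (U x)\<^sup>2) - (?m t)\<^sup>2" by (simp add: vU_def variance_on_def)
    moreover have "mean_on X (ker t) ?f = mean_on X (ker t) (\<lambda>x. (U x)\<^sup>2) - 2 * Bs * ?m t"
      by (simp add: mean_on_diff mean_on_cmult)
    ultimately show ?thesis by (simp add: algebra_simps)
  qed
  have "XU \<le> (\<Sum>t<n. (mean_on X (ker t) ?f - ?f (nx t)) - ((U (Some (st t)))\<^sup>2 - (U (nx t))\<^sup>2)
      + 2 * Bs * (U (Some (st t)) - U (nx t)))"
    unfolding XU_def by (rule sum_mono) (rule bnd)
  also have "\<dots> = (\<Sum>t<n. mean_on X (ker t) ?f - ?f (nx t)) - (\<Sum>t<n. (U (Some (st t)))\<^sup>2 - (U (nx t))\<^sup>2)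
      + 2 * Bs * (\<Sum>t<n. U (Some (st t)) - U (nx t))"
    by (simp only: sum.distrib sum_subtractf sum_distrib_left right_diff_distrib)
  also have "\<dots> \<le> (XU / 2 + D * Bs\<^sup>2 * Lam) + Bs\<^sup>2 + 2 * Bs * (Bs + real (goals n) * U (Some (init M)))"
  proof -
    have s: "Some (st n) \<in> X" "Some (init M) \<in> X" using path by auto
    have "K * Bs\<^sup>2 * lt \<le> D * Bs\<^sup>2 * Lam" using K D lt_le by (intro mult_mono) auto
    then have "(\<Sum>t<n. mean_on X (ker t) ?f - ?f (nx t)) \<le> XU / 2 + D * Bs\<^sup>2 * Lam"
      using good_U2[of n] by (simp add: XU_def vU_def lt_def)
    moreover have "- Bs\<^sup>2 \<le> (\<Sum>t<n. (U (Some (st t)))\<^sup>2 - (U (nx t))\<^sup>2)"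
    proof -
      have "(U (Some (st n)))\<^sup>2 \<le> Bs\<^sup>2" using U s by (intro power_mono) auto
      moreover have "0 \<le> (U (Some (init M)))\<^sup>2" by simp
      moreover have "(U (Some (init M)))\<^sup>2 - (U (Some (st n)))\<^sup>2 \<le> (\<Sum>t<n. (U (Some (st t)))\<^sup>2 - (U (nx t))\<^sup>2)"
        using potential_sum_ge[of "\<lambda>t x. (U x)\<^sup>2" 0 n] U(1) by simp
      ultimately show ?thesis by linarith
    qed
    moreover have "(\<Sum>t<n. U (Some (st t)) - U (nx t)) \<le> Bs + real (goals n) * U (Some (init M))"
    proof -
      have "- U (Some (init M)) + U (Some (st n)) + real (goals n) * (- U (Some (init M))) \<le>
          (\<Sum>t<n. - U (Some (st t)) + U (nx t))"
        using potential_sum_ge[of "\<lambda>t x. - U x" "- U (Some (init M))" n] U(1) by simp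
      also have "\<dots> = - (\<Sum>t<n. U (Some (st t)) - U (nx t))" by (simp add: sum_negf[symmetric])
      finally show ?thesis using U(2)[of "Some (st n)"] U(3)[OF s(2)] by simp
    qed
    then have "2 * Bs * (\<Sum>t<n. U (Some (st t)) - U (nx t)) \<le> 2 * Bs * (Bs + real (goals n) * U (Some (init M)))"
      using Bs by (intro mult_left_mono) auto
    ultimately show ?thesis by linarith
  qed
  finally have "XU / 2 \<le> D * Bs\<^sup>2 * Lam + 3 * Bs\<^sup>2 + 2 * Bs * real (goals n) * U (Some (init M))"
    by (simp add: power2_eq_square algebra_simps)
  moreover have "Bs\<^sup>2 * 1 \<le> Bs\<^sup>2 * (D * Lam)" using lt_le by (intro mult_left_mono) auto
  ultimately show ?thesis by (simp add: algebra_simps)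
qed

lemma F_le: "F \<le> 2 * sqrt (U (Some (init M)) * Bs * N * NA * real (goals n) * Lam) + D * B * G"
  unfolding F_def
proof (rule sqrt_le_of_add_squares)
  have NL: "0 \<le> N * NA * Lam" using N_ge1 Lam_pos by simp
  show "0 \<le> U (Some (init M)) * Bs * N * NA * real (goals n) * Lam"
    using U(2) Bs N_ge1 Lam_pos by simp
  show "0 \<le> D * B * G" using D B sizes by simp
  have "XU * (N * NA * Lam) \<le> (4 * Bs * real (goals n) * U (Some (init M)) + 8 * D * Bs\<^sup>2 * Lam) * (N * NA * Lam)"
    by (rule mult_right_mono[OF XU_le NL])
  also have "8 * D * Bs\<^sup>2 * Lam * (N * NA * Lam) \<le> (D * B * G)\<^sup>2"
  proof -
    have "Bs\<^sup>2 \<le> B\<^sup>2" using Bs by (intro power_mono) auto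
    then have "(8 * D) * Bs\<^sup>2 * (Lam * (N * NA * Lam)) \<le> D\<^sup>2 * B\<^sup>2 * (G * G)"
      using D sizes Lam_pos NL by (intro mult_mono) (auto simp: power2_eq_square)
    then show ?thesis by (simp add: power2_eq_square mult_ac)
  qed
  then have "(4 * Bs * real (goals n) * U (Some (init M)) + 8 * D * Bs\<^sup>2 * Lam) * (N * NA * Lam) \<le>
      2\<^sup>2 * (U (Some (init M)) * Bs * N * NA * real (goals n) * Lam) + (D * B * G)\<^sup>2"
    by (simp add: algebra_simps)
  finally show "XU * (N * NA * Lam) \<le>
      2\<^sup>2 * (U (Some (init M)) * Bs * N * NA * real (goals n) * Lam) + (D * B * G)\<^sup>2" .
qed simp

lemma regret_bound:
  "real (goals n) * U (Some (init M)) - (\<Sum>t<n. rew t) \<le>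
     1000 * D\<^sup>2 * (sqrt (U (Some (init M)) * Bs * N * NA * real (goals n) * Lam) + B * N\<^sup>2 * NA * Lam)"
proof -
  let ?drop = "\<lambda>t. Q t (st t) (ac t) - Q (Suc t) (st t) (ac t)"
  let ?mart = "\<Sum>t<n. mean_on X (ker t) (V t) - V t (nx t)"
  let ?R = "sqrt (U (Some (init M)) * Bs * N * NA * real (goals n) * Lam)"
  have s: "Some (st n) \<in> X" "Some (init M) \<in> X" using path by auto
  \<comment> \<open>By optimism each completed episode counts with at least the optimal initial
    value, whatever the estimate is at that time.\<close>
  have "V 0 (Some (init M)) - V n (Some (st n)) + real (goals n) * U (Some (init M)) \<le>
      (\<Sum>t<n. V t (Some (st t)) - V (Suc t) (nx t))"
    using U_le_V by (intro potential_sum_ge) auto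
  then have "real (goals n) * U (Some (init M)) - B \<le> (\<Sum>t<n. V t (Some (st t)) - V (Suc t) (nx t))"
    using V_nonneg[OF s(2), of 0] V_le_B[OF s(1), of n] by linarith
  also have "\<dots> \<le> (\<Sum>t<n. (?drop t + rew t + mean_on X (ker t) (V t) + err t) - V (Suc t) (nx t))"
    by (intro sum_mono diff_right_mono V_step)
  also have "\<dots> = (\<Sum>t<n. ?drop t) + (\<Sum>t<n. rew t) + ?mart + (\<Sum>t<n. err t) + (\<Sum>t<n. V t (nx t) - V (Suc t) (nx t))"
    by (simp add: sum.distrib sum_subtractf)
  finally have "real (goals n) * U (Some (init M)) - (\<Sum>t<n. rew t) \<le>
      B + N * NA * B + N * B + ?mart + (\<Sum>t<n. err t)"
    using sum_Q_drop' sum_V_drop[of n] by (simp add: N_def[symmetric])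
  also have "B + N * NA * B + N * B \<le> 3 * (D * B * G)"
  proof -
    have "N * NA * 1 \<le> N * NA * (D * Lam)" using lt_le sizes by (intro mult_left_mono) auto
    also have "\<dots> = D * (N * NA * Lam)" by (simp add: mult_ac)
    also have "\<dots> \<le> D * G" using sizes D by (intro mult_left_mono) auto
    finally have "N * NA \<le> D * G" by simp
    moreover have "N \<le> N * NA" using N_ge1 by simp
    ultimately have "1 + N * NA + N \<le> 3 * (D * G)" using sizes by linarith
    then have "B * (1 + N * NA + N) \<le> B * (3 * (D * G))" using B by (intro mult_left_mono) auto
    then show ?thesis by (simp add: algebra_simps)
  qed
  also have "3 * (D * B * G) + ?mart + (\<Sum>t<n. err t) \<le> 10 * (D * F) + 11 * (D * H) + 4 * (D * B * G) + 40 * (D\<^sup>2 * B * G)"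
    using martingale_V_le sum_err_le unfolding mult.assoc by linarith
  also have "D * H \<le> D * F + 40 * (D\<^sup>2 * B * G)"
    using mult_left_mono[OF H_le, of D] D by (simp add: power2_eq_square algebra_simps)
  also have "D * F \<le> 2 * (D * ?R) + D\<^sup>2 * B * G"
    using mult_left_mono[OF F_le, of D] D by (simp add: power2_eq_square algebra_simps)
  \<comment> \<open>Eliminating \<open>H\<close> and then \<open>F\<close> gives 21 * 2 = 42 and 440
    + 21 + 40 = 501.\<close>
  finally have "real (goals n) * U (Some (init M)) - (\<Sum>t<n. rew t) \<le>
      42 * (D * ?R) + 501 * (D\<^sup>2 * B * G) + 4 * (D * B * G)"
    by (simp add: mult_ac)
  moreover have "D * (B * G) \<le> D\<^sup>2 * (B * G)"
    using D B sizes by (intro mult_right_mono) (auto simp: self_le_power)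
  moreover have "D * ?R \<le> D\<^sup>2 * ?R"
    using D U(2) Bs N_ge1 Lam_pos by (intro mult_right_mono) (auto simp: self_le_power)
  moreover have "0 \<le> D\<^sup>2 * (B * G)" "0 \<le> D\<^sup>2 * ?R" using B sizes U(2) Bs N_ge1 Lam_pos by auto
  ultimately have "real (goals n) * U (Some (init M)) - (\<Sum>t<n. rew t) \<le> 1000 * (D\<^sup>2 * ?R) + 1000 * (D\<^sup>2 * (B * G))"
    unfolding mult.assoc by linarith
  also have "\<dots> = 1000 * D\<^sup>2 * (?R + B * G)" by (simp only: distrib_left mult.assoc)
  also have "B * G = B * N\<^sup>2 * NA * Lam" by (simp add: G_def mult.assoc)
  finally show ?thesis .
qed

end

end

subsection \<open>Concentration along a run\<close>

text \<open>The deviation is set to 0 off the pair, so it is a martingale difference of the whole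
  process and visit times need no treatment as stopping times. With the visit indicator as \<nu>,
  the iterated logarithm sees only visits. The two signs \<open>c\<close> of the deviation cost the
  factor 2 in \<open>2 * p\<close>.\<close>

lemma time_uniform_empirical_bernstein:
  fixes M :: "('s::countable, 'a::countable) path_problem" and f :: "'s option \<Rightarrow> real"
  assumes f: "\<And>x. 0 \<le> f x" "\<And>x. f x \<le> R" and R: "0 < R" and p: "0 < p" "p \<le> 1"
  shows "\<exists>E\<in>sets (learning M L). measure (learning M L) E \<le> 2 * p \<and> (\<forall>\<omega>. \<omega> \<notin> E \<longrightarrow> (\<forall>n.
    \<bar>\<Sum>t<n. if fst (\<omega> t) = s \<and> fst (snd (\<omega> t)) = a then f (snd (snd (\<omega> t))) - (LINT x|trans M s a. f x) else 0\<bar> \<le>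
    3 * sqrt ((\<Sum>t<n. if fst (\<omega> t) = s \<and> fst (snd (\<omega> t)) = a then (f (snd (snd (\<omega> t))) - (LINT x|trans M s a. f x))\<^sup>2 else 0) *
      (ln (1 / p) + 3 + 2 * lnln (\<Sum>t<n. if fst (\<omega> t) = s \<and> fst (snd (\<omega> t)) = a then 1 else 0))) +
    2 * R * (ln (1 / p) + 3 + 2 * lnln (\<Sum>t<n. if fst (\<omega> t) = s \<and> fst (snd (\<omega> t)) = a then 1 else 0))))"
proof -
  let ?\<mu> = "LINT x|trans M s a. f x"
  let ?sel = "\<lambda>y::('s,'a) transition. fst y = s \<and> fst (snd y) = a"
  let ?Y = "\<lambda>y::('s,'a) transition. if ?sel y then f (snd (snd y)) - ?\<mu> else 0"
  let ?q = "\<lambda>y::('s,'a) transition. if ?sel y then (f (snd (snd y)) - ?\<mu>)\<^sup>2 else 0"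
  let ?n = "\<lambda>y::('s,'a) transition. if ?sel y then 1 else 0::real"
  interpret prob_space "learning M L" unfolding learning_def by (rule prob_space_trajectories)
  have int: "integrable (measure_pmf q) f" for q
    by (rule integrable_pmf_bounded[where C = R]) (use f in \<open>auto simp: abs_le_iff intro: order_trans[of _ 0]\<close>)
  have \<mu>: "0 \<le> ?\<mu>" "?\<mu> \<le> R"
  proof -
    show "0 \<le> ?\<mu>" by (simp add: f Bochner_Integration.integral_nonneg)
    have "?\<mu> \<le> (LINT x|trans M s a. R)" by (rule integral_mono[OF int]) (auto simp: f)
    then show "?\<mu> \<le> R" by simp
  qed
  have Y: "\<bar>c * ?Y y\<bar> \<le> R" if "\<bar>c\<bar> = 1" for c y
    using f[of "snd (snd y)"] \<mu> R that by (auto simp: abs_mult abs_le_iff)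
  have q: "?q y = (c * ?Y y)\<^sup>2" if "\<bar>c\<bar> = 1" for c y
    using that by (auto simp: power_mult_distrib abs_square_eq_1)
  have qn: "?q y \<le> R\<^sup>2 * ?n y" for y
    using Y[of 1 y] R by (auto intro!: abs_le_square_iff[THEN iffD1])
  have E0: "(LINT y|learning_step M L h. c * ?Y y) = 0" for h c
  proof -
    let ?s = "current_state M h"
    let ?a = "L h ?s"
    have "(LINT y|learning_step M L h. c * ?Y y) =
        (LINT x|trans M ?s ?a. c * (if ?s = s \<and> ?a = a then f x - ?\<mu> else 0))"
      by (simp only: learning_step_def Let_def integral_map_pmf fst_conv snd_conv)
    also have "\<dots> = (if ?s = s \<and> ?a = a then LINT x|trans M ?s ?a. c * (f x - ?\<mu>) else 0)"
    proof (cases "?s = s \<and> ?a = a")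
      case True
      then have "(?s = s \<and> ?a = a) = True" by blast
      then show ?thesis by (simp only: if_True)
    next
      case False
      then have "(?s = s \<and> ?a = a) = False" by blast
      then show ?thesis by (simp only: if_False mult_zero_right Bochner_Integration.integral_zero)
    qed
    also have "\<dots> = 0"
      using int by auto
    finally show ?thesis .
  qed
  have "\<exists>E\<in>sets (learning M L). prob E \<le> p \<and> (\<forall>\<omega>. \<omega> \<notin> E \<longrightarrow> (\<forall>n. (\<Sum>t<n. c * ?Y (\<omega> t)) \<le>
      3 * sqrt ((\<Sum>t<n. ?q (\<omega> t)) * (ln (1 / p) + 3 + 2 * lnln (\<Sum>t<n. ?n (\<omega> t)))) +
      2 * R * (ln (1 / p) + 3 + 2 * lnln (\<Sum>t<n. ?n (\<omega> t)))))" if c: "\<bar>c\<bar> = 1" for c :: real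
    unfolding learning_def
  proof (rule time_uniform_bernstein[where Y = "\<lambda>_ y. c * ?Y y" and q = "\<lambda>_. ?q" and \<nu> = "\<lambda>_. ?n", OF R _ qn _ p])
    fix \<eta> :: real and h assume \<eta>: "0 < \<eta>" "\<eta> * R \<le> 1 / 2"
    show "(\<integral>\<^sup>+y. ennreal (exp (\<eta> * (c * ?Y y) - \<eta>\<^sup>2 * ?q y)) \<partial>learning_step M L h) \<le> 1"
      unfolding q[OF c] by (rule nn_integral_exp_self_normalized[OF Y[OF c] E0 \<eta>])
  qed auto
  from this[of 1] this[of "-1"] obtain E1 E2 where E:
    "E1 \<in> sets (learning M L)" "prob E1 \<le> p" "E2 \<in> sets (learning M L)" "prob E2 \<le> p"
    "\<And>\<omega> n. \<omega> \<notin> E1 \<Longrightarrow> (\<Sum>t<n. 1 * ?Y (\<omega> t)) \<le>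
      3 * sqrt ((\<Sum>t<n. ?q (\<omega> t)) * (ln (1 / p) + 3 + 2 * lnln (\<Sum>t<n. ?n (\<omega> t)))) +
      2 * R * (ln (1 / p) + 3 + 2 * lnln (\<Sum>t<n. ?n (\<omega> t)))"
    "\<And>\<omega> n. \<omega> \<notin> E2 \<Longrightarrow> (\<Sum>t<n. -1 * ?Y (\<omega> t)) \<le>
      3 * sqrt ((\<Sum>t<n. ?q (\<omega> t)) * (ln (1 / p) + 3 + 2 * lnln (\<Sum>t<n. ?n (\<omega> t)))) +
      2 * R * (ln (1 / p) + 3 + 2 * lnln (\<Sum>t<n. ?n (\<omega> t)))"
    by auto
  have "prob (E1 \<union> E2) \<le> prob E1 + prob E2" using E by (intro measure_Un_le) auto
  then have "prob (E1 \<union> E2) \<le> 2 * p" using E by simp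
  moreover have "\<bar>\<Sum>t<n. ?Y (\<omega> t)\<bar> \<le>
      3 * sqrt ((\<Sum>t<n. ?q (\<omega> t)) * (ln (1 / p) + 3 + 2 * lnln (\<Sum>t<n. ?n (\<omega> t)))) +
      2 * R * (ln (1 / p) + 3 + 2 * lnln (\<Sum>t<n. ?n (\<omega> t)))" if "\<omega> \<notin> E1 \<union> E2" for \<omega> n
  proof -
    have "(\<Sum>t<n. -1 * ?Y (\<omega> t)) = - (\<Sum>t<n. ?Y (\<omega> t))" by (simp add: sum_negf)
    then show ?thesis using E(5)[of \<omega> n] E(6)[of \<omega> n] that by (simp add: abs_le_iff)
  qed
  ultimately show ?thesis using E(1,3) by (intro bexI[of _ "E1 \<union> E2"]) auto
qed

text \<open>A martingale difference for a function \<open>g h\<close> that is fixed by the past. The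
  sign, mean minus outcome, is the one whose sums the regret analysis bounds from above.\<close>

definition innov :: "('s, 'a) path_problem \<Rightarrow> ('s, 'a) learner \<Rightarrow> (('s, 'a) transition list \<Rightarrow> 's option \<Rightarrow> real) \<Rightarrow>
    ('s, 'a) transition list \<Rightarrow> ('s, 'a) transition \<Rightarrow> real" where
  "innov M L g h y = (LINT x|trans M (current_state M h) (L h (current_state M h)). g h x) - g h (snd (snd y))"

definition innov_var :: "('s, 'a) path_problem \<Rightarrow> ('s, 'a) learner \<Rightarrow> (('s, 'a) transition list \<Rightarrow> 's option \<Rightarrow> real) \<Rightarrow>
    ('s, 'a) transition list \<Rightarrow> real" where
  "innov_var M L g h = (LINT y|learning_step M L h. (innov M L g h y)\<^sup>2)"

context
  fixes M :: "('s::countable, 'a::countable) path_problem" and L :: "('s, 'a) learner"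
    and g :: "('s, 'a) transition list \<Rightarrow> 's option \<Rightarrow> real" and lo R :: real
  assumes g: "\<And>h x. lo \<le> g h x" "\<And>h x. g h x \<le> lo + R" and R: "0 < R"
begin

lemma integrable_g: "integrable (measure_pmf q) (g h)"
proof (rule integrable_pmf_bounded)
  fix x show "\<bar>g h x\<bar> \<le> \<bar>lo\<bar> + R" using g[of h x] R by (auto simp: abs_if)
qed

lemma innov_bound: "\<bar>innov M L g h y\<bar> \<le> R"
proof -
  let ?p = "trans M (current_state M h) (L h (current_state M h))"
  have "(LINT x|?p. lo) \<le> (LINT x|?p. g h x)" by (rule integral_mono[OF _ integrable_g]) (auto simp: g)
  moreover have "(LINT x|?p. g h x) \<le> (LINT x|?p. lo + R)" by (rule integral_mono[OF integrable_g]) (auto simp: g)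
  ultimately show ?thesis using g[of h "snd (snd y)"] by (simp add: innov_def abs_le_iff)
qed

lemma scaled_innov_le:
  assumes "0 < \<eta>" "\<eta> * R \<le> 1"
  shows "\<eta> * innov M L g h y \<le> 1"
proof -
  have "\<eta> * innov M L g h y \<le> \<eta> * R"
    using innov_bound[of h y] assms(1) by (intro mult_left_mono) auto
  then show ?thesis using assms(2) by linarith
qed

lemma innov_centered: "(LINT y|learning_step M L h. innov M L g h y) = 0"
  using integrable_g by (simp add: learning_step_def Let_def innov_def)

lemma innov_var_bounds: "0 \<le> innov_var M L g h" "innov_var M L g h \<le> R\<^sup>2"
proof -
  show "0 \<le> innov_var M L g h" by (simp add: innov_var_def Bochner_Integration.integral_nonneg)
  have sq: "(innov M L g h y)\<^sup>2 \<le> R\<^sup>2" for y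
    using innov_bound[of h y] R by (intro abs_le_square_iff[THEN iffD1]) auto
  have "innov_var M L g h \<le> (LINT y|learning_step M L h. R\<^sup>2)"
    unfolding innov_var_def
    by (intro integral_mono integrable_pmf_bounded[where C = "R\<^sup>2"]) (auto simp: sq)
  then show "innov_var M L g h \<le> R\<^sup>2" by simp
qed

lemma time_uniform_innov:
  assumes p: "0 < p" "p \<le> 1"
  shows "\<exists>E\<in>sets (learning M L). measure (learning M L) E \<le> p \<and> (\<forall>\<omega>. \<omega> \<notin> E \<longrightarrow> (\<forall>n.
    (\<Sum>t<n. innov M L g (map \<omega> [0..<t]) (\<omega> t)) \<le>
    3 * sqrt ((\<Sum>t<n. innov_var M L g (map \<omega> [0..<t])) * (ln (1 / p) + 3 + 2 * lnln (real n))) +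
    2 * R * (ln (1 / p) + 3 + 2 * lnln (real n))))"
proof -
  have "\<exists>E\<in>sets (trajectories (learning_step M L)). measure (trajectories (learning_step M L)) E \<le> p \<and> (\<forall>\<omega>. \<omega> \<notin> E \<longrightarrow> (\<forall>n.
    (\<Sum>t<n. innov M L g (map \<omega> [0..<t]) (\<omega> t)) \<le>
    3 * sqrt ((\<Sum>t<n. innov_var M L g (map \<omega> [0..<t])) * (ln (1 / p) + 3 + 2 * lnln (\<Sum>t<n. 1))) +
    2 * R * (ln (1 / p) + 3 + 2 * lnln (\<Sum>t<n. 1))))"
  proof (rule time_uniform_bernstein[where q = "\<lambda>h _. innov_var M L g h" and \<nu> = "\<lambda>_ _. 1", OF R _ _ _ p])
    fix \<eta> :: real and h assume \<eta>: "0 < \<eta>" "\<eta> * R \<le> 1 / 2"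
    show "(\<integral>\<^sup>+y. ennreal (exp (\<eta> * innov M L g h y - \<eta>\<^sup>2 * innov_var M L g h)) \<partial>learning_step M L h) \<le> 1"
      unfolding innov_var_def
      by (rule nn_integral_exp_cond_variance[OF innov_bound innov_centered scaled_innov_le]) (use \<eta> in auto)
  qed (auto simp: innov_var_bounds)
  then show ?thesis by (simp add: learning_def)
qed

text \<open>With a single \<eta> there is no stitching and no iterated logarithm. The variance
  enters linearly with coefficient \<eta>, which suits the sums that are absorbed later.\<close>

lemma freedman_innov:
  assumes p: "0 < p" and \<eta>: "0 < \<eta>" "\<eta> * R \<le> 1"
  shows "\<exists>E\<in>sets (learning M L). measure (learning M L) E \<le> p \<and> (\<forall>\<omega>. \<omega> \<notin> E \<longrightarrow> (\<forall>n.
    (\<Sum>t<n. innov M L g (map \<omega> [0..<t]) (\<omega> t)) \<le>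
      \<eta> * (\<Sum>t<n. innov_var M L g (map \<omega> [0..<t])) + ln (1 / p) / \<eta>))"
proof -
  have "(\<integral>\<^sup>+y. ennreal (exp (\<eta> * innov M L g h y - \<eta>\<^sup>2 * innov_var M L g h)) \<partial>learning_step M L h) \<le> 1" for h
    unfolding innov_var_def by (rule nn_integral_exp_cond_variance[OF innov_bound innov_centered scaled_innov_le[OF \<eta>]])
  from ville_exp[where Z = "\<lambda>h y. \<eta> * innov M L g h y - \<eta>\<^sup>2 * innov_var M L g h", OF this p]
  obtain E where E: "E \<in> sets (learning M L)" "measure (learning M L) E \<le> p"
    "\<And>\<omega> n. \<omega> \<notin> E \<Longrightarrow> (\<Sum>t<n. \<eta> * innov M L g (map \<omega> [0..<t]) (\<omega> t) - \<eta>\<^sup>2 * innov_var M L g (map \<omega> [0..<t])) < ln (1 / p)"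
    unfolding learning_def by blast
  have "(\<Sum>t<n. innov M L g (map \<omega> [0..<t]) (\<omega> t)) \<le>
      \<eta> * (\<Sum>t<n. innov_var M L g (map \<omega> [0..<t])) + ln (1 / p) / \<eta>" if "\<omega> \<notin> E" for \<omega> n
  proof -
    let ?S = "\<Sum>t<n. innov M L g (map \<omega> [0..<t]) (\<omega> t)" and ?Q = "\<Sum>t<n. innov_var M L g (map \<omega> [0..<t])"
    have "\<eta> * ?S - \<eta>\<^sup>2 * ?Q \<le> ln (1 / p)"
      using E(3)[OF that, of n] by (simp add: sum_subtractf sum_distrib_left)
    then have "\<eta> * ?S \<le> \<eta> * (\<eta> * ?Q + ln (1 / p) / \<eta>)"
      using \<eta> by (simp add: power2_eq_square algebra_simps)
    then show ?thesis using \<eta> by simp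
  qed
  then show ?thesis using E by blast
qed

end

subsection \<open>Measurability of the regret\<close>

lemma measurable_learning_nth [measurable]:
  fixes M :: "('s::countable, 'a::countable) path_problem"
  shows "(\<lambda>\<omega>. \<omega> t) \<in> learning M L \<rightarrow>\<^sub>M count_space UNIV"
  unfolding learning_def by measurable

lemma measurable_learning_fun:
  fixes M :: "('s::countable, 'a::countable) path_problem"
  shows "(\<lambda>\<omega>. f (\<omega> t)) \<in> learning M L \<rightarrow>\<^sub>M count_space UNIV"
  by (rule measurable_compose[OF measurable_learning_nth measurable_count_space])

lemma measurable_ep_end:
  fixes M :: "('s::countable, 'a::countable) path_problem"
  shows "(\<lambda>\<omega>. ep_end \<omega> k) \<in> learning M L \<rightarrow>\<^sub>M count_space UNIV"
proof (induction k)
  case (Suc k)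
  have goal: "(\<lambda>\<omega>. i \<le> t \<and> reaches_goal (\<omega> t)) \<in> learning M L \<rightarrow>\<^sub>M count_space UNIV" for i t
    by (rule measurable_learning_fun[of "\<lambda>y. i \<le> t \<and> reaches_goal y" t M L])
  have "(\<lambda>\<omega>. Suc (LEAST t. i \<le> t \<and> reaches_goal (\<omega> t))) \<in> learning M L \<rightarrow>\<^sub>M count_space UNIV" for i
    by (rule measurable_compose[OF measurable_Least[where P = "\<lambda>t \<omega>. i \<le> t \<and> reaches_goal (\<omega> t)", OF goal]])
       (rule measurable_count_space)
  from measurable_compose_countable[where f = "\<lambda>i \<omega>. Suc (LEAST t. i \<le> t \<and> reaches_goal (\<omega> t))", OF this Suc]
  show ?case by (simp only: ep_end.simps)
next
  case 0
  show ?case unfolding ep_end.simps by (rule measurable_const) simp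
qed

text \<open>The summation limits are random but take countably many values, so they are frozen one
  at a time.\<close>

lemma measurable_regret:
  fixes M :: "('s::countable, 'a::countable) path_problem"
  shows "(\<lambda>\<omega>. regret M \<omega> K) \<in> borel_measurable (learning M L)"
proof -
  have r: "(\<lambda>\<omega>. case \<omega> t of (s, a, _) \<Rightarrow> reward M s a) \<in> borel_measurable (learning M L)" for t
    by (rule measurable_compose[OF measurable_learning_nth, where g = "\<lambda>y. case y of (s, a, _) \<Rightarrow> reward M s a"])
       (simp only: measurable_count_space_eq1 space_borel Pi_UNIV UNIV_I)
  let ?f = "\<lambda>m n \<omega>. \<Sum>t\<in>{m..<n}. case \<omega> t of (s, a, _) \<Rightarrow> reward M s a"
  have 1: "?f m n \<in> borel_measurable (learning M L)" for m n
    by (rule borel_measurable_sum[OF r])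
  have 2: "(\<lambda>\<omega>. ?f m (ep_end \<omega> j) \<omega>) \<in> borel_measurable (learning M L)" for m j
    by (rule measurable_compose_countable[where f = "?f m" and g = "\<lambda>\<omega>. ep_end \<omega> j", OF 1 measurable_ep_end])
  have 3: "(\<lambda>\<omega>. ?f (ep_end \<omega> i) (ep_end \<omega> j) \<omega>) \<in> borel_measurable (learning M L)" for i j
    by (rule measurable_compose_countable[where f = "\<lambda>m \<omega>. ?f m (ep_end \<omega> j) \<omega>" and g = "\<lambda>\<omega>. ep_end \<omega> i", OF 2 measurable_ep_end])
  show ?thesis unfolding regret_def
    by (intro borel_measurable_sum borel_measurable_diff borel_measurable_const 3)
qed

lemma measurable_regret_bound:
  fixes M :: "('s::countable, 'a::countable) path_problem" and R :: "nat \<Rightarrow> nat \<Rightarrow> real"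
  shows "{\<omega> \<in> space (learning M L). infinite {t. reaches_goal (\<omega> t)} \<and> (\<forall>K\<ge>1. regret M \<omega> K \<le> R K (ep_end \<omega> K))}
    \<in> sets (learning M L)"
proof -
  have g: "{\<omega> \<in> space (learning M L). m \<le> t \<and> reaches_goal (\<omega> t)} \<in> sets (learning M L)" for m t
    using measurable_learning_fun[of "\<lambda>y. m \<le> t \<and> reaches_goal y" t M L] by (simp only: pred_def)
  have "(\<lambda>\<omega>. R K (ep_end \<omega> K)) \<in> borel_measurable (learning M L)" for K
    by (rule measurable_compose[OF measurable_ep_end, where g = "R K"])
       (simp only: measurable_count_space_eq1 space_borel Pi_UNIV UNIV_I)
  then have r: "{\<omega> \<in> space (learning M L). regret M \<omega> K \<le> R K (ep_end \<omega> K)} \<in> sets (learning M L)" for K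
    by (rule borel_measurable_le[OF measurable_regret])
  have t: "t \<in> {t. reaches_goal (\<omega> t)} \<longleftrightarrow> reaches_goal (\<omega> t)" for t \<omega> by simp
  show ?thesis unfolding infinite_nat_iff_unbounded_le t
    by (intro sets.sets_Collect_conj sets.sets_Collect_countable_All sets.sets_Collect_countable_Ex
        sets.sets_Collect_imp sets.sets_Collect_const g r)
qed

subsection \<open>Episodes\<close>

context
  fixes \<omega> :: "nat \<Rightarrow> ('s, 'a) transition"
  assumes inf: "infinite {t. reaches_goal (\<omega> t)}"
begin

text \<open>\<open>ep_end\<close> is the successor of a \<open>LEAST\<close>, which is meaningful
  because there are infinitely many goals; the goal step of an episode is thus at its
  \<open>ep_end\<close> minus 1.\<close>

lemma ep_end_Suc:
  "ep_end \<omega> k < ep_end \<omega> (Suc k)" "reaches_goal (\<omega> (ep_end \<omega> (Suc k) - 1))"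
  "ep_end \<omega> k \<le> t \<Longrightarrow> t < ep_end \<omega> (Suc k) - 1 \<Longrightarrow> \<not> reaches_goal (\<omega> t)"
proof -
  let ?P = "\<lambda>t. ep_end \<omega> k \<le> t \<and> reaches_goal (\<omega> t)"
  have "\<exists>t. ?P t" using inf unfolding infinite_nat_iff_unbounded_le by auto
  then have "?P (LEAST t. ?P t)" by (rule LeastI_ex)
  then show "ep_end \<omega> k < ep_end \<omega> (Suc k)" "reaches_goal (\<omega> (ep_end \<omega> (Suc k) - 1))" by auto
  show "\<not> reaches_goal (\<omega> t)" if "ep_end \<omega> k \<le> t" "t < ep_end \<omega> (Suc k) - 1"
    using not_less_Least[of t ?P] that by auto
qed

lemma card_goals_ep_end: "card {t. t < ep_end \<omega> K \<and> reaches_goal (\<omega> t)} = K"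
proof (induction K)
  case (Suc K)
  let ?e = "ep_end \<omega> (Suc K) - 1"
  have "{t. t < ep_end \<omega> (Suc K) \<and> reaches_goal (\<omega> t)} = insert ?e {t. t < ep_end \<omega> K \<and> reaches_goal (\<omega> t)}"
  proof -
    have "t = ?e" if "t < ep_end \<omega> (Suc K)" "reaches_goal (\<omega> t)" "\<not> t < ep_end \<omega> K" for t
      using ep_end_Suc(3)[of K t] that by linarith
    then show ?thesis using ep_end_Suc(1,2)[of K] by (auto simp del: ep_end.simps)
  qed
  moreover have "?e \<notin> {t. t < ep_end \<omega> K \<and> reaches_goal (\<omega> t)}" using ep_end_Suc(1)[of K] by auto
  moreover have "finite {t. t < ep_end \<omega> K \<and> reaches_goal (\<omega> t)}" by simp
  ultimately show ?case using Suc by simp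
qed simp

lemma regret_eq:
  "regret M \<omega> K = real K * opt_value M (init M) - (\<Sum>t<ep_end \<omega> K. reward M (fst (\<omega> t)) (fst (snd (\<omega> t))))"
proof -
  let ?r = "\<lambda>t. reward M (fst (\<omega> t)) (fst (snd (\<omega> t)))"
  have "(\<Sum>k=1..K. \<Sum>t\<in>{ep_end \<omega> (k - 1)..<ep_end \<omega> k}. ?r t) = (\<Sum>t<ep_end \<omega> K. ?r t)"
  proof (induction K)
    case (Suc K)
    have "{..<ep_end \<omega> (Suc K)} = {..<ep_end \<omega> K} \<union> {ep_end \<omega> K..<ep_end \<omega> (Suc K)}"
      using ep_end_Suc(1)[of K] by (auto simp del: ep_end.simps)
    then have "(\<Sum>t<ep_end \<omega> (Suc K). ?r t) = (\<Sum>t<ep_end \<omega> K. ?r t) + (\<Sum>t\<in>{ep_end \<omega> K..<ep_end \<omega> (Suc K)}. ?r t)"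
      by (simp del: ep_end.simps add: sum.union_disjoint ivl_disj_int)
    then show ?case using Suc by (simp del: ep_end.simps)
  qed simp
  then show ?thesis by (simp add: regret_def sum_subtractf case_prod_unfold)
qed

lemma ep_end_pos: "1 \<le> K \<Longrightarrow> 0 < ep_end \<omega> K"
  using ep_end_Suc(1)[of "K - 1"] by (cases K) (auto simp del: ep_end.simps)

end

subsection \<open>The general case\<close>

context vi_path
begin

lemma run_history: "current_state M (map \<omega> [0..<t]) = st t" "L (map \<omega> [0..<t]) (st t) = ac t"
  using valid by (simp_all add: valid_run_def st_def ac_def)

lemma innov_run: "innov M L g (map \<omega> [0..<t]) (\<omega> t) =
    mean_on X (ker t) (g (map \<omega> [0..<t])) - g (map \<omega> [0..<t]) (nx t)"
  by (simp add: innov_def run_history expectation_trans path ker_def nx_def)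

lemma innov_var_run: "innov_var M L g (map \<omega> [0..<t]) = variance_on X (ker t) (g (map \<omega> [0..<t]))"
proof -
  let ?h = "map \<omega> [0..<t]"
  have "innov_var M L g ?h = (LINT x|trans M (st t) (ac t). (mean_on X (ker t) (g ?h) - g ?h x)\<^sup>2)"
    by (simp add: innov_var_def innov_def learning_step_def Let_def run_history expectation_trans path ker_def)
  also have "\<dots> = mean_on X (ker t) (\<lambda>x. (mean_on X (ker t) (g ?h) - g ?h x)\<^sup>2)"
    by (simp add: expectation_trans path ker_def)
  also have "\<dots> = variance_on X (ker t) (g ?h)"
    unfolding variance_on_eq[OF ker_prob(1)] by (intro mean_on_cong power2_commute)
  finally show ?thesis .
qed

text \<open>\<open>empirical_bernstein_solve\<close> after passing from
  \<open>lp + 3 + 2 * lnln\<close> to 50 times \<open>io t\<close>. The constant is 36 * 50 = 1800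
  for the linear term; the root term needs only 6 * 8, as 8 exceeds the root of 50.\<close>

lemma empirical_bernstein_run:
  assumes ev: "\<And>n. \<bar>\<Sum>i<n. if fst (\<omega> i) = st t \<and> fst (snd (\<omega> i)) = ac t
        then f (snd (snd (\<omega> i))) - (LINT x|trans M (st t) (ac t). f x) else 0\<bar> \<le>
      3 * sqrt ((\<Sum>i<n. if fst (\<omega> i) = st t \<and> fst (snd (\<omega> i)) = ac t
          then (f (snd (snd (\<omega> i))) - (LINT x|trans M (st t) (ac t). f x))\<^sup>2 else 0) *
        (lp + 3 + 2 * lnln (\<Sum>i<n. if fst (\<omega> i) = st t \<and> fst (snd (\<omega> i)) = ac t then 1 else 0))) +
      2 * R * (lp + 3 + 2 * lnln (\<Sum>i<n. if fst (\<omega> i) = st t \<and> fst (snd (\<omega> i)) = ac t then 1 else 0))"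
    and f: "\<And>x. 0 \<le> f x" "\<And>x. f x \<le> R" and lp: "0 \<le> lp"
    and l: "\<And>z. 0 \<le> z \<Longrightarrow> lp + 3 + 2 * lnln z \<le> 50 * log_term M \<delta> (B * z)"
  shows "\<bar>mean_on X (emp t) f - mean_on X (ker t) f\<bar> \<le> 1800 * (sqrt (variance_on X (emp t) f * y t) + R * y t)"
proof -
  define m where "m = mean_on X (ker t) f"
  define \<Delta> where "\<Delta> = mean_on X (emp t) f - m"
  define l' where "l' = lp + 3 + 2 * lnln (vis t)"
  have vis: "1 \<le> vis t" by (rule vis_ge1)
  have m: "(LINT x|trans M (st t) (ac t). f x) = m" by (simp add: m_def expectation_trans path ker_def)
  have R: "0 \<le> R" using f order_trans by blast
  have m_bounds: "0 \<le> m" "m \<le> R" "0 \<le> mean_on X (emp t) f" "mean_on X (emp t) f \<le> R"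
    using mean_on_mono[of X "ker t" f "\<lambda>_. R"] mean_on_mono[of X "emp t" f "\<lambda>_. R"] f ker_prob emp_prob
    by (auto simp: m_def mean_on_const intro!: mean_on_nonneg)
  have sums: "(\<Sum>i<Suc t. if st i = st t \<and> ac i = ac t then g (nx i) else 0) = vis t * mean_on X (emp t) g" for g
    using vis by (simp add: mean_emp del: sum.lessThan_Suc)
  \<comment> \<open>Taken at time \<open>Suc t\<close>, because \<open>vis t\<close> and
    \<open>emp t\<close> include the current visit.\<close>
  have "\<bar>vis t * mean_on X (emp t) (\<lambda>x. f x - m)\<bar> \<le>
      3 * sqrt (vis t * mean_on X (emp t) (\<lambda>x. (f x - m)\<^sup>2) * l') + 2 * R * l'"
    using ev[of "Suc t"] unfolding m st_def[symmetric] ac_def[symmetric] nx_def[symmetric]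
      sums[of "\<lambda>x. f x - m"] sums[of "\<lambda>x. (f x - m)\<^sup>2"] vis_eq[symmetric] l'_def .
  moreover have "mean_on X (emp t) (\<lambda>x. f x - m) = \<Delta>"
    by (simp only: mean_on_diff mean_on_const[OF emp_prob(1)] \<Delta>_def)
  moreover have "mean_on X (emp t) (\<lambda>x. (f x - m)\<^sup>2) = variance_on X (emp t) f + \<Delta>\<^sup>2"
    by (simp only: mean_square_shift[OF emp_prob(1)] \<Delta>_def)
  ultimately have "vis t * \<bar>\<Delta>\<bar> \<le> 3 * sqrt (vis t * (variance_on X (emp t) f + \<Delta>\<^sup>2) * l') + 2 * R * l'"
    using vis by (simp add: abs_mult)
  moreover have "0 \<le> l'" using lp lnln_nonneg[of "vis t"] by (simp add: l'_def)
  moreover have "0 \<le> variance_on X (emp t) f" by (rule variance_on_nonneg[OF emp_prob])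
  moreover have "\<bar>\<Delta>\<bar> \<le> R" using m_bounds by (simp add: \<Delta>_def abs_le_iff)
  ultimately have b: "\<bar>\<Delta>\<bar> \<le> 6 * sqrt (variance_on X (emp t) f * l' / vis t) + 36 * R * l' / vis t"
    using vis R by (intro empirical_bernstein_solve) auto
  have v: "0 \<le> variance_on X (emp t) f" by (rule variance_on_nonneg[OF emp_prob])
  have "l' \<le> 50 * io t" unfolding l'_def io_def using vis by (intro l) auto
  then have ly: "l' / vis t \<le> 50 * y t" using vis by (simp add: y_def divide_right_mono)
  have "variance_on X (emp t) f * l' / vis t \<le> 8\<^sup>2 * (variance_on X (emp t) f * y t) + 0\<^sup>2"
  proof -
    have "variance_on X (emp t) f * (l' / vis t) \<le> variance_on X (emp t) f * (64 * y t)"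
      using v ly y_pos[of t] by (intro mult_left_mono) auto
    then show ?thesis by simp
  qed
  then have "sqrt (variance_on X (emp t) f * l' / vis t) \<le> 8 * sqrt (variance_on X (emp t) f * y t) + 0"
    using v y_pos[of t] by (intro sqrt_le_of_add_squares) auto
  moreover have "36 * R * l' / vis t \<le> 1800 * (R * y t)"
    using mult_left_mono[OF ly, of "36 * R"] R by simp
  moreover have "0 \<le> sqrt (variance_on X (emp t) f * y t)" using v y_pos[of t] by simp
  ultimately have "\<bar>\<Delta>\<bar> \<le> 1800 * (sqrt (variance_on X (emp t) f * y t) + R * y t)"
    unfolding distrib_left using b by linarith
  then show ?thesis by (simp add: \<Delta>_def m_def)
qed

lemma goals_eq: "goals n = card {t. t < n \<and> reaches_goal (\<omega> t)}"
  by (simp add: goals_def reaches_goal_def nx_def)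

end

context nonneg_path_problem
begin

text \<open>Setting \<open>U\<close> to 0 off the successors makes its bounds hold on the whole
  type, as the concentration lemmas require.\<close>

lemma opt_value_bellman_bounded:
  obtains U :: "'s option \<Rightarrow> real" where "U None = 0" "\<And>x. 0 \<le> U x" "\<And>x. U x \<le> B_star M"
    "\<And>s. s \<in> S \<Longrightarrow> U (Some s) = opt_value M s"
    "\<And>s a. s \<in> S \<Longrightarrow> a \<in> A \<Longrightarrow> reward M s a + exp_next M s a U \<le> U (Some s)"
    "\<And>s. s \<in> S \<Longrightarrow> \<exists>a\<in>A. U (Some s) = reward M s a + exp_next M s a U"
proof -
  obtain U :: "'s option \<Rightarrow> real" where U: "U None = 0" "\<And>x. 0 \<le> U x"
    "\<And>s. s \<in> S \<Longrightarrow> U (Some s) = opt_value M s"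
    "\<And>s a. s \<in> S \<Longrightarrow> a \<in> A \<Longrightarrow> reward M s a + exp_next M s a U \<le> U (Some s)"
    "\<And>s. s \<in> S \<Longrightarrow> \<exists>a\<in>A. U (Some s) = reward M s a + exp_next M s a U"
    using opt_value_bellman by blast
  define U' where "U' x = (if x \<in> X then U x else 0)" for x
  have exp: "exp_next M s a U' = exp_next M s a U" for s a
    by (rule mean_on_cong) (simp add: U'_def)
  have le: "\<bar>opt_value M s\<bar> \<le> B_star M" if "s \<in> S" for s
    using that by (simp add: B_star_def)
  have B0: "0 \<le> B_star M" using le[OF init_S] by linarith
  have U'_le: "U' x \<le> B_star M" for x
  proof (cases "x \<in> Some ` S")
    case True
    then obtain s where s: "s \<in> S" "x = Some s" by blast
    then have "U' x = opt_value M s" using U(3) by (simp add: U'_def)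
    then show ?thesis using le[OF s(1)] by linarith
  next
    case False
    then show ?thesis using B0 U(1) by (auto simp: U'_def)
  qed
  have U'_Some: "U' (Some s) = U (Some s)" if "s \<in> S" for s using that by (simp add: U'_def)
  show thesis
  proof (rule that[of U'])
    show "U' None = 0" using U(1) by (simp add: U'_def)
    show "0 \<le> U' x" for x using U(2) by (simp add: U'_def)
  qed (use U'_le U'_Some exp U in auto)
qed

lemma regret_high_probability:
  fixes c1 c2 B \<delta> :: real and L :: "('s, 'a) learner"
  assumes c_large: "3600 \<le> c1" "2 * c1\<^sup>2 \<le> c2" and B: "1 \<le> B_star M" "B_star M \<le> B" and \<delta>: "0 < \<delta>" "\<delta> < 1"
    and run: "runs_VI_SP M c1 c2 B \<delta> L" and log_lb: "\<And>x. 1 / 8 \<le> log_term M \<delta> x"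
  shows "measure (learning M L)
         {\<omega> \<in> space (learning M L).
            infinite {t. reaches_goal (\<omega> t)} \<and>
            (\<forall>K\<ge>1. regret M \<omega> K \<le>
               1000 * c2\<^sup>2 * (sqrt (V_star M * B_star M * real (card (states M)) * real (card (actions M)) * real K
                          * log_factor M B \<delta> (ep_end \<omega> K))
                    + B * (real (card (states M)))\<^sup>2 * real (card (actions M))
                      * log_factor M B \<delta> (ep_end \<omega> K)))}
       \<ge> 1 - \<delta>" (is "measure ?P ?T \<ge> _")
proof -
  interpret P: prob_space "learning M L" unfolding learning_def by (rule prob_space_trajectories)
  have L: "L h s \<in> A" if "s \<in> S" for h s
    using run that by (auto simp: runs_VI_SP_def is_arg_max_def)
  obtain U :: "'s option \<Rightarrow> real" where U: "U None = 0" "\<And>x. 0 \<le> U x" "\<And>x. U x \<le> B_star M"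
    "\<And>s. s \<in> S \<Longrightarrow> U (Some s) = opt_value M s"
    "\<And>s a. s \<in> S \<Longrightarrow> a \<in> A \<Longrightarrow> reward M s a + exp_next M s a U \<le> U (Some s)"
    "\<And>s. s \<in> S \<Longrightarrow> \<exists>a\<in>A. U (Some s) = reward M s a + exp_next M s a U"
    using opt_value_bellman_bounded by blast
  have U_init: "U (Some (init M)) = opt_value M (init M)" by (rule U(4)[OF init_S])
  define Bs where "Bs = B_star M"
  have Bs: "1 \<le> Bs" "Bs \<le> B" "1 \<le> B" using B by (auto simp: Bs_def)
  have U_le: "U x \<le> Bs" "U x \<le> B" for x using U(3)[of x] Bs by (auto simp: Bs_def)
  have "c1 * 1 \<le> c1 * c1" using c_large by (intro mult_left_mono) auto
  moreover have "0 \<le> c1 * c1" by simp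
  ultimately have c': "0 < c1" "c1 \<le> c2" using c_large unfolding power2_eq_square by linarith+
  define n where "n = real (card S) * real (card A)"
  have cards: "1 \<le> card S" "1 \<le> card A"
    using A_ne init_S by (auto simp: Suc_le_eq card_gt_0_iff simp del: init_S)
  then have n: "1 \<le> n" "real (card S) \<le> n"
    using mult_mono[of 1 "real (card S)" 1 "real (card A)"] mult_left_mono[of 1 "real (card A)" "real (card S)"]
    by (auto simp: n_def)
  \<comment> \<open>The square accounts for a union over up to \<open>2 * n\<^sup>2\<close> entries
    of the kernel, while \<open>ln (1 / p)\<close> remains of the order of
    \<open>ln (n / \<delta>)\<close>. The total failure is at most
    \<open>9 * n\<^sup>2 * p = 9 / 16 * \<delta>\<^sup>2\<close>.\<close>
  define p where "p = (\<delta> / n)\<^sup>2 / 16"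
  have \<delta>n: "0 < \<delta> / n" "\<delta> / n \<le> 1" using \<delta> n by (auto simp: divide_le_eq)
  have "(\<delta> / n)\<^sup>2 \<le> 1" using \<delta>n by (simp add: power_le_one)
  then have p: "0 < p" "p \<le> 1" using \<delta>n by (auto simp: p_def)
  have lp: "0 \<le> ln (1 / p)" using p by simp
  have l: "ln (1 / p) + 3 + 2 * lnln z \<le> 50 * log_term M \<delta> (B * z)" if z: "0 \<le> z" for z
  proof -
    have "1 / p = 16 * (n / \<delta>)\<^sup>2" using \<delta> n by (simp add: p_def power_divide)
    moreover have "ln (16::real) = 4 * ln 2" using ln_realpow[of 2 4] by simp
    ultimately have "ln (1 / p) = 4 * ln 2 + 2 * ln (n / \<delta>)"
      using \<delta> n by (simp add: ln_mult ln_realpow)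
    then have 1: "ln (1 / p) \<le> 3 + 2 * ln (n / \<delta>)" using ln2_le_25_over_36 by simp
    have "lnln z \<le> lnln (B * z)" using z Bs mult_right_mono[of 1 B z] by (intro lnln_mono) auto
    \<comment> \<open>At argument 0 the iterated logarithm vanishes, so \<open>log_lb\<close> bounds
      \<open>ln (n / \<delta>)\<close> itself. The constants 3 + 3 are then at most 48 of these
      logarithms, whence 50 = 2 + 48.\<close>
    moreover have "1 / 8 \<le> ln (n / \<delta>)" using log_lb[of 0] by (simp add: log_term_def lnln_def n_def)
    moreover have "log_term M \<delta> (B * z) = ln (n / \<delta>) + lnln (B * z)" by (simp add: log_term_def n_def)
    moreover have "0 \<le> lnln z" by simp
    ultimately show ?thesis using 1 by linarith
  qed
  define ev where "ev f R s a \<omega> \<longleftrightarrow> (\<forall>n.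
    \<bar>\<Sum>t<n. if fst (\<omega> t) = s \<and> fst (snd (\<omega> t)) = a then f (snd (snd (\<omega> t))) - (LINT x|trans M s a. f x) else 0\<bar> \<le>
    3 * sqrt ((\<Sum>t<n. if fst (\<omega> t) = s \<and> fst (snd (\<omega> t)) = a then (f (snd (snd (\<omega> t))) - (LINT x|trans M s a. f x))\<^sup>2 else 0) *
      (ln (1 / p) + 3 + 2 * lnln (\<Sum>t<n. if fst (\<omega> t) = s \<and> fst (snd (\<omega> t)) = a then 1 else 0))) +
    2 * R * (ln (1 / p) + 3 + 2 * lnln (\<Sum>t<n. if fst (\<omega> t) = s \<and> fst (snd (\<omega> t)) = a then 1 else 0)))"
    for f :: "'s option \<Rightarrow> real" and R s a and \<omega> :: "nat \<Rightarrow> ('s, 'a) transition"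
  have ev_ex: "\<exists>E. E \<in> sets (learning M L) \<and> P.prob E \<le> 2 * p \<and> (\<forall>\<omega>. \<omega> \<notin> E \<longrightarrow> ev f R s a \<omega>)"
    if "\<And>x. 0 \<le> f x" "\<And>x. f x \<le> R" "0 < R" for f R s a
    using time_uniform_empirical_bernstein[of f R p M L s a, OF that p] unfolding ev_def by blast
  have "\<forall>sa. \<exists>E. E \<in> sets (learning M L) \<and> P.prob E \<le> 2 * p \<and> (\<forall>\<omega>. \<omega> \<notin> E \<longrightarrow> ev U B (fst sa) (snd sa) \<omega>)"
    using U U_le Bs by (intro allI ev_ex) auto
  from choice[OF this] obtain E1 where E1: "\<And>sa. E1 sa \<in> sets (learning M L)" "\<And>sa. P.prob (E1 sa) \<le> 2 * p"
      "\<And>sa \<omega>. \<omega> \<notin> E1 sa \<Longrightarrow> ev U B (fst sa) (snd sa) \<omega>" by blast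
  have "\<forall>sax. \<exists>E. E \<in> sets (learning M L) \<and> P.prob E \<le> 2 * p \<and>
      (\<forall>\<omega>. \<omega> \<notin> E \<longrightarrow> ev (indicator {snd sax}) 1 (fst (fst sax)) (snd (fst sax)) \<omega>)"
    by (intro allI ev_ex) (auto simp: indicator_def)
  from choice[OF this] obtain E2 where E2: "\<And>sax. E2 sax \<in> sets (learning M L)" "\<And>sax. P.prob (E2 sax) \<le> 2 * p"
      "\<And>sax \<omega>. \<omega> \<notin> E2 sax \<Longrightarrow> ev (indicator {snd sax}) 1 (fst (fst sax)) (snd (fst sax)) \<omega>" by blast
  \<comment> \<open>The estimates lie in \<open>[0, B]\<close> only along valid runs, but
    \<open>innov\<close> needs bounds for every history; on valid runs clipping changes nothing at
    the successors.\<close>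
  define clip where "clip h x = max 0 (min B (Vval (vi_run M c1 c2 B \<delta> h) x))" for h x
  have clip: "0 \<le> clip h x" "clip h x \<le> B" for h x using Bs by (auto simp: clip_def)
  obtain E3 where E3: "E3 \<in> sets (learning M L)" "P.prob E3 \<le> p"
    "\<And>\<omega> n. \<omega> \<notin> E3 \<Longrightarrow> (\<Sum>t<n. innov M L clip (map \<omega> [0..<t]) (\<omega> t)) \<le>
      3 * sqrt ((\<Sum>t<n. innov_var M L clip (map \<omega> [0..<t])) * (ln (1 / p) + 3 + 2 * lnln (real n))) +
      2 * B * (ln (1 / p) + 3 + 2 * lnln (real n))"
    using time_uniform_innov[where g = clip and lo = 0 and R = B and M = M and L = L and p = p] clip Bs p by auto
  \<comment> \<open>This is \<open>(U x - Bs)\<^sup>2 - Bs\<^sup>2\<close>, hence of range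
    \<open>Bs\<^sup>2\<close>.\<close>
  define u2 where "u2 h x = (U x)\<^sup>2 - 2 * Bs * U x" for h :: "('s, 'a) transition list" and x
  have u2: "- Bs\<^sup>2 \<le> u2 h x" "u2 h x \<le> - Bs\<^sup>2 + Bs\<^sup>2" for h x
  proof -
    have "0 \<le> (U x - Bs)\<^sup>2" by simp
    then show "- Bs\<^sup>2 \<le> u2 h x" by (simp add: u2_def power2_diff algebra_simps)
    have "U x * U x \<le> (2 * Bs) * U x" using U(2)[of x] U_le(1)[of x] by (intro mult_right_mono) auto
    then show "u2 h x \<le> - Bs\<^sup>2 + Bs\<^sup>2" by (simp add: u2_def power2_eq_square)
  qed
  obtain E4 where E4: "E4 \<in> sets (learning M L)" "P.prob E4 \<le> p"
    "\<And>\<omega> n. \<omega> \<notin> E4 \<Longrightarrow> (\<Sum>t<n. innov M L u2 (map \<omega> [0..<t]) (\<omega> t)) \<le>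
      1 / (8 * Bs\<^sup>2) * (\<Sum>t<n. innov_var M L u2 (map \<omega> [0..<t])) + ln (1 / p) / (1 / (8 * Bs\<^sup>2))"
  proof -
    \<comment> \<open>The variance of \<open>u2\<close> is at most \<open>4 * Bs\<^sup>2\<close>
      times that of \<open>U\<close>, so this step size yields the coefficient 1/2 of
      \<open>good_U2\<close>.\<close>
    have "0 < 1 / (8 * Bs\<^sup>2)" "1 / (8 * Bs\<^sup>2) * Bs\<^sup>2 \<le> 1" "0 < Bs\<^sup>2" using Bs by auto
    from freedman_innov[where g = u2 and lo = "- Bs\<^sup>2" and M = M and L = L, OF u2 this(3) p(1) this(1,2)]
    show thesis using that by blast
  qed
  define w2 where "w2 h x = (clip h x - U x)\<^sup>2" for h x
  have w2: "0 \<le> w2 h x" "w2 h x \<le> 0 + B\<^sup>2" for h x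
  proof -
    show "0 \<le> w2 h x" by (simp add: w2_def)
    have "\<bar>clip h x - U x\<bar> \<le> \<bar>B\<bar>" using clip[of h x] U(2)[of x] U_le(2)[of x] by auto
    then show "w2 h x \<le> 0 + B\<^sup>2" unfolding w2_def by (simp add: abs_le_square_iff)
  qed
  obtain E5 where E5: "E5 \<in> sets (learning M L)" "P.prob E5 \<le> p"
    "\<And>\<omega> n. \<omega> \<notin> E5 \<Longrightarrow> (\<Sum>t<n. innov M L w2 (map \<omega> [0..<t]) (\<omega> t)) \<le>
      1 / (16 * B\<^sup>2) * (\<Sum>t<n. innov_var M L w2 (map \<omega> [0..<t])) + ln (1 / p) / (1 / (16 * B\<^sup>2))"
  proof -
    \<comment> \<open>In the same way \<open>4 * B\<^sup>2 / (16 * B\<^sup>2)\<close> is the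
      coefficient 1/4 of \<open>good_W2\<close>.\<close>
    have "0 < 1 / (16 * B\<^sup>2)" "1 / (16 * B\<^sup>2) * B\<^sup>2 \<le> 1" "0 < B\<^sup>2" using Bs by auto
    from freedman_innov[where g = w2 and lo = 0 and M = M and L = L, OF w2 this(3) p(1) this(1,2)]
    show thesis using that by blast
  qed
  let ?E1 = "\<Union>sa\<in>S \<times> A. E1 sa" and ?E2 = "\<Union>sax\<in>(S \<times> A) \<times> X. E2 sax"
  define E where "E = ?E1 \<union> ?E2 \<union> (E3 \<union> E4 \<union> E5)"
  have E_sets: "E \<in> sets (learning M L)"
    unfolding E_def using E1(1) E2(1) E3(1) E4(1) E5(1) by (intro sets.Un sets.finite_UN) auto
  have E_prob: "P.prob E \<le> \<delta>"
  proof -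
    have s1: "?E1 \<in> sets (learning M L)" and s2: "?E2 \<in> sets (learning M L)"
      using E1(1) E2(1) by (auto intro!: sets.finite_UN)
    have "P.prob ?E1 \<le> (\<Sum>sa\<in>S \<times> A. P.prob (E1 sa))"
      using E1(1) by (intro P.finite_measure_subadditive_finite) auto
    also have "\<dots> \<le> (\<Sum>sa\<in>S \<times> A. 2 * p)" by (intro sum_mono E1)
    also have "\<dots> = n * (2 * p)" by (simp add: n_def card_cartesian_product)
    finally have 1: "P.prob ?E1 \<le> n * (2 * p)" .
    have "card X = Suc (card S)" by (simp add: card_image)
    then have cX: "real (card X) \<le> 2 * n" using n by simp
    have "P.prob ?E2 \<le> (\<Sum>sax\<in>(S \<times> A) \<times> X. P.prob (E2 sax))"
      using E2(1) by (intro P.finite_measure_subadditive_finite) auto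
    also have "\<dots> \<le> (\<Sum>sax\<in>(S \<times> A) \<times> X. 2 * p)" by (intro sum_mono E2)
    also have "\<dots> = n * real (card X) * (2 * p)" by (simp only: sum_constant card_cartesian_product n_def of_nat_mult)
    also have "\<dots> \<le> n * (2 * n) * (2 * p)" using cX n p by (intro mult_left_mono mult_right_mono) auto
    finally have 2: "P.prob ?E2 \<le> n * (2 * n) * (2 * p)" .
    have "P.prob (E3 \<union> E4 \<union> E5) \<le> P.prob (E3 \<union> E4) + P.prob E5"
      using E3(1) E4(1) E5(1) by (intro measure_Un_le) auto
    also have "P.prob (E3 \<union> E4) \<le> P.prob E3 + P.prob E4"
      using E3(1) E4(1) by (intro measure_Un_le) auto
    finally have 3: "P.prob (E3 \<union> E4 \<union> E5) \<le> 3 * p" using E3(2) E4(2) E5(2) by simp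
    have "P.prob E \<le> P.prob (?E1 \<union> ?E2) + P.prob (E3 \<union> E4 \<union> E5)"
      unfolding E_def using s1 s2 E3(1) E4(1) E5(1) by (intro measure_Un_le) auto
    also have "P.prob (?E1 \<union> ?E2) \<le> P.prob ?E1 + P.prob ?E2"
      using s1 s2 by (intro measure_Un_le)
    finally have "P.prob E \<le> n * (2 * p) + n * (2 * n) * (2 * p) + 3 * p" using 1 2 3 by linarith
    also have "\<dots> \<le> 9 * (n\<^sup>2 * p)"
    proof -
      have "n * p \<le> n\<^sup>2 * p" "1 * p \<le> n\<^sup>2 * p"
        using n p by (intro mult_right_mono; simp add: self_le_power)+
      then show ?thesis by (simp add: power2_eq_square algebra_simps)
    qed
    also have "n\<^sup>2 * p = \<delta>\<^sup>2 / 16" using n by (simp add: p_def power_divide)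
    also have "9 * (\<delta>\<^sup>2 / 16) \<le> \<delta>" using \<delta> by (simp add: power2_eq_square)
    finally show ?thesis .
  qed
  have main: "\<omega> \<in> ?T" if \<omega>: "\<omega> \<notin> E" and valid: "valid_run M L \<omega>" and inf: "infinite {t. reaches_goal (\<omega> t)}"
    and sp\<omega>: "\<omega> \<in> space (learning M L)" for \<omega>
  proof -
    interpret vi_path M c1 c2 B \<delta> L \<omega>
      using Bs c_large c' \<delta> run valid by unfold_locales auto
    have clipV: "clip (map \<omega> [0..<t]) x = V t x" if "x \<in> X" for t x
      using V_nonneg[OF that, of t] V_le_B[OF that, of t] by (simp add: clip_def V_def mem_def)
    have ev1: "ev U B s a \<omega>" if "s \<in> S" "a \<in> A" for s a
      using E1(3)[of \<omega> "(s, a)"] \<omega> that by (auto simp: E_def)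
    have ev2: "ev (indicator {x}) 1 s a \<omega>" if "s \<in> S" "a \<in> A" "x \<in> X" for s a x
      using E2(3)[of \<omega> "((s, a), x)"] \<omega> that unfolding E_def by force
    have lt: "ln (1 / p) \<le> 50 * log_term M \<delta> (B * real k)" for k :: nat
      using l[OF of_nat_0_le_iff, of k] lnln_nonneg[of "real k"] by linarith
    \<comment> \<open>\<open>c2\<close> can serve as \<open>D\<close>: with
      \<open>c1 \<ge> 3600\<close>, the condition \<open>2 * c1\<^sup>2 \<le> c2\<close> puts all
      other constants below it.\<close>
    interpret vi_good M c1 c2 B \<delta> L \<omega> U Bs 1800 c2
    proof unfold_locales
      show "U None = 0" "\<And>x. 0 \<le> U x" "\<And>x. U x \<le> Bs" "1 \<le> Bs" "Bs \<le> B" by (fact U U_le Bs)+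
      show "\<And>s a. s \<in> S \<Longrightarrow> a \<in> A \<Longrightarrow> reward M s a + exp_next M s a U \<le> U (Some s)"
        "\<And>s. s \<in> S \<Longrightarrow> \<exists>a\<in>A. U (Some s) = reward M s a + exp_next M s a U" by (fact U)+
      show "(0::real) < 1800" "2 * 1800 \<le> c1" "2 * 1800 \<le> c2" "8 \<le> c2" "1800 \<le> c2" "c1 \<le> c2" "c2 \<le> c2"
        using c_large c' by auto
      show "\<And>x. 1 / 8 \<le> log_term M \<delta> x" by (fact log_lb)
      show "\<bar>mean_on X (emp t) U - mean_on X (ker t) U\<bar> \<le> 1800 * (sqrt (variance_on X (emp t) U * y t) + B * y t)" for t
        by (rule empirical_bernstein_run[where f = U and R = B and lp = "ln (1 / p)" and t = t,
              OF ev1[OF path(1,2)[of t], unfolded ev_def, rule_format] U(2) U_le(2) lp l])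
      show "\<bar>emp t x - ker t x\<bar> \<le> 1800 * (sqrt (emp t x * y t) + y t)" if x: "x \<in> X" for t x
      proof -
        let ?f = "indicator {x} :: 's option \<Rightarrow> real"
        have mean: "mean_on X q ?f = q x" for q
        proof -
          have "mean_on X q ?f = (\<Sum>z\<in>X. if z = x then q z else 0)"
            unfolding mean_on_def by (rule sum.cong) (auto simp: indicator_def)
          also have "\<dots> = q x" using x by (subst sum.delta) auto
          finally show ?thesis .
        qed
        have "\<bar>mean_on X (emp t) ?f - mean_on X (ker t) ?f\<bar> \<le> 1800 * (sqrt (variance_on X (emp t) ?f * y t) + 1 * y t)"
          by (rule empirical_bernstein_run[where f = ?f and R = 1 and lp = "ln (1 / p)" and t = t,
                OF ev2[OF path(1,2)[of t] x, unfolded ev_def, rule_format] _ _ lp l])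
             (auto simp: indicator_def)
        \<comment> \<open>An indicator equals its square, so its variance is at most its
          mean.\<close>
        moreover have "variance_on X (emp t) ?f \<le> emp t x"
        proof -
          have "(\<lambda>z. (?f z)\<^sup>2) = ?f" by (auto simp: indicator_def)
          then show ?thesis by (simp add: variance_on_def mean)
        qed
        then have "sqrt (variance_on X (emp t) ?f * y t) \<le> sqrt (emp t x * y t)"
          using y_pos[of t] by (intro real_sqrt_le_mono mult_right_mono) auto
        ultimately show ?thesis unfolding mean distrib_left by linarith
      qed
      show "(\<Sum>t<n. mean_on X (ker t) (V t) - V t (nx t)) \<le>
          1800 * (sqrt ((\<Sum>t<n. variance_on X (ker t) (V t)) * log_term M \<delta> (B * real n)) + B * log_term M \<delta> (B * real n))" for n
      proof -
        let ?l = "ln (1 / p) + 3 + 2 * lnln (real n)" and ?lt = "log_term M \<delta> (B * real n)"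
        let ?v = "\<Sum>t<n. variance_on X (ker t) (V t)"
        have m: "mean_on X (ker t) (clip (map \<omega> [0..<t])) = mean_on X (ker t) (V t)" for t
          by (rule mean_on_cong) (rule clipV)
        have v: "variance_on X (ker t) (clip (map \<omega> [0..<t])) = variance_on X (ker t) (V t)" for t
          unfolding variance_on_def m by (rule arg_cong2[where f = minus, OF mean_on_cong refl]) (simp add: clipV)
        have ll: "?l \<le> 50 * ?lt" by (rule l) simp
        have v0: "0 \<le> ?v" by (intro sum_nonneg variance_on_nonneg ker_prob)
        have 1: "(\<Sum>t<n. mean_on X (ker t) (V t) - V t (nx t)) \<le> 3 * sqrt (?v * ?l) + 2 * B * ?l"
          using E3(3)[of \<omega> n] \<omega> unfolding innov_run innov_var_run m v clipV[OF path(3)] by (simp add: E_def)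
        have 2: "sqrt (?v * ?l) \<le> 8 * sqrt (?v * ?lt) + 0"
        proof (rule sqrt_le_of_add_squares)
          have "?v * ?l \<le> ?v * (64 * ?lt)" using ll log_term_pos[of "B * real n"] v0 by (intro mult_left_mono) auto
          then show "?v * ?l \<le> 8\<^sup>2 * (?v * ?lt) + 0\<^sup>2" by simp
        qed (use v0 log_term_pos[of "B * real n"] in auto)
        have 3: "B * ?l \<le> B * (50 * ?lt)" using ll Bs by (intro mult_left_mono) auto
        have 4: "0 \<le> sqrt (?v * ?lt)" "0 \<le> B * ?lt" using v0 log_term_pos[of "B * real n"] Bs by auto
        have "S' \<le> 1800 * (r + B * t')"
          if "S' \<le> 3 * q + 2 * B * l'" "q \<le> 8 * r + 0" "B * l' \<le> B * (50 * t')" "0 \<le> r" "0 \<le> B * t'"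
          for S' q l' r t' :: real
          using that by (simp add: distrib_left)
        from this[OF 1 2 3 4] show ?thesis .
      qed
      show "(\<Sum>t<n. mean_on X (ker t) (\<lambda>x. (U x)\<^sup>2 - 2 * Bs * U x) - ((U (nx t))\<^sup>2 - 2 * Bs * U (nx t))) \<le>
          (\<Sum>t<n. variance_on X (ker t) U) / 2 + 1800 * Bs\<^sup>2 * log_term M \<delta> (B * real n)" for n
      proof -
        let ?lt = "log_term M \<delta> (B * real n)" and ?f = "\<lambda>x. (U x)\<^sup>2 - 2 * Bs * U x"
        have vb: "variance_on X (ker t) ?f \<le> 4 * Bs\<^sup>2 * variance_on X (ker t) U" for t
        proof (rule variance_on_square_le[OF ker_prob])
          have "0 \<le> mean_on X (ker t) U" "mean_on X (ker t) U \<le> Bs"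
            using mean_on_mono[of X "ker t" U "\<lambda>_. Bs"] U U_le ker_prob by (auto simp: mean_on_const intro!: mean_on_nonneg)
          then show "\<bar>mean_on X (ker t) U - Bs\<bar> \<le> Bs" by auto
          show "\<bar>U x - Bs\<bar> \<le> Bs" for x using U(2)[of x] U_le(1)[of x] by auto
        qed
        have "(\<Sum>t<n. mean_on X (ker t) ?f - ?f (nx t)) \<le>
            1 / (8 * Bs\<^sup>2) * (\<Sum>t<n. variance_on X (ker t) ?f) + ln (1 / p) / (1 / (8 * Bs\<^sup>2))"
          using E4(3)[of \<omega> n] \<omega> unfolding innov_run innov_var_run u2_def by (simp add: E_def)
        also have "\<dots> \<le> 1 / (8 * Bs\<^sup>2) * (\<Sum>t<n. 4 * Bs\<^sup>2 * variance_on X (ker t) U) + ln (1 / p) * (8 * Bs\<^sup>2)"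
          by (intro add_mono mult_left_mono sum_mono vb) auto
        also have "1 / (8 * Bs\<^sup>2) * (\<Sum>t<n. 4 * Bs\<^sup>2 * variance_on X (ker t) U) = (\<Sum>t<n. variance_on X (ker t) U) / 2"
          using Bs by (simp add: sum_distrib_left[symmetric])
        \<comment> \<open>The factor 50 is relaxed to 225 to reach the common constant 225 * 8 =
          1800.\<close>
        also have "ln (1 / p) * (8 * Bs\<^sup>2) \<le> (225 * ?lt) * (8 * Bs\<^sup>2)"
          using lt[of n] log_term_pos[of "B * real n"] by (intro mult_right_mono) auto
        finally show ?thesis by (simp add: mult_ac)
      qed
      show "(\<Sum>t<n. mean_on X (ker t) (\<lambda>x. (V t x - U x)\<^sup>2) - (V t (nx t) - U (nx t))\<^sup>2) \<le>
          (\<Sum>t<n. variance_on X (ker t) (\<lambda>x. V t x - U x)) / 4 + 1800 * B\<^sup>2 * log_term M \<delta> (B * real n)" for n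
      proof -
        let ?lt = "log_term M \<delta> (B * real n)"
        have m: "mean_on X (ker t) (w2 (map \<omega> [0..<t])) = mean_on X (ker t) (\<lambda>x. (V t x - U x)\<^sup>2)" for t
          by (rule mean_on_cong) (simp add: w2_def clipV)
        have v: "variance_on X (ker t) (w2 (map \<omega> [0..<t])) = variance_on X (ker t) (\<lambda>x. (V t x - U x)\<^sup>2)" for t
          unfolding variance_on_def m by (rule arg_cong2[where f = minus, OF mean_on_cong refl]) (simp add: w2_def clipV)
        have vb: "variance_on X (ker t) (\<lambda>x. (V t x - U x)\<^sup>2) \<le> 4 * B\<^sup>2 * variance_on X (ker t) (\<lambda>x. V t x - U x)" for t
        proof -
          have b: "- B \<le> V t x - U x" "V t x - U x \<le> B" if "x \<in> X" for x
            using V_nonneg[OF that, of t] V_le_B[OF that, of t] U(2)[of x] U_le(2)[of x] by auto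
          have "- B \<le> mean_on X (ker t) (\<lambda>x. V t x - U x)" "mean_on X (ker t) (\<lambda>x. V t x - U x) \<le> B"
            using mean_on_mono[of X "ker t" "\<lambda>x. V t x - U x" "\<lambda>_. B"]
              mean_on_mono[of X "ker t" "\<lambda>_. - B" "\<lambda>x. V t x - U x"] b ker_prob
            by (auto simp only: mean_on_const[OF ker_prob(1)])
          then have "\<bar>mean_on X (ker t) (\<lambda>x. V t x - U x) - 0\<bar> \<le> B" by linarith
          moreover have "\<bar>V t x - U x - 0\<bar> \<le> B" if "x \<in> X" for x using b[OF that] by linarith
          ultimately have "variance_on X (ker t) (\<lambda>x. (V t x - U x)\<^sup>2 - 2 * 0 * (V t x - U x)) \<le>
              4 * B\<^sup>2 * variance_on X (ker t) (\<lambda>x. V t x - U x)"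
            by (intro variance_on_square_le ker_prob)
          then show ?thesis by simp
        qed
        have "(\<Sum>t<n. mean_on X (ker t) (\<lambda>x. (V t x - U x)\<^sup>2) - (V t (nx t) - U (nx t))\<^sup>2) \<le>
            1 / (16 * B\<^sup>2) * (\<Sum>t<n. variance_on X (ker t) (\<lambda>x. (V t x - U x)\<^sup>2)) + ln (1 / p) / (1 / (16 * B\<^sup>2))"
          using E5(3)[of \<omega> n] \<omega> unfolding innov_run innov_var_run m v w2_def clipV[OF path(3)] by (simp add: E_def)
        also have "\<dots> \<le> 1 / (16 * B\<^sup>2) * (\<Sum>t<n. 4 * B\<^sup>2 * variance_on X (ker t) (\<lambda>x. V t x - U x)) + ln (1 / p) * (16 * B\<^sup>2)"
          by (intro add_mono mult_left_mono sum_mono vb) auto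
        also have "1 / (16 * B\<^sup>2) * (\<Sum>t<n. 4 * B\<^sup>2 * variance_on X (ker t) (\<lambda>x. V t x - U x)) =
            (\<Sum>t<n. variance_on X (ker t) (\<lambda>x. V t x - U x)) / 4"
          using Bs by (simp add: sum_distrib_left[symmetric])
        also have "ln (1 / p) * (16 * B\<^sup>2) \<le> (225 / 2 * ?lt) * (16 * B\<^sup>2)"
          using lt[of n] log_term_pos[of "B * real n"] by (intro mult_right_mono) auto
        finally show ?thesis by (simp add: mult_ac)
      qed
    qed
    have "regret M \<omega> K \<le> 1000 * c2\<^sup>2 * (sqrt (V_star M * B_star M * real (card S) * real (card A) * real K
        * log_factor M B \<delta> (ep_end \<omega> K)) + B * (real (card S))\<^sup>2 * real (card A) * log_factor M B \<delta> (ep_end \<omega> K))"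
      if K: "1 \<le> K" for K
    proof -
      have g: "goals (ep_end \<omega> K) = K" unfolding goals_eq by (rule card_goals_ep_end[OF inf])
      have V: "V_star M = U (Some (init M))" using U(2)[of "Some (init M)"] U_init by (simp add: V_star_def)
      have "regret M \<omega> K = real K * U (Some (init M)) - (\<Sum>t<ep_end \<omega> K. rew t)"
        unfolding regret_eq[OF inf] U_init by (simp add: rew_def st_def ac_def)
      then show ?thesis
        using regret_bound[OF ep_end_pos[OF inf K]] unfolding g Lam_def[OF ep_end_pos[OF inf K]] N_def NA_def V Bs_def by simp
    qed
    then show ?thesis using inf sp\<omega> by blast
  qed
  have T_sets: "?T \<in> sets (learning M L)"
    by (rule measurable_regret_bound)
  have "1 - \<delta> \<le> 1 - P.prob E" using E_prob by simp
  also have "\<dots> = P.prob (space (learning M L) - E)" by (rule P.prob_compl[OF E_sets, symmetric])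
  also have "\<dots> \<le> P.prob ?T"
  proof (rule P.finite_measure_mono_AE[OF _ T_sets])
    have "AE \<omega> in learning M L. valid_run M L \<omega>" by (rule AE_valid_run) (rule L)
    moreover have "AE \<omega> in learning M L. infinite {t. reaches_goal (\<omega> t)}"
      by (rule AE_infinite_goals) (rule L)
    ultimately show "AE \<omega> in learning M L. \<omega> \<in> space (learning M L) - E \<longrightarrow> \<omega> \<in> ?T"
      by eventually_elim (use main in blast)
  qed
  finally show ?thesis .
qed

end

subsection \<open>A single state and a single action\<close>

lemma mult_ln_le: "0 < x \<Longrightarrow> 0 < k \<Longrightarrow> x * ln (k / x) \<le> (k::real)"
proof -
  assume "0 < x" "0 < k"
  then have "x * ln (k / x) \<le> x * (k / x)"
    using ln_le_minus_one[of "k / x"] by (intro mult_left_mono) auto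
  then show ?thesis using \<open>0 < x\<close> by simp
qed

lemma one_minus_inverse_le_ln: "0 < x \<Longrightarrow> 1 - 1 / x \<le> ln (x::real)"
  using ln_le_minus_one[of "1 / x"] by (simp add: ln_div)

text \<open>From three steps on, the iterated logarithm alone is bounded away from 0; for at most
  two steps only \<open>ln (1 / \<delta>)\<close> is guaranteed, which is why short runs need their
  own event.\<close>

lemma lnln_3_pos: "0 < lnln 3"
proof -
  have "exp (1::real) < 3" using e_less_272 by simp
  then have "1 < ln (3::real)" by (metis exp_less_cancel_iff exp_ln zero_less_numeral)
  then show ?thesis by (simp add: lnln_def)
qed

context nonneg_path_problem
begin

context
  fixes s0 a0 and B \<delta> :: real and L :: "('s, 'a) learner"
  assumes S1: "S = {s0}" and A1: "A = {a0}" and \<delta>: "7 / 8 < \<delta>" "\<delta> < 1"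
    and B: "1 \<le> B" "B_star M \<le> B"
    and L: "\<And>h. L h s0 = a0"
begin

definition "pg = pmf (trans M s0 a0) None"
definition "pf = pmf (trans M s0 a0) (Some s0)"
definition "fail = (s0, a0, Some s0 :: 's option)"

lemma pg_pf: "pg + pf = 1" "0 \<le> pg" "0 \<le> pf" "pg = 1 - pf"
proof -
  have "sum (pmf (trans M s0 a0)) X = 1" by (rule sum_trans) (auto simp: S1 A1)
  then show "pg + pf = 1" by (simp add: S1 pg_def pf_def)
  then show "pg = 1 - pf" by linarith
qed (auto simp: pg_def pf_def)

lemma exp_single: "exp_next M s0 a0 f = pg * f None + pf * f (Some s0)"
  unfolding mean_on_def S1 pg_def pf_def by simp

lemma expectation_single: "(LINT x|trans M s0 a0. f x) = pg * f None + pf * f (Some s0)"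
  by (subst expectation_trans, simp add: S1, simp add: A1, rule exp_single)

lemma prob_fail: "measure (learning M L) {\<omega>. map \<omega> [0..<n] = map (\<lambda>_. fail) [0..<n]} = pf ^ n"
proof -
  have "pmf (learning_step M L (map (\<lambda>_. fail) [0..<i])) fail = pf" for i
  proof -
    have "current_state M (map (\<lambda>_. fail) [0..<i]) = s0"
      using init_S S1 by (cases i) (auto simp: fail_def)
    then have "learning_step M L (map (\<lambda>_. fail) [0..<i]) = map_pmf (\<lambda>x. (s0, a0, x)) (trans M s0 a0)"
      by (simp add: learning_step_def L)
    moreover have "inj (\<lambda>x. (s0, a0, x))" by (simp add: inj_def)
    ultimately show ?thesis
      using pmf_map_inj'[of "\<lambda>x. (s0, a0, x)" "trans M s0 a0" "Some s0"] by (simp only: fail_def pf_def)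
  qed
  then show ?thesis
    unfolding learning_def measure_trajectories_prefix by simp
qed

text \<open>
  The failure probability \<open>pf / 4\<close> costs a term \<open>ln (4 / pf)\<close>, which the variance \<open>pg * pf\<close> absorbs.
\<close>

lemma goal_count_concentration:
  "\<exists>E\<in>sets (learning M L). measure (learning M L) E \<le> pf / 4 \<and>
     (\<forall>\<omega> n. \<omega> \<notin> E \<longrightarrow> valid_run M L \<omega> \<longrightarrow>
        real (card {t. t < n \<and> reaches_goal (\<omega> t)}) - pg * real n \<le>
          3 * sqrt (real (card {t. t < n \<and> reaches_goal (\<omega> t)}) * (7 + 2 * lnln (real n))) + 2 * (7 + 2 * lnln (real n)))"
proof (cases "pf = 0")
  case True
  have "real (card {t. t < n \<and> reaches_goal (\<omega> t)}) - pg * real n \<le>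
      3 * sqrt (real (card {t. t < n \<and> reaches_goal (\<omega> t)}) * (7 + 2 * lnln (real n))) + 2 * (7 + 2 * lnln (real n))" for \<omega> :: "nat \<Rightarrow> ('s, 'a) transition" and n
  proof -
    have "card {t. t < n \<and> reaches_goal (\<omega> t)} \<le> card {..<n}" by (intro card_mono) auto
    then have "real (card {t. t < n \<and> reaches_goal (\<omega> t)}) - pg * real n \<le> 0" using True pg_pf(1-3) by simp
    also have "\<dots> \<le> 3 * sqrt (real (card {t. t < n \<and> reaches_goal (\<omega> t)}) * (7 + 2 * lnln (real n))) + 2 * (7 + 2 * lnln (real n))"
      using lnln_nonneg[of "real n"] by (intro add_nonneg_nonneg mult_nonneg_nonneg real_sqrt_ge_zero) auto
    finally show ?thesis .
  qed
  then show ?thesis using True by (intro bexI[of _ "{}"]) auto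
next
  case False
  then have pf: "0 < pf" "pf \<le> 1" using pg_pf(1-3) by auto
  define Y where "Y h y = (if current_state M h = s0 then (if reaches_goal y then 1 else 0) - pg else 0)"
    for h and y :: "('s, 'a) transition"
  define q where "q h y = (if current_state M h = s0 then pg * pf else 0)" for h :: "('s, 'a) transition list" and y :: "('s, 'a) transition"
  \<comment> \<open>\<open>Y\<close> is at most \<open>pf\<close>, hence at most \<open>R\<close>.
    This choice satisfies \<open>q h y \<le> R\<^sup>2\<close>, and \<open>R\<close> times
    \<open>ln (4 / pf)\<close> stays bounded as \<open>pf\<close> tends to 0.\<close>
  define R where "R = sqrt pf"
  have R: "0 < R" "R\<^sup>2 = pf" "pf \<le> R" "R \<le> 1"
    using pf real_sqrt_le_mono[of "pf\<^sup>2" pf] by (auto simp: R_def power2_eq_square mult_left_le)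
  have step: "(LINT y|learning_step M L h. G y) = pg * G (s0, a0, None) + pf * G (s0, a0, Some s0)"
    if "current_state M h = s0" for h and G :: "('s, 'a) transition \<Rightarrow> real"
    using that by (simp add: learning_step_def L expectation_single)
  have pf1: "pf = 1 - pg" using pg_pf(1) by linarith
  have exp: "(\<integral>\<^sup>+y. ennreal (exp (\<eta> * Y h y - \<eta>\<^sup>2 * q h y)) \<partial>learning_step M L h) \<le> 1"
    if \<eta>: "0 < \<eta>" "\<eta> * R \<le> 1 / 2" for \<eta> h
  proof (cases "current_state M h = s0")
    case True
    have "(LINT y|learning_step M L h. (Y h y)\<^sup>2) = pg * pf"
    proof -
      have "pg * (1 - pg)\<^sup>2 + (1 - pg) * (0 - pg)\<^sup>2 = pg * (1 - pg)"
        by (simp add: power2_eq_square algebra_simps)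
      then show ?thesis unfolding step[OF True] pf1 by (simp add: Y_def True reaches_goal_def)
    qed
    then have q: "q h y = (LINT y|learning_step M L h. (Y h y)\<^sup>2)" for y by (simp add: q_def True)
    show ?thesis unfolding q
    proof (rule nn_integral_exp_cond_variance)
      show "\<bar>Y h y\<bar> \<le> 1" for y using pg_pf(1-3) by (auto simp: Y_def)
      show "(LINT y|learning_step M L h. Y h y) = 0"
      proof -
        have "pg * (1 - pg) + (1 - pg) * (0 - pg) = 0" by (simp add: algebra_simps)
        then show ?thesis unfolding step[OF True] pf1 by (simp add: Y_def True reaches_goal_def)
      qed
      have "Y h y \<le> R" for y using pg_pf(1-3) R by (auto simp: Y_def)
      then have "\<eta> * Y h y \<le> \<eta> * R" for y using \<eta> by (intro mult_left_mono) auto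
      then show "\<eta> * Y h y \<le> 1" for y using \<eta> order_trans[of "\<eta> * Y h y" "\<eta> * R" 1] by simp
    qed
  next
    case False
    then show ?thesis by (simp add: Y_def q_def)
  qed
  have q01: "0 \<le> q h y" "q h y \<le> R\<^sup>2 * 1" for h y
    using pg_pf(1-3) mult_right_mono[of pg 1 pf] by (auto simp: q_def R(2))
  have p4: "0 < pf / 4" "pf / 4 \<le> 1" using pf by auto
  obtain E where E: "E \<in> sets (learning M L)" "measure (learning M L) E \<le> pf / 4"
    "\<And>\<omega> n. \<omega> \<notin> E \<Longrightarrow> (\<Sum>t<n. Y (map \<omega> [0..<t]) (\<omega> t)) \<le>
         3 * sqrt ((\<Sum>t<n. q (map \<omega> [0..<t]) (\<omega> t)) * (ln (1 / (pf / 4)) + 3 + 2 * lnln (\<Sum>t<n. 1))) +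
         2 * R * (ln (1 / (pf / 4)) + 3 + 2 * lnln (\<Sum>t<n. 1))"
    using time_uniform_bernstein[where \<kappa> = "learning_step M L" and Y = Y and q = q and \<nu> = "\<lambda>_ _. 1" and R = R and p = "pf / 4",
        OF R(1) q01 exp p4] unfolding learning_def by blast
  have "real (card {t. t < n \<and> reaches_goal (\<omega> t)}) - pg * real n \<le>
      3 * sqrt (real (card {t. t < n \<and> reaches_goal (\<omega> t)}) * (7 + 2 * lnln (real n))) + 2 * (7 + 2 * lnln (real n))"
    if \<omega>: "\<omega> \<notin> E" "valid_run M L \<omega>" for \<omega> n
  proof -
    define K where "K = real (card {t. t < n \<and> reaches_goal (\<omega> t)})"
    define m where "m = 7 + 2 * lnln (real n)"
    define l where "l = ln (4 / pf) + 3 + 2 * lnln (real n)"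
    have cs: "current_state M (map \<omega> [0..<t]) = s0" for t
    proof -
      have "fst (\<omega> t) = current_state M (map \<omega> [0..<t])" "fst (\<omega> t) \<in> S"
        using \<omega>(2) unfolding valid_run_def by blast+
      then show ?thesis unfolding S1 by (metis singletonD)
    qed
    have K: "K = (\<Sum>t<n. if reaches_goal (\<omega> t) then 1 else 0)"
      by (simp add: K_def sum.If_cases Int_def)
    have Ysum: "(\<Sum>t<n. Y (map \<omega> [0..<t]) (\<omega> t)) = K - pg * real n"
      by (simp add: Y_def cs K sum_subtractf)
    have qsum: "(\<Sum>t<n. q (map \<omega> [0..<t]) (\<omega> t)) = real n * (pg * pf)" by (simp add: q_def cs)
    have main: "K - pg * real n \<le> 3 * sqrt (real n * (pg * pf) * l) + 2 * R * l"
      using E(3)[OF \<omega>(1), of n] unfolding Ysum qsum by (simp add: l_def)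
    have K0: "0 \<le> K" by (simp add: K_def)
    have m0: "7 \<le> m" using lnln_nonneg[of "real n"] by (simp add: m_def)
    show ?thesis unfolding K_def[symmetric] m_def[symmetric]
    proof (cases "pg * real n \<le> K")
      case True
      have "0 \<le> ln (4 / pf)" using pf by simp
      then have l0: "0 \<le> l" using lnln_nonneg[of "real n"] by (simp add: l_def)
      \<comment> \<open>Both \<open>pf * ln (4 / pf)\<close> and \<open>R * ln (4 / pf)\<close> are
        at most 4; together with the 3 in \<open>l\<close> this gives the 7 in
        \<open>m\<close>.\<close>
      have 1: "pf * l \<le> m"
      proof -
        have "pf * (3 + 2 * lnln (real n)) \<le> 1 * (3 + 2 * lnln (real n))"
          using pf lnln_nonneg[of "real n"] by (intro mult_right_mono) auto
        then show ?thesis using mult_ln_le[of pf 4] pf by (simp add: l_def m_def algebra_simps)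
      qed
      have 2: "R * l \<le> m"
      proof -
        have "R * (3 + 2 * lnln (real n)) \<le> 1 * (3 + 2 * lnln (real n))"
          using R lnln_nonneg[of "real n"] by (intro mult_right_mono) auto
        moreover have "R * ln (4 / pf) = 2 * (R * ln (2 / R))"
        proof -
          have "4 / pf = (2 / R)\<^sup>2" by (simp add: power_divide R)
          then show ?thesis using R by (simp add: ln_realpow)
        qed
        ultimately show ?thesis using mult_ln_le[of R 2] R by (simp add: l_def m_def algebra_simps)
      qed
      \<comment> \<open>In this case the observed count \<open>K\<close> exceeds its mean
        \<open>pg * real n\<close> and can replace it under the root.\<close>
      have "real n * (pg * pf) * l \<le> K * m"
      proof -
        have "(pg * real n) * (pf * l) \<le> K * m"
          using True 1 K0 l0 pf pg_pf(1-3) m0 by (intro mult_mono) auto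
        then show ?thesis by (simp add: mult_ac)
      qed
      then have "sqrt (real n * (pg * pf) * l) \<le> sqrt (K * m)" by (rule real_sqrt_le_mono)
      moreover have "2 * R * l = 2 * (R * l)" by simp
      ultimately show "K - pg * real n \<le> 3 * sqrt (K * m) + 2 * m" using main 2 by linarith
    next
      case False
      then have "K - pg * real n \<le> 0" by simp
      also have "0 \<le> 3 * sqrt (K * m) + 2 * m" using K0 m0 by simp
      finally show "K - pg * real n \<le> 3 * sqrt (K * m) + 2 * m" .
    qed
  qed
  then show ?thesis using E by blast
qed

text \<open>
  For runs of at most two steps the logarithmic term can be as small as \<open>1 - \<delta>\<close>; there the regret is at
  most \<open>2 * pf\<close>, and if this is too large, the runs that start with failures are already likely enough.
\<close>

lemma early_event:
  "\<exists>F\<in>sets (learning M L). (1 - \<delta>) + pf / 4 \<le> measure (learning M L) F \<and>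
     (\<forall>\<omega>\<in>F. \<forall>n. 1 \<le> n \<longrightarrow> n \<le> 2 \<longrightarrow> reaches_goal (\<omega> (n - 1)) \<longrightarrow>
        real (card {t. t < n \<and> reaches_goal (\<omega> t)}) - pg * real n \<le> 16 * (1 - \<delta>))"
proof -
  interpret P: prob_space "learning M L" unfolding learning_def by (rule prob_space_trajectories)
  have sp: "space (learning M L) = UNIV" by (simp add: learning_def)
  have card_le: "card {t. t < n \<and> reaches_goal (\<omega> t)} \<le> n" for n and \<omega> :: "nat \<Rightarrow> ('s, 'a) transition"
    using card_mono[of "{..<n}" "{t. t < n \<and> reaches_goal (\<omega> t)}"] by auto
  let ?F = "\<lambda>n. {\<omega>. map \<omega> [0..<n] = map (\<lambda>_. fail) [0..<n]}"
  have F_sets: "?F n \<in> sets (learning M L)" for n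
  proof -
    have "(\<lambda>\<omega>. map \<omega> [0..<n]) \<in> learning M L \<rightarrow>\<^sub>M count_space UNIV"
      unfolding learning_def by (rule measurable_prefix)
    from measurable_sets[OF this, of "{map (\<lambda>_. fail) [0..<n]}"] show ?thesis by (simp add: sp vimage_def)
  qed
  have F_fail: "\<not> reaches_goal (\<omega> i)" if "\<omega> \<in> ?F n" "i < n" for \<omega> n i
  proof -
    have "\<omega> i = fail" using that by (auto simp: map_eq_conv)
    then show ?thesis by (simp add: reaches_goal_def fail_def)
  qed
  consider "2 * pf \<le> 16 * (1 - \<delta>)" | "8 * (1 - \<delta>) < pf" "1 / 2 \<le> pg" | "8 * (1 - \<delta>) < pf" "pg < 1 / 2"
    by linarith
  then show ?thesis
  proof cases
    case 1
    have "real (card {t. t < n \<and> reaches_goal (\<omega> t)}) - pg * real n \<le> 16 * (1 - \<delta>)"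
      if "n \<le> 2" for n and \<omega> :: "nat \<Rightarrow> ('s, 'a) transition"
    proof -
      have "real (card {t. t < n \<and> reaches_goal (\<omega> t)}) \<le> real n" using card_le by simp
      moreover have "real n - pg * real n = pf * real n" by (simp add: pg_pf(4) algebra_simps)
      moreover have "pf * real n \<le> pf * 2" using that pg_pf(1-3) by (intro mult_left_mono) auto
      ultimately show ?thesis using 1 by linarith
    qed
    moreover have "(1 - \<delta>) + pf / 4 \<le> P.prob (space (learning M L))"
      using \<delta> pg_pf(1-3) unfolding P.prob_space by linarith
    ultimately show ?thesis by (intro bexI[of _ "space (learning M L)"]) auto
  next
    case 2
    have "real (card {t. t < n \<and> reaches_goal (\<omega> t)}) - pg * real n \<le> 16 * (1 - \<delta>)"
      if n: "1 \<le> n" "n \<le> 2" "reaches_goal (\<omega> (n - 1))" and \<omega>: "\<omega> \<in> ?F 1" for n \<omega>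
    proof -
      have f: "\<not> reaches_goal (\<omega> 0)" using F_fail[OF \<omega>, of 0] by simp
      then have "n \<noteq> 1" using n by auto
      then have n2: "n = 2" using n by linarith
      have "{t. t < n \<and> reaches_goal (\<omega> t)} \<subseteq> {1}" using f by (auto simp: n2 less_2_cases_iff)
      then have "card {t. t < n \<and> reaches_goal (\<omega> t)} \<le> 1" using card_mono[of "{1::nat}"] by fastforce
      then have "real (card {t. t < n \<and> reaches_goal (\<omega> t)}) \<le> 1" by simp
      then show ?thesis using 2 \<delta> by (simp add: n2)
    qed
    moreover have "(1 - \<delta>) + pf / 4 \<le> P.prob (?F 1)"
      using prob_fail[of 1] 2 \<delta> by simp
    ultimately show ?thesis using F_sets[of 1] by blast
  next
    case 3
    have False if n: "1 \<le> n" "n \<le> 2" "reaches_goal (\<omega> (n - 1))" and \<omega>: "\<omega> \<in> ?F 2" for n \<omega>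
      using F_fail[OF \<omega>, of "n - 1"] n by simp
    moreover have "(1 - \<delta>) + pf / 4 \<le> P.prob (?F 2)"
    proof -
      have "pf / 2 = pf * (1 / 2)" by simp
      also have "\<dots> \<le> pf * pf" using 3 pg_pf(1-3) by (intro mult_left_mono) auto
      also have "\<dots> = P.prob (?F 2)"
        unfolding power2_eq_square[symmetric] by (rule prob_fail[symmetric])
      finally have "pf / 2 \<le> P.prob (?F 2)" .
      moreover have "(1 - \<delta>) + pf / 4 \<le> pf / 2" using 3(1) \<delta>(2) by (simp add: field_simps)
      ultimately show ?thesis by (rule order_trans[rotated])
    qed
    ultimately show ?thesis using F_sets[of 2] by blast
  qed
qed

text \<open>The Bellman equation reads \<open>reward = pg * u\<close>, so the regret is
  \<open>u\<close> times the excess of the number of goals over its mean. The surplus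
  \<open>pf / 4\<close> in the probability of the early event pays exactly for the exceptional set
  of the concentration bound.\<close>

lemma single_state_regret:
  fixes c :: real
  assumes Bs: "1 \<le> B_star M" and c: "21 / lnln 3 + 22 \<le> c"
  shows "measure (learning M L)
         {\<omega> \<in> space (learning M L).
            infinite {t. reaches_goal (\<omega> t)} \<and>
            (\<forall>K\<ge>1. regret M \<omega> K \<le>
               c * (sqrt (V_star M * B_star M * real (card (states M)) * real (card (actions M)) * real K
                          * log_factor M B \<delta> (ep_end \<omega> K))
                    + B * (real (card (states M)))\<^sup>2 * real (card (actions M))
                      * log_factor M B \<delta> (ep_end \<omega> K)))}
       \<ge> 1 - \<delta>" (is "measure ?P ?T \<ge> _")
proof -
  interpret P: prob_space "learning M L" unfolding learning_def by (rule prob_space_trajectories)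
  have sp: "space (learning M L) = UNIV" by (simp add: learning_def)
  have LA: "L h s \<in> A" if "s \<in> S" for h s using that L S1 A1 by auto
  obtain U :: "'s option \<Rightarrow> real" where U: "U None = 0" "\<And>x. 0 \<le> U x" "\<And>x. U x \<le> B_star M"
    "\<And>s. s \<in> S \<Longrightarrow> U (Some s) = opt_value M s"
    "\<And>s a. s \<in> S \<Longrightarrow> a \<in> A \<Longrightarrow> reward M s a + exp_next M s a U \<le> U (Some s)"
    "\<And>s. s \<in> S \<Longrightarrow> \<exists>a\<in>A. U (Some s) = reward M s a + exp_next M s a U"
    using opt_value_bellman_bounded by blast
  define u where "u = U (Some s0)"
  have init: "init M = s0" using init_S S1 by simp
  have opt: "opt_value M s0 = u" using U(4)[of s0] S1 by (simp add: u_def)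
  have u0: "0 \<le> u" using U(2) by (simp add: u_def)
  have Vs: "V_star M = u" "B_star M = u" using u0 by (simp_all add: V_star_def B_star_def init opt S1)
  have "\<exists>a\<in>A. U (Some s0) = reward M s0 a + exp_next M s0 a U" by (rule U(6)) (simp add: S1)
  then obtain a where "a \<in> A" "U (Some s0) = reward M s0 a + exp_next M s0 a U" by blast
  moreover from this have "a = a0" using A1 by blast
  ultimately have "u = reward M s0 a0 + pf * u"
    by (simp only: exp_single U(1) u_def mult_zero_right add_0_left)
  then have r: "reward M s0 a0 = pg * u" using pg_pf(1) by (simp add: pg_pf(4) algebra_simps)
  have \<delta>pos: "0 < \<delta>" using \<delta> by simp
  \<comment> \<open>\<open>C0\<close> times the log factor dominates \<open>7 + 2 * lnln n\<close>
    once \<open>n\<close> is at least 3, and \<open>3 * C0 + 16\<close> is the threshold assumed for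
    \<open>c\<close>.\<close>
  define C0 where "C0 = 7 / lnln 3 + 2"
  have C0: "1 \<le> C0" "3 * C0 + 16 \<le> c" using c lnln_3_pos by (auto simp: C0_def)
  have lam: "log_factor M B \<delta> n = (ln (1 / \<delta>) + lnln (B * real n)) * max 1 (ln (real n))" for n
    by (simp add: log_factor_def log_term_def S1 A1)
  have ln\<delta>: "1 - \<delta> \<le> ln (1 / \<delta>)" using one_minus_inverse_le_ln[of "1 / \<delta>"] \<delta>pos by simp
  have lam_ge: "(1 - \<delta>) + lnln (real n) \<le> log_factor M B \<delta> n" for n
  proof -
    have "lnln (real n) \<le> lnln (B * real n)" using B mult_right_mono[of 1 B "real n"] by (intro lnln_mono) auto
    then have "(1 - \<delta>) + lnln (real n) \<le> ln (1 / \<delta>) + lnln (B * real n)" using ln\<delta> by simp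
    also have "\<dots> \<le> (ln (1 / \<delta>) + lnln (B * real n)) * max 1 (ln (real n))"
      using ln\<delta> \<delta> lnln_nonneg[of "B * real n"] mult_left_mono[of 1 "max 1 (ln (real n))" "ln (1 / \<delta>) + lnln (B * real n)"] by simp
    finally show ?thesis by (simp add: lam)
  qed
  obtain E where E: "E \<in> sets (learning M L)" "P.prob E \<le> pf / 4"
    "\<And>\<omega> n. \<omega> \<notin> E \<Longrightarrow> valid_run M L \<omega> \<Longrightarrow> real (card {t. t < n \<and> reaches_goal (\<omega> t)}) - pg * real n \<le>
      3 * sqrt (real (card {t. t < n \<and> reaches_goal (\<omega> t)}) * (7 + 2 * lnln (real n))) + 2 * (7 + 2 * lnln (real n))"
    using goal_count_concentration by blast
  obtain F where F: "F \<in> sets (learning M L)" "(1 - \<delta>) + pf / 4 \<le> P.prob F"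
    "\<And>\<omega> n. \<omega> \<in> F \<Longrightarrow> 1 \<le> n \<Longrightarrow> n \<le> 2 \<Longrightarrow> reaches_goal (\<omega> (n - 1)) \<Longrightarrow>
      real (card {t. t < n \<and> reaches_goal (\<omega> t)}) - pg * real n \<le> 16 * (1 - \<delta>)"
    using early_event by blast
  have main: "\<omega> \<in> ?T" if \<omega>: "\<omega> \<in> F" "\<omega> \<notin> E" and valid: "valid_run M L \<omega>" and inf: "infinite {t. reaches_goal (\<omega> t)}" for \<omega>
  proof -
    have "regret M \<omega> K \<le> c * (sqrt (V_star M * B_star M * real (card S) * real (card A) * real K
        * log_factor M B \<delta> (ep_end \<omega> K)) + B * (real (card S))\<^sup>2 * real (card A) * log_factor M B \<delta> (ep_end \<omega> K))"
      if K: "1 \<le> K" for K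
    proof -
      define n where "n = ep_end \<omega> K"
      define lf where "lf = log_factor M B \<delta> n"
      have n: "1 \<le> n" "reaches_goal (\<omega> (n - 1))"
        using ep_end_pos[OF inf K] ep_end_Suc(2)[OF inf, of "K - 1"] K by (simp_all add: n_def Suc_le_eq)
      have cK: "card {t. t < n \<and> reaches_goal (\<omega> t)} = K" unfolding n_def by (rule card_goals_ep_end[OF inf])
      have sa: "fst (\<omega> t) = s0" "fst (snd (\<omega> t)) = a0" for t
      proof -
        have "fst (\<omega> t) \<in> S" "fst (snd (\<omega> t)) \<in> A" using valid unfolding valid_run_def by blast+
        then show "fst (\<omega> t) = s0" "fst (snd (\<omega> t)) = a0" unfolding S1 A1 by auto
      qed
      have reg: "regret M \<omega> K = u * (real K - pg * real n)"
        unfolding regret_eq[OF inf] n_def[symmetric] by (simp add: sa init opt r algebra_simps)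
      have lf: "1 - \<delta> \<le> lf" "lnln (real n) \<le> lf" "0 \<le> lf"
        using lam_ge[of n, folded lf_def] \<delta> lnln_nonneg[of "real n"] by linarith+
      have sq0: "0 \<le> sqrt (real K * lf)" using lf by simp
      have "real K - pg * real n \<le> (3 * C0 + 16) * (sqrt (real K * lf) + lf)"
      proof (cases "n \<le> 2")
        case True
        have "real K - pg * real n \<le> 16 * (1 - \<delta>)" using F(3)[OF \<omega>(1) n(1) True n(2)] unfolding cK .
        also have "\<dots> \<le> 16 * lf" using lf by simp
        also have "\<dots> \<le> (3 * C0 + 16) * lf" using C0 lf by (intro mult_right_mono) auto
        also have "\<dots> \<le> (3 * C0 + 16) * (sqrt (real K * lf) + lf)" using C0 sq0 by (intro mult_left_mono) auto
        finally show ?thesis .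
      next
        case False
        then have "lnln 3 \<le> lnln (real n)" by (intro lnln_mono) auto
        then have "7 * 1 \<le> 7 * (lf / lnln 3)" using lf lnln_3_pos by (intro mult_left_mono) auto
        then have m: "7 + 2 * lnln (real n) \<le> C0 * lf" using lf by (simp add: C0_def algebra_simps)
        have "sqrt (real K * (7 + 2 * lnln (real n))) \<le> C0 * sqrt (real K * lf) + 0"
        proof (rule sqrt_le_of_add_squares)
          have "C0 * 1 \<le> C0 * C0" using C0 by (intro mult_left_mono) auto
          then have "C0 * lf \<le> C0\<^sup>2 * lf" using lf by (intro mult_right_mono) (auto simp: power2_eq_square)
          then have "real K * (7 + 2 * lnln (real n)) \<le> real K * (C0\<^sup>2 * lf)" using m by (intro mult_left_mono) auto
          then show "real K * (7 + 2 * lnln (real n)) \<le> C0\<^sup>2 * (real K * lf) + 0\<^sup>2" by (simp add: mult_ac)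
        qed (use C0 lf in auto)
        then have "3 * sqrt (real K * (7 + 2 * lnln (real n))) + 2 * (7 + 2 * lnln (real n)) \<le>
            3 * (C0 * sqrt (real K * lf)) + 2 * (C0 * lf)"
          using m by (intro add_mono mult_left_mono) auto
        then have "real K - pg * real n \<le> 3 * (C0 * sqrt (real K * lf)) + 2 * (C0 * lf)"
          using E(3)[OF \<omega>(2) valid, of n] unfolding cK by (rule order_trans[rotated])
        also have "\<dots> \<le> (3 * C0 + 16) * (sqrt (real K * lf) + lf)"
          using C0 lf sq0 by (simp add: algebra_simps)
        finally show ?thesis .
      qed
      also have "\<dots> \<le> c * (sqrt (real K * lf) + lf)" using C0 lf sq0 by (intro mult_right_mono) auto
      finally have "regret M \<omega> K \<le> u * (c * (sqrt (real K * lf) + lf))"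
        unfolding reg using u0 by (intro mult_left_mono)
      also have "\<dots> = c * (sqrt (u * u * real K * lf) + u * lf)"
        using u0 by (simp add: real_sqrt_mult algebra_simps)
      also have "\<dots> \<le> c * (sqrt (u * u * real K * lf) + B * lf)"
        using C0 lf B Vs by (intro mult_left_mono add_left_mono mult_right_mono) auto
      finally show ?thesis by (simp add: Vs S1 A1 lf_def n_def)
    qed
    then show ?thesis using inf sp by blast
  qed
  have T_sets: "?T \<in> sets (learning M L)" by (rule measurable_regret_bound)
  have "P.prob F \<le> P.prob ((F - E) \<union> E)" using E(1) F(1) by (intro P.finite_measure_mono) auto
  also have "\<dots> \<le> P.prob (F - E) + P.prob E" using E(1) F(1) by (intro measure_Un_le) auto
  finally have "1 - \<delta> \<le> P.prob (F - E)" using E(2) F(2) by linarith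
  also have "\<dots> \<le> P.prob ?T"
  proof (rule P.finite_measure_mono_AE[OF _ T_sets])
    have "AE \<omega> in learning M L. valid_run M L \<omega>" by (rule AE_valid_run) (rule LA)
    moreover have "AE \<omega> in learning M L. infinite {t. reaches_goal (\<omega> t)}"
      by (rule AE_infinite_goals) (rule LA)
    ultimately show "AE \<omega> in learning M L. \<omega> \<in> F - E \<longrightarrow> \<omega> \<in> ?T"
      by eventually_elim (use main in blast)
  qed
  finally show ?thesis .
qed

end

end

theorem theorem6:
  shows "\<exists>C>0. \<forall>c1 c2 :: real. C \<le> c1 \<longrightarrow> C \<le> c2 \<longrightarrow> 2 * c1\<^sup>2 \<le> c2 \<longrightarrow>
    (\<exists>c>0. \<forall>(M :: (nat, nat) path_problem) (B :: real) (\<delta> :: real) (L :: (nat, nat) learner).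
       stochastic_path M \<longrightarrow>
       (\<forall>\<pi>\<in>HD_policies M. proper M \<pi>) \<longrightarrow>
       (\<forall>s\<in>states M. \<forall>a\<in>actions M. 0 \<le> reward M s a) \<longrightarrow>
       1 \<le> V_star M \<longrightarrow> 1 \<le> B_star M \<longrightarrow>
       1 \<le> B \<longrightarrow> B_star M \<le> B \<longrightarrow> 0 < \<delta> \<longrightarrow> \<delta> < 1 \<longrightarrow>
       runs_VI_SP M c1 c2 B \<delta> L \<longrightarrow>
       measure (learning M L)
         {\<omega> \<in> space (learning M L).
            infinite {t. reaches_goal (\<omega> t)} \<and>
            (\<forall>K\<ge>1. regret M \<omega> K \<le>
               c * (sqrt (V_star M * B_star M * real (card (states M)) * real (card (actions M)) * real K
                          * log_factor M B \<delta> (ep_end \<omega> K))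
                    + B * (real (card (states M)))\<^sup>2 * real (card (actions M))
                      * log_factor M B \<delta> (ep_end \<omega> K)))}
       \<ge> 1 - \<delta>)"
proof (rule exI[of _ "3600 :: real"], intro conjI allI impI)
  fix c1 c2 :: real
  \<comment> \<open>3600 is twice the concentration constant 1800, as optimism requires.\<close>
  assume c: "3600 \<le> c1" "3600 \<le> c2" "2 * c1\<^sup>2 \<le> c2"
  define c where "c = max (1000 * c2\<^sup>2) (21 / lnln 3 + 22)"
  have "0 < 21 / lnln 3 + 22" using lnln_3_pos by (simp add: add_pos_pos)
  then have "0 < c" by (simp add: c_def)
  then show "\<exists>c>0. \<forall>(M :: (nat, nat) path_problem) (B :: real) (\<delta> :: real) (L :: (nat, nat) learner).
       stochastic_path M \<longrightarrow>
       (\<forall>\<pi>\<in>HD_policies M. proper M \<pi>) \<longrightarrow>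
       (\<forall>s\<in>states M. \<forall>a\<in>actions M. 0 \<le> reward M s a) \<longrightarrow>
       1 \<le> V_star M \<longrightarrow> 1 \<le> B_star M \<longrightarrow>
       1 \<le> B \<longrightarrow> B_star M \<le> B \<longrightarrow> 0 < \<delta> \<longrightarrow> \<delta> < 1 \<longrightarrow>
       runs_VI_SP M c1 c2 B \<delta> L \<longrightarrow>
       measure (learning M L)
         {\<omega> \<in> space (learning M L).
            infinite {t. reaches_goal (\<omega> t)} \<and>
            (\<forall>K\<ge>1. regret M \<omega> K \<le>
               c * (sqrt (V_star M * B_star M * real (card (states M)) * real (card (actions M)) * real K
                          * log_factor M B \<delta> (ep_end \<omega> K))
                    + B * (real (card (states M)))\<^sup>2 * real (card (actions M))
                      * log_factor M B \<delta> (ep_end \<omega> K)))}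
       \<ge> 1 - \<delta>"
  proof (intro exI[of _ c] conjI allI impI)
    fix M :: "(nat, nat) path_problem" and B \<delta> :: real and L :: "(nat, nat) learner"
    assume sp: "stochastic_path M" and proper: "\<forall>\<pi>\<in>HD_policies M. proper M \<pi>"
      and rew: "\<forall>s\<in>states M. \<forall>a\<in>actions M. 0 \<le> reward M s a"
      and Bs: "1 \<le> B_star M" "1 \<le> B" "B_star M \<le> B" and \<delta>: "0 < \<delta>" "\<delta> < 1"
      and run: "runs_VI_SP M c1 c2 B \<delta> L"
    interpret nonneg_path_problem M
      using sp proper rew by unfold_locales auto
    interpret P: prob_space "learning M L" unfolding learning_def by (rule prob_space_trajectories)
    have cards: "1 \<le> card (states M)" "1 \<le> card (actions M)"
      using A_ne init_S by (auto simp: Suc_le_eq card_gt_0_iff simp del: init_S)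
    then have "1 \<le> card (states M) * card (actions M)" by (simp add: Suc_le_eq)
    let ?n = "real (card (states M)) * real (card (actions M))"
    have n: "1 \<le> ?n" using \<open>1 \<le> card (states M) * card (actions M)\<close> by (metis of_nat_1 of_nat_le_iff of_nat_mult)
    show "1 - \<delta> \<le> measure (learning M L)
         {\<omega> \<in> space (learning M L).
            infinite {t. reaches_goal (\<omega> t)} \<and>
            (\<forall>K\<ge>1. regret M \<omega> K \<le>
               c * (sqrt (V_star M * B_star M * real (card (states M)) * real (card (actions M)) * real K
                          * log_factor M B \<delta> (ep_end \<omega> K))
                    + B * (real (card (states M)))\<^sup>2 * real (card (actions M))
                      * log_factor M B \<delta> (ep_end \<omega> K)))}"
    proof (cases "1 / 8 \<le> ln (?n / \<delta>)")
      case True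
      have log_lb: "1 / 8 \<le> log_term M \<delta> x" for x
        unfolding log_term_def using True lnln_nonneg[of x] by linarith
      have "1000 * c2\<^sup>2 * r \<le> c * r" if "0 \<le> r" for r
        using that by (intro mult_right_mono) (auto simp: c_def)
      moreover have "0 \<le> log_factor M B \<delta> k" for k
        using log_lb[of "B * real k"] by (simp add: log_factor_def)
      moreover have "0 \<le> V_star M" by (simp add: V_star_def)
      ultimately have le: "x \<le> 1000 * c2\<^sup>2 * (sqrt (V_star M * B_star M * real (card (states M)) * real (card (actions M)) * real K
            * log_factor M B \<delta> k) + B * (real (card (states M)))\<^sup>2 * real (card (actions M)) * log_factor M B \<delta> k) \<Longrightarrow>
          x \<le> c * (sqrt (V_star M * B_star M * real (card (states M)) * real (card (actions M)) * real K
            * log_factor M B \<delta> k) + B * (real (card (states M)))\<^sup>2 * real (card (actions M)) * log_factor M B \<delta> k)" for x K k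
        using Bs by (elim order_trans) (simp add: add_nonneg_nonneg)
      show ?thesis
        by (rule order_trans[OF regret_high_probability[OF c(1,3) Bs(1,3) \<delta> run log_lb]],
            rule P.finite_measure_mono[OF _ measurable_regret_bound]) (use le in blast)
    next
      case False
      \<comment> \<open>By this bound two or more pairs would give a logarithm of at least 1/2, so
        the present case leaves a single pair and \<delta> above 7/8.\<close>
      have ln_ge: "1 - \<delta> / ?n \<le> ln (?n / \<delta>)"
        using one_minus_inverse_le_ln[of "?n / \<delta>"] n \<delta> by (simp only: divide_divide_eq_right mult_1_left) simp
      have "\<not> 2 \<le> card (states M) * card (actions M)"
      proof
        assume "2 \<le> card (states M) * card (actions M)"
        then have "2 \<le> ?n" by (metis of_nat_le_iff of_nat_mult of_nat_numeral)
        then have "\<delta> / ?n \<le> 1 / 2" using \<delta> by (simp add: divide_le_eq)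
        then show False using False ln_ge by linarith
      qed
      then have "card (states M) * card (actions M) = 1" using \<open>1 \<le> card (states M) * card (actions M)\<close> by linarith
      then obtain s0 a0 where SA: "states M = {s0}" "actions M = {a0}"
        by (auto simp: card_1_singleton_iff)
      then have "7 / 8 < \<delta>" using False ln_ge by simp
      moreover have "L h s0 = a0" for h
        using run SA by (auto simp: runs_VI_SP_def is_arg_max_def)
      ultimately show ?thesis
        using SA \<delta> Bs by (intro single_state_regret) (auto simp: c_def)
    qed
  qed simp
qed simp

end
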